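(* Let $k(u_1,u_2,u_3,v_1,v_2,v_3,x)$ be an interaction rate of type 1 (three-dimensional) and assume $k(u_1,\dots,v_3,x)\ge k_1(x)(u_1+u_2+u_3+v_1+v_2+v_3)^\alpha$ for some $\alpha\in[0,1]$ and some $k_1\in L^\infty(\mathbb{T}^3)$ with $\operatorname{ess\,inf}k_1>0$. Let $0\le u_{0,i},v_{0,i}\in L^\infty(\mathbb{T}^3)$, $M:=\max_i\{\|u_{0,i}\|_{L^\infty},\|v_{0,i}\|_{L^\infty}\}$, and assume $m_\infty:=\frac16\int_{\mathbb{T}^3}\sum_i(u_{0,i}+v_{0,i})dx>0$. Let $(u_i,v_i)$ be the weak solution of the three-dimensional system with these data. Then there exist positive constants $\tilde\Lambda_\alpha$ (depending only on $M,m_\infty,c$) and $\tilde\lambda_\alpha$ (depending only on $M,m_\infty,c,\alpha$, $\operatorname{ess\,inf}k_1$ and the bound $\kappa_1(M)$ of $k$) such that for all $t\ge0$ $$\sum_{i=1}^3\int_{\mathbb{T}^3}\big[(u_i(t)-m_\infty)^2+(v_i(t)-m_\infty)^2\big]dx\le\tilde\Lambda_\alpha e^{-2\tilde\lambda_\alpha t}\sum_{i=1}^3\int_{\mathbb{T}^3}\big[(u_{0,i}-m_\infty)^2+(v_{0,i}-m_\infty)^2\big]dx.$$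
   Context: $\mathbb{T}^3=\mathbb{R}^3/\mathbb{Z}^3$ with Lebesgue measure of total mass $1$; $c>0$ fixed; $\rho:=\sum_{i=1}^3(u_i+v_i)$. The three-dimensional system is $\partial_t u_i+c\partial_{x_i}u_i=k(\rho-6u_i)$, $\partial_t v_i-c\partial_{x_i}v_i=k(\rho-6v_i)$, $i=1,2,3$, with initial data $u_{0,i},v_{0,i}$. A weak solution is a family of nonnegative $u_i,v_i\in L^\infty([0,T)\times\mathbb{T}^3)\cap C([0,T];L^p(\mathbb{T}^3))$ for all $T,p\in[1,\infty)$ satisfying, for all $\psi\in C_c^\infty([0,\infty)\times\mathbb{T}^3)$, $\int_0^\infty\!\int u_i(\partial_t\psi+c\partial_{x_i}\psi)+\int\psi(0)u_{0,i}+\int_0^\infty\!\int k(\rho-6u_i)\psi=0$ and the analogous identity for $v_i$ with $-c\partial_{x_i}$ and $k(\rho-6v_i)$. An interaction rate is a nonnegative measurable $k$ on $[0,\infty)^6\times\mathbb{T}^3$; it is of type 1 if for every $\gamma>0$ there is $\kappa_1(\gamma)>0$ with $k\le\kappa_1(\gamma)$ whenever $0\le u_i,v_i\le\gamma$ for all $i$. Known fact (Lions–Toscani): for $k$ of type 1 and nonnegative $L^\infty$ data there is a unique weak solution, and it satisfies $0\le u_i(t),v_i(t)\le M$ for all $t\ge0$. *)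

theory Defs
  imports "HOL-Analysis.Analysis"
begin

text \<open>The torus T^3 = R^3/Z^3 is represented by its fundamental domain, the closed unit
cube (boundary is a null set), equipped with Lebesgue measure (total mass 1).
Functions on T^3 are functions on real^3 of which only the values on the cube matter;
test functions are smooth and Z^3-periodic in the space variable.
The three coordinate directions / components are indexed by the type 3.\<close>

definition T3 :: "(real^3) set" where
  "T3 = {x. \<forall>i. 0 \<le> x$i \<and> x$i \<le> 1}"

fun Ck :: "nat \<Rightarrow> ('a::euclidean_space \<Rightarrow> real) \<Rightarrow> bool" where
  "Ck 0 f = continuous_on UNIV f"
| "Ck (Suc n) f = ((\<forall>x. f differentiable (at x)) \<and>
      (\<forall>w. Ck n (\<lambda>x. frechet_derivative f (at x) w)))"

definition smooth_fun :: "('a::euclidean_space \<Rightarrow> real) \<Rightarrow> bool" where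
  "smooth_fun f \<longleftrightarrow> (\<forall>n. Ck n f)"

text \<open>Test functions in C_c^infinity([0,infinity) x T^3) (time first).\<close>
definition test_fun :: "(real \<times> (real^3) \<Rightarrow> real) \<Rightarrow> bool" where
  "test_fun \<psi> \<longleftrightarrow> smooth_fun \<psi> \<and>
     (\<forall>t x i. \<psi> (t, x + axis i 1) = \<psi> (t, x)) \<and>
     (\<exists>T. \<forall>t x. T \<le> t \<longrightarrow> \<psi> (t, x) = 0)"

definition dt :: "(real \<times> (real^3) \<Rightarrow> real) \<Rightarrow> real \<Rightarrow> real^3 \<Rightarrow> real" where
  "dt \<psi> t x = frechet_derivative \<psi> (at (t, x)) (1, 0)"

definition dx :: "(real \<times> (real^3) \<Rightarrow> real) \<Rightarrow> 3 \<Rightarrow> real \<Rightarrow> real^3 \<Rightarrow> real" where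
  "dx \<psi> i t x = frechet_derivative \<psi> (at (t, x)) (0, axis i 1)"

text \<open>Power with the convention s^0 = 1 (also for s = 0).\<close>
definition rpow :: "real \<Rightarrow> real \<Rightarrow> real" where
  "rpow s a = (if a = 0 then 1 else s powr a)"

definition ess_inf_T3 :: "(real^3 \<Rightarrow> real) \<Rightarrow> real" where
  "ess_inf_T3 f = Sup {d. AE x in lebesgue_on T3. d \<le> f x}"

definition Linf_T3 :: "(real^3 \<Rightarrow> real) \<Rightarrow> real" where
  "Linf_T3 f = Inf {C. AE x in lebesgue_on T3. \<bar>f x\<bar> \<le> C}"

definition Linf_fun_T3 :: "(real^3 \<Rightarrow> real) \<Rightarrow> bool" where
  "Linf_fun_T3 f \<longleftrightarrow> f \<in> borel_measurable (lebesgue_on T3) \<and>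
     (\<exists>C. AE x in lebesgue_on T3. \<bar>f x\<bar> \<le> C)"

definition int_T3 :: "(real^3 \<Rightarrow> real) \<Rightarrow> real" where
  "int_T3 f = integral\<^sup>L (lebesgue_on T3) f"

definition int_QT :: "(real \<Rightarrow> real^3 \<Rightarrow> real) \<Rightarrow> real" where
  "int_QT f = integral\<^sup>L (lebesgue_on ({0..} \<times> T3)) (\<lambda>z. f (fst z) (snd z))"

definition interaction_rate :: "(real^3 \<Rightarrow> real^3 \<Rightarrow> real^3 \<Rightarrow> real) \<Rightarrow> bool" where
  "interaction_rate k \<longleftrightarrow>
     (\<lambda>z. k (fst z) (fst (snd z)) (snd (snd z))) \<in> borel_measurable borel \<and>
     (\<forall>a b x. (\<forall>i. 0 \<le> a$i \<and> 0 \<le> b$i) \<longrightarrow> 0 \<le> k a b x)"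

definition type1_with :: "(real^3 \<Rightarrow> real^3 \<Rightarrow> real^3 \<Rightarrow> real) \<Rightarrow> (real \<Rightarrow> real) \<Rightarrow> bool" where
  "type1_with k \<kappa>1 \<longleftrightarrow> (\<forall>\<gamma>>0. 0 < \<kappa>1 \<gamma> \<and>
     (\<forall>a b x. (\<forall>i. 0 \<le> a$i \<and> a$i \<le> \<gamma> \<and> 0 \<le> b$i \<and> b$i \<le> \<gamma>) \<longrightarrow> k a b x \<le> \<kappa>1 \<gamma>))"

definition sol_regular :: "(real \<Rightarrow> real^3 \<Rightarrow> real) \<Rightarrow> bool" where
  "sol_regular w \<longleftrightarrow>
     (\<forall>T>0. (\<lambda>z. w (fst z) (snd z)) \<in> borel_measurable (lebesgue_on ({0..<T} \<times> T3)) \<and>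
            (\<exists>C. AE z in lebesgue_on ({0..<T} \<times> T3). \<bar>w (fst z) (snd z)\<bar> \<le> C)) \<and>
     (\<forall>t\<ge>0. \<forall>p\<ge>1. w t \<in> borel_measurable (lebesgue_on T3) \<and>
            integrable (lebesgue_on T3) (\<lambda>x. \<bar>w t x\<bar> powr p) \<and>
            ((\<lambda>s. int_T3 (\<lambda>x. \<bar>w s x - w t x\<bar> powr p)) \<longlongrightarrow> 0) (at t within {0..}))"

definition rho :: "(3 \<Rightarrow> real \<Rightarrow> real^3 \<Rightarrow> real) \<Rightarrow> (3 \<Rightarrow> real \<Rightarrow> real^3 \<Rightarrow> real)
    \<Rightarrow> real \<Rightarrow> real^3 \<Rightarrow> real" where
  "rho u v t x = (\<Sum>i\<in>UNIV. u i t x + v i t x)"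

definition kval :: "(real^3 \<Rightarrow> real^3 \<Rightarrow> real^3 \<Rightarrow> real) \<Rightarrow> (3 \<Rightarrow> real \<Rightarrow> real^3 \<Rightarrow> real)
    \<Rightarrow> (3 \<Rightarrow> real \<Rightarrow> real^3 \<Rightarrow> real) \<Rightarrow> real \<Rightarrow> real^3 \<Rightarrow> real" where
  "kval k u v t x = k (\<chi> i. u i t x) (\<chi> i. v i t x) x"

definition weak_solution ::
  "real \<Rightarrow> (real^3 \<Rightarrow> real^3 \<Rightarrow> real^3 \<Rightarrow> real) \<Rightarrow> (3 \<Rightarrow> real^3 \<Rightarrow> real) \<Rightarrow> (3 \<Rightarrow> real^3 \<Rightarrow> real)
   \<Rightarrow> (3 \<Rightarrow> real \<Rightarrow> real^3 \<Rightarrow> real) \<Rightarrow> (3 \<Rightarrow> real \<Rightarrow> real^3 \<Rightarrow> real) \<Rightarrow> bool" where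
  "weak_solution c k u0 v0 u v \<longleftrightarrow>
     (\<forall>i. \<forall>t\<ge>0. AE x in lebesgue_on T3. 0 \<le> u i t x \<and> 0 \<le> v i t x) \<and>
     (\<forall>i. sol_regular (u i) \<and> sol_regular (v i)) \<and>
     (\<forall>\<psi> i. test_fun \<psi> \<longrightarrow>
        int_QT (\<lambda>t x. u i t x * (dt \<psi> t x + c * dx \<psi> i t x))
        + int_T3 (\<lambda>x. \<psi> (0, x) * u0 i x)
        + int_QT (\<lambda>t x. kval k u v t x * (rho u v t x - 6 * u i t x) * \<psi> (t, x)) = 0 \<and>
        int_QT (\<lambda>t x. v i t x * (dt \<psi> t x - c * dx \<psi> i t x))
        + int_T3 (\<lambda>x. \<psi> (0, x) * v0 i x)
        + int_QT (\<lambda>t x. kval k u v t x * (rho u v t x - 6 * v i t x) * \<psi> (t, x)) = 0)"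

definition energy :: "(3 \<Rightarrow> real^3 \<Rightarrow> real) \<Rightarrow> (3 \<Rightarrow> real^3 \<Rightarrow> real) \<Rightarrow> real \<Rightarrow> real" where
  "energy f g m = (\<Sum>i\<in>UNIV. int_T3 (\<lambda>x. (f i x - m)\<^sup>2 + (g i x - m)\<^sup>2))"

end

theory Submission
  imports Defs
begin

text \<open>
  Index the six unknowns by \<open>3 \<times> bool\<close>. A weak solution coincides, for every time and almost every x,
  with the mild solution obtained by integrating the source along characteristics; this follows by
  testing with \<open>\<theta>(t) X(x - c t d)\<close>, where X runs through smooth periodic approximations of indicators of boxes.
  Along characteristics the chain rule gives a balance law for every \<open>C\<^sup>1\<^sup>,\<^sup>1\<close> function of the solution. The
  squared positive part of \<open>z - M\<close> yields the bound M, and the square of \<open>z - m\<close> yields the dissipation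
  \<open>\<integral>\<integral> k \<Sum>\<^sub>i\<^sub>j (z\<^sub>i - z\<^sub>j)\<^sup>2\<close>.

  Since \<open>k \<ge> e \<rho>\<^sup>\<alpha>\<close> degenerates where \<open>\<rho>\<close> vanishes, the dissipation does not control \<open>z\<^sub>i - z\<^sub>j\<close>, but it does
  control the differences of squares: \<open>(z\<^sub>i\<^sup>2 - z\<^sub>j\<^sup>2)\<^sup>2 \<le> \<rho>\<^sup>2 (z\<^sub>i - z\<^sub>j)\<^sup>2 \<le> (6M)\<^sup>2\<^sup>-\<^sup>\<alpha> (k / e) (z\<^sub>i - z\<^sub>j)\<^sup>2\<close>.
  Over one period 1/c the solution differs from free transport of its state f by a multiple of the
  dissipation, and for free transport the squares \<open>W\<^sub>i = f\<^sub>i\<^sup>2\<close> are observed: \<open>W\<^sub>i(x)\<close> is close to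
  \<open>W\<^sub>j(x + s (d\<^sub>i - d\<^sub>j))\<close> on average over s, and chaining the directions \<open>e\<^sub>1 - e\<^sub>2\<close>, \<open>e\<^sub>2 - e\<^sub>3\<close>, \<open>2 e\<^sub>3\<close>, which
  equidistribute on the torus, shows that \<open>W\<^sub>i(x)\<close> is close to \<open>W\<^sub>l(y)\<close> on average over all x, y. As
  \<open>f\<^sub>l(y)\<^sup>2 (f\<^sub>i(x) - f\<^sub>l(y))\<^sup>2 \<le> (W\<^sub>i(x) - W\<^sub>l(y))\<^sup>2\<close> and the mean m minimises the variance, the energy is bounded
  by a constant times the energy lost in one period, which gives exponential decay.
\<close>

section \<open>The flat torus\<close>

text \<open>Two circumstances shape the development. The rate may vanish where \<open>\<rho>\<close>
  does, so it has no positive pointwise lower bound; what rescues the argument is the weight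
  \<open>(f l y)\<^sup>2\<close>, whose integrals over \<open>y\<close>, summed over
  \<open>l\<close>, amount to at least \<open>6 * m\<^sup>2\<close>. Vacuum is harmless because the
  mass is positive, and this is the origin of the factor \<open>1 / m\<^sup>2\<close>. Moreover, the
  equation is known only in weak form and up to null sets, while a single characteristic is itself a
  null set. Solution, source and rate are therefore replaced by Borel functions that are periodic
  and bounded at every point, and the nonlinear rate is frozen as a given function
  \<open>\<kappa> s x\<close> of time and space. The bounds on these representatives are crude and
  depend on the time horizon; they secure integrability and never reach the decay rate, which is
  computed only after the bound \<open>M\<close> is established for the mild solution. Numerical
  constants come from squared triangle inequalities with three links (3), from the number of species
  (6) and from the Lipschitz constant \<open>2 * M\<close> of squaring on
  \<open>[0, M]\<close>.\<close>

definition lattice :: "'a::euclidean_space set" where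
  "lattice = {n. \<forall>b\<in>Basis. n \<bullet> b \<in> \<int>}"

text \<open>Half-open, unlike the closed cube \<open>T3\<close>: its lattice translates tile the
  space without overlap, so every class has exactly one representative. In dimension three the two
  cells differ by a null set.\<close>

definition unit_cell :: "'a::euclidean_space set" where
  "unit_cell = {x. \<forall>b\<in>Basis. 0 \<le> x \<bullet> b \<and> x \<bullet> b < 1}"

definition torus :: "'a::euclidean_space measure" where
  "torus = restrict_space lborel unit_cell"

definition periodic :: "('a::euclidean_space \<Rightarrow> 'b) \<Rightarrow> bool" where
  "periodic f \<longleftrightarrow> (\<forall>n\<in>lattice. \<forall>x. f (x + n) = f x)"

definition wrap :: "'a::euclidean_space \<Rightarrow> 'a" where
  "wrap x = (\<Sum>b\<in>Basis. frac (x \<bullet> b) *\<^sub>R b)"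

lemma wrap_inner [simp]: "b \<in> Basis \<Longrightarrow> wrap x \<bullet> b = frac (x \<bullet> b)"
  by (simp add: wrap_def)

lemma wrap_in_unit_cell: "wrap x \<in> unit_cell"
  by (simp add: unit_cell_def frac_ge_0 frac_lt_1)

lemma wrap_unit_cell: "x \<in> unit_cell \<Longrightarrow> wrap x = x"
  by (rule euclidean_eqI) (auto simp: unit_cell_def frac_eq)

lemma wrap_diff_lattice: "wrap x - x \<in> lattice"
  by (auto simp: lattice_def inner_diff_left frac_def)

lemma wrap_add_lattice: "n \<in> lattice \<Longrightarrow> wrap (x + n) = wrap x"
proof (rule euclidean_eqI)
  fix b :: 'a assume n: "n \<in> lattice" and b: "b \<in> Basis"
  obtain k where "n \<bullet> b = of_int k"
    using n b by (auto simp: lattice_def Ints_def)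
  then show "wrap (x + n) \<bullet> b = wrap x \<bullet> b"
    using b by (simp add: inner_add_left frac_def)
qed

lemma periodic_wrap: "periodic (\<lambda>x. f (wrap x))"
  by (simp add: periodic_def wrap_add_lattice)

lemma periodic_const: "periodic (\<lambda>x. a)"
  by (simp add: periodic_def)

lemma periodic_comp: "periodic f \<Longrightarrow> periodic (\<lambda>x. g (f x))"
  by (simp add: periodic_def)

lemma periodic_comp2: "periodic f \<Longrightarrow> periodic g \<Longrightarrow> periodic (\<lambda>x. h (f x) (g x))"
  by (simp add: periodic_def)

lemma periodicD: "periodic f \<Longrightarrow> n \<in> lattice \<Longrightarrow> f (x + n) = f x"
  by (simp add: periodic_def)

lemma periodic_translate: "periodic f \<Longrightarrow> periodic (\<lambda>x. f (x + h))"
  unfolding periodic_def by (metis add.assoc add.commute)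

lemma periodic_eq_wrap: "periodic f \<Longrightarrow> f (wrap x) = f x"
  using periodicD[OF _ wrap_diff_lattice[of x], of f x] by simp

lemma measurable_wrap [measurable]: "wrap \<in> borel_measurable borel"
  unfolding wrap_def[abs_def] frac_def by measurable

lemma unit_cell_borel [measurable]: "unit_cell \<in> sets borel"
proof -
  have "unit_cell = (\<Inter>b\<in>Basis. {x::'a. 0 \<le> x \<bullet> b \<and> x \<bullet> b < 1})"
    by (auto simp: unit_cell_def)
  also have "\<dots> \<in> sets borel"
    by (rule sets.finite_INT) auto
  finally show ?thesis .
qed

section \<open>Unfolding over the lattice and translation invariance\<close>

lemma lattice_uminus: "n \<in> lattice \<Longrightarrow> - n \<in> lattice"
  by (simp add: lattice_def)

lemma countable_lattice: "countable (lattice :: 'a::euclidean_space set)"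
proof -
  let ?g = "\<lambda>f::'a \<Rightarrow> int. \<Sum>b\<in>Basis. real_of_int (f b) *\<^sub>R b"
  have "countable (?g ` (PiE Basis (\<lambda>_. UNIV)))"
    by (intro countable_image countable_PiE) (simp_all add: finite_Basis)
  moreover have "n \<in> ?g ` (PiE Basis (\<lambda>_. UNIV))" if n: "n \<in> lattice" for n :: 'a
  proof (rule image_eqI)
    show "restrict (\<lambda>b. \<lfloor>n \<bullet> b\<rfloor>) Basis \<in> PiE Basis (\<lambda>_. UNIV)"
      by simp
    show "n = ?g (restrict (\<lambda>b. \<lfloor>n \<bullet> b\<rfloor>) Basis)"
    proof (rule euclidean_eqI)
      fix b :: 'a assume b: "b \<in> Basis"
      have "real_of_int \<lfloor>n \<bullet> b\<rfloor> = n \<bullet> b"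
        using n b by (auto simp: lattice_def elim!: Ints_cases)
      then show "n \<bullet> b = ?g (restrict (\<lambda>b. \<lfloor>n \<bullet> b\<rfloor>) Basis) \<bullet> b"
        using b by (simp only: inner_sum_left_Basis restrict_apply')
    qed
  qed
  ultimately show ?thesis
    by (blast intro: countable_subset)
qed

text \<open>Exactly one lattice vector, \<open>wrap x - x\<close>, brings \<open>x\<close> into the
  cell. The identity serves as a partition of unity when integrals over different fundamental cells
  are compared.\<close>

lemma lattice_translates_tile:
  "(\<integral>\<^sup>+n. indicator unit_cell (x + n) \<partial>count_space lattice) = (1::ennreal)"
proof -
  have "(\<integral>\<^sup>+n. indicator unit_cell (x + n) \<partial>count_space lattice)
      = (\<integral>\<^sup>+n. indicator {wrap x - x} n \<partial>count_space lattice)"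
  proof (rule nn_integral_cong)
    fix n :: 'a assume "n \<in> space (count_space lattice)"
    then have n: "n \<in> lattice" by simp
    have "x + n \<in> unit_cell \<longleftrightarrow> n = wrap x - x"
      using wrap_unit_cell[of "x + n"] wrap_add_lattice[OF n, of x] wrap_in_unit_cell[of x]
      by (metis add.commute add_diff_cancel diff_add_cancel)
    then show "(indicator unit_cell (x + n) :: ennreal) = indicator {wrap x - x} n"
      by (simp add: indicator_def)
  qed
  also have "\<dots> = 1"
    using wrap_diff_lattice[of x] by simp
  finally show ?thesis .
qed

lemma nn_integral_lborel_translate:
  fixes f :: "'a::euclidean_space \<Rightarrow> ennreal"
  assumes [measurable]: "f \<in> borel_measurable borel"
  shows "(\<integral>\<^sup>+x. f (x + h) \<partial>lborel) = (\<integral>\<^sup>+x. f x \<partial>lborel)"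
proof -
  have "(\<integral>\<^sup>+x. f x \<partial>lborel) = (\<integral>\<^sup>+x. f x \<partial>distr lborel borel ((+) h))"
    by (simp add: lborel_distr_plus)
  also have "\<dots> = (\<integral>\<^sup>+x. f (x + h) \<partial>lborel)"
    by (subst nn_integral_distr) (auto simp: add.commute)
  finally show ?thesis by simp
qed

lemma nn_integral_torus:
  "(\<integral>\<^sup>+x. f x \<partial>torus) = (\<integral>\<^sup>+x. f x * indicator unit_cell x \<partial>lborel)"
  unfolding torus_def by (subst nn_integral_restrict_space) auto

text \<open>Unfolding: the shift of the variable moves the cell to a translate of itself. The
  shifted cell is cut along the tiling, each piece is moved back by a lattice vector using
  periodicity of \<open>f\<close>, and the pieces are reassembled with the tiling by the shifted
  cell. Countability of the lattice permits the exchange of sum and integral.\<close>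

lemma nn_integral_torus_translate:
  fixes f :: "'a::euclidean_space \<Rightarrow> ennreal"
  assumes [measurable]: "f \<in> borel_measurable borel" and per: "periodic f"
  shows "(\<integral>\<^sup>+x. f (x + h) \<partial>torus) = (\<integral>\<^sup>+x. f x \<partial>torus)"
proof -
  let ?I = "indicator unit_cell :: 'a \<Rightarrow> ennreal"
  have "(\<integral>\<^sup>+x. f (x + h) \<partial>torus) = (\<integral>\<^sup>+x. f (x + h) * ?I (x + h - h) \<partial>lborel)"
    by (simp add: nn_integral_torus)
  also have "\<dots> = (\<integral>\<^sup>+x. f x * ?I (x - h) \<partial>lborel)"
    by (rule nn_integral_lborel_translate) measurable
  also have "\<dots> = (\<integral>\<^sup>+x. f x * ?I (x - h) * (\<integral>\<^sup>+n. ?I (x + n) \<partial>count_space lattice) \<partial>lborel)"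
    by (simp add: lattice_translates_tile)
  also have "\<dots> = (\<integral>\<^sup>+x. (\<integral>\<^sup>+n. f x * ?I (x - h) * ?I (x + n) \<partial>count_space lattice) \<partial>lborel)"
    by (simp add: nn_integral_cmult)
  also have "\<dots> = (\<integral>\<^sup>+n. (\<integral>\<^sup>+x. f x * ?I (x - h) * ?I (x + n) \<partial>lborel) \<partial>count_space lattice)"
    by (rule nn_integral_count_space_nn_integral[OF countable_lattice]) measurable
  also have "\<dots> = (\<integral>\<^sup>+n. (\<integral>\<^sup>+x. f x * ?I x * ?I (x - h - n) \<partial>lborel) \<partial>count_space lattice)"
  proof (rule nn_integral_cong)
    fix n :: 'a assume "n \<in> space (count_space lattice)"
    then have n: "n \<in> lattice" by simp
    have "(\<integral>\<^sup>+x. f x * ?I (x - h) * ?I (x + n) \<partial>lborel)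
        = (\<integral>\<^sup>+x. f (x + n - n) * ?I (x + n - n - h) * ?I (x + n) \<partial>lborel)"
      by simp
    also have "\<dots> = (\<integral>\<^sup>+x. f (x - n) * ?I (x - n - h) * ?I x \<partial>lborel)"
      by (rule nn_integral_lborel_translate) measurable
    also have "\<dots> = (\<integral>\<^sup>+x. f x * ?I x * ?I (x - h - n) \<partial>lborel)"
      using periodicD[OF per lattice_uminus[OF n]]
      by (intro nn_integral_cong) (simp add: mult_ac diff_diff_eq add.commute)
    finally show "(\<integral>\<^sup>+x. f x * ?I (x - h) * ?I (x + n) \<partial>lborel)
        = (\<integral>\<^sup>+x. f x * ?I x * ?I (x - h - n) \<partial>lborel)" .
  qed
  also have "\<dots> = (\<integral>\<^sup>+x. (\<integral>\<^sup>+n. f x * ?I x * ?I (x - h - n) \<partial>count_space lattice) \<partial>lborel)"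
    by (rule nn_integral_count_space_nn_integral[OF countable_lattice, symmetric]) measurable
  also have "\<dots> = (\<integral>\<^sup>+x. f x * ?I x * (\<integral>\<^sup>+n. ?I (x - h - n) \<partial>count_space lattice) \<partial>lborel)"
    by (simp add: nn_integral_cmult)
  also have "\<dots> = (\<integral>\<^sup>+x. f x * ?I x \<partial>lborel)"
  proof (rule nn_integral_cong)
    fix x :: 'a
    have "bij_betw uminus lattice (lattice :: 'a set)"
      by (rule bij_betwI[of _ _ _ uminus]) (auto simp: lattice_uminus)
    then have "(\<integral>\<^sup>+n. ?I (x - h - n) \<partial>count_space lattice) = (\<integral>\<^sup>+n. ?I (x - h + n) \<partial>count_space lattice)"
      by (subst nn_integral_bij_count_space[symmetric, of uminus lattice lattice]) auto
    then show "f x * ?I x * (\<integral>\<^sup>+n. ?I (x - h - n) \<partial>count_space lattice) = f x * ?I x"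
      by (simp add: lattice_translates_tile)
  qed
  also have "\<dots> = (\<integral>\<^sup>+x. f x \<partial>torus)"
    by (simp add: nn_integral_torus)
  finally show ?thesis .
qed

lemma unit_cell_bounds: "box 0 One \<subseteq> unit_cell" "unit_cell \<subseteq> cbox 0 One"
  by (auto simp: unit_cell_def mem_box less_imp_le)

lemma AE_unit_cell_iff_cbox: "AE x in lborel. x \<in> unit_cell \<longleftrightarrow> x \<in> cbox 0 (One::'a::euclidean_space)"
proof -
  have "cbox 0 One - box 0 (One::'a) \<in> null_sets lborel"
    by (simp add: null_sets_cbox_Diff_box)
  then have "AE x in lborel. x \<notin> cbox 0 One - box 0 (One::'a)"
    by (rule AE_not_in)
  then show ?thesis
    by (rule eventually_mono) (use unit_cell_bounds in blast)
qed

lemma space_torus [simp]: "space torus = unit_cell"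
  by (simp add: torus_def space_restrict_space)

lemma measurable_torusI [measurable (raw)]:
  "f \<in> measurable borel M \<Longrightarrow> f \<in> measurable torus M"
  unfolding torus_def by (rule measurable_restrict_space1) simp

lemma emeasure_torus_unit_cell [simp]: "emeasure torus (unit_cell :: 'a::euclidean_space set) = 1"
proof -
  have "emeasure torus (unit_cell :: 'a set) = emeasure lborel (unit_cell :: 'a set)"
    by (simp add: torus_def emeasure_restrict_space)
  also have "\<dots> = emeasure lborel (cbox 0 (One::'a))"
    by (rule emeasure_eq_AE[OF AE_unit_cell_iff_cbox]) auto
  also have "\<dots> = 1" by (simp add: emeasure_lborel_cbox_eq)
  finally show ?thesis .
qed

lemma measure_torus_unit_cell [simp]: "measure torus (unit_cell :: 'a::euclidean_space set) = 1"
  by (simp add: measure_def)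

interpretation torus: finite_measure "torus :: 'a::euclidean_space measure"
  by standard simp

text \<open>Formulated as invariance of the measure under a self-map of the cell, from which signed
  integrals, integrability and null sets all inherit translation invariance at once.\<close>

lemma distr_torus_translate:
  "distr torus torus (\<lambda>x. wrap (x + h)) = (torus :: 'a::euclidean_space measure)"
proof (rule measure_eqI)
  have meas: "(\<lambda>x. wrap (x + h)) \<in> measurable torus (torus :: 'a measure)"
    unfolding torus_def
    by (intro measurable_restrict_space2 measurable_restrict_space1)
      (auto simp: wrap_in_unit_cell)
  show "sets (distr torus torus (\<lambda>x. wrap (x + h))) = sets (torus :: 'a measure)" by simp
  fix A assume "A \<in> sets (distr torus torus (\<lambda>x::'a. wrap (x + h)))"
  then have A: "A \<in> sets torus" by simp
  then have Ab [measurable]: "A \<in> sets borel" and Asub: "A \<subseteq> unit_cell"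
    by (auto simp: torus_def sets_restrict_space)
  have "emeasure (distr torus torus (\<lambda>x. wrap (x + h))) A
      = (\<integral>\<^sup>+x. indicator A x \<partial>distr torus torus (\<lambda>x. wrap (x + h)))"
    using A by simp
  also have "\<dots> = (\<integral>\<^sup>+x. indicator A (wrap (x + h)) \<partial>torus)"
    using A by (subst nn_integral_distr[OF meas]) auto
  also have "\<dots> = (\<integral>\<^sup>+x. indicator A (wrap x) \<partial>torus)"
    by (rule nn_integral_torus_translate[of "\<lambda>x. indicator A (wrap x)"])
      (measurable, rule periodic_wrap)
  also have "\<dots> = (\<integral>\<^sup>+x. indicator A x \<partial>torus)"
    by (intro nn_integral_cong) (simp add: wrap_unit_cell)
  also have "\<dots> = emeasure torus A"
    using A by simp
  finally show "emeasure (distr torus torus (\<lambda>x. wrap (x + h))) A = emeasure torus A" .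
qed

lemma measurable_wrap_torus [measurable]: "(\<lambda>x. wrap (x + h)) \<in> measurable torus torus"
  unfolding torus_def
  by (intro measurable_restrict_space2 measurable_restrict_space1)
    (auto simp: wrap_in_unit_cell)

lemma integral_torus_translate:
  fixes f :: "'a::euclidean_space \<Rightarrow> real"
  assumes [measurable]: "f \<in> borel_measurable borel" and per: "periodic f"
  shows "(\<integral>x. f (x + h) \<partial>torus) = (\<integral>x. f x \<partial>torus)"
proof -
  have "(\<integral>x. f x \<partial>torus) = (\<integral>x. f x \<partial>distr torus torus (\<lambda>x. wrap (x + h)))"
    by (simp add: distr_torus_translate)
  also have "\<dots> = (\<integral>x. f (wrap (x + h)) \<partial>torus)"
    by (rule integral_distr) measurable
  also have "\<dots> = (\<integral>x. f (x + h) \<partial>torus)"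
    by (simp add: periodic_eq_wrap[OF per])
  finally show ?thesis by simp
qed

lemma AE_torus_translate:
  fixes P :: "'a::euclidean_space \<Rightarrow> bool"
  assumes ae: "AE x in torus. P x" and per: "periodic P"
  shows "AE x in torus. P (x + h)"
proof -
  have "AE x in distr torus torus (\<lambda>x. wrap (x + h)). P x"
    using ae by (subst distr_torus_translate)
  then have "AE x in torus. P (wrap (x + h))"
    by (rule AE_distrD[rotated]) measurable
  then show ?thesis by (simp add: periodic_eq_wrap[OF per])
qed

section \<open>Joint measurability, averages along closed lines, equidistribution\<close>

lemma measurable_borel_pairI:
  fixes f :: "'a::second_countable_topology \<times> 'b::second_countable_topology \<Rightarrow> 'c"
  assumes "f \<in> measurable borel M" "(\<lambda>x. x) \<in> measurable N1 borel" "(\<lambda>x. x) \<in> measurable N2 borel"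
  shows "f \<in> measurable (N1 \<Otimes>\<^sub>M N2) M"
proof -
  have "(\<lambda>z. (fst z, snd z)) \<in> measurable (N1 \<Otimes>\<^sub>M N2) (borel \<Otimes>\<^sub>M borel)"
    by (intro measurable_Pair measurable_compose[OF measurable_fst assms(2)]
        measurable_compose[OF measurable_snd assms(3)])
  from measurable_compose[OF this, of f M] show ?thesis
    using assms(1) by (simp add: borel_prod)
qed

lemma measurable_ident_torus: "(\<lambda>x. x) \<in> measurable torus borel"
  by (rule measurable_torusI) simp

lemma nn_integral_torus_swap:
  fixes f :: "'a::euclidean_space \<Rightarrow> 'b::euclidean_space \<Rightarrow> ennreal"
  assumes "(\<lambda>(x, y). f x y) \<in> borel_measurable borel"
  shows "(\<integral>\<^sup>+x. (\<integral>\<^sup>+y. f x y \<partial>torus) \<partial>torus) = (\<integral>\<^sup>+y. (\<integral>\<^sup>+x. f x y \<partial>torus) \<partial>torus)"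
proof -
  interpret pair_sigma_finite "torus :: 'b measure" "torus :: 'a measure" ..
  have "(\<lambda>z. f (snd z) (fst z)) \<in> borel_measurable (borel :: ('b \<times> 'a) measure)"
    using measurable_compose[of "\<lambda>z. (snd z, fst z)" borel "borel :: ('a \<times> 'b) measure", OF _ assms]
    by (simp add: borel_prod[symmetric] split_beta')
  then have "(\<lambda>z. f (snd z) (fst z)) \<in> borel_measurable (torus \<Otimes>\<^sub>M torus :: ('b \<times> 'a) measure)"
    by (rule measurable_borel_pairI[OF _ measurable_ident_torus measurable_ident_torus])
  then show ?thesis
    using Fubini'[of "\<lambda>y x. f x y"] by (simp add: split_beta')
qed

text \<open>The variable \<open>s\<close> runs through the circle, the one-dimensional
  \<open>torus\<close>. For a lattice vector \<open>a\<close> the line closes up after unit time, so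
  this is an average over a closed line of the flat torus.\<close>

definition line_avg :: "'a::euclidean_space \<Rightarrow> ('a \<Rightarrow> ennreal) \<Rightarrow> 'a \<Rightarrow> ennreal" where
  "line_avg a G x = (\<integral>\<^sup>+s. G (x + s *\<^sub>R a) \<partial>torus)"

lemma measurable_line_avg [measurable]:
  assumes [measurable]: "G \<in> borel_measurable borel"
  shows "line_avg a G \<in> borel_measurable borel"
  unfolding line_avg_def
proof (rule torus.borel_measurable_nn_integral)
  have "(\<lambda>(x, s). G (x + s *\<^sub>R a)) \<in> borel_measurable borel"
    by (simp add: borel_prod[symmetric])
  then show "(\<lambda>(x, s). G (x + s *\<^sub>R a)) \<in> borel_measurable (borel \<Otimes>\<^sub>M torus)"
    by (rule measurable_borel_pairI[OF _ _ measurable_ident_torus]) simp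
qed

lemma periodic_line_avg: "periodic G \<Longrightarrow> periodic (line_avg a G)"
proof -
  assume per: "periodic G"
  have "G (x + n + s *\<^sub>R a) = G (x + s *\<^sub>R a)" if "n \<in> lattice" for x n s
    using periodicD[OF per that, of "x + s *\<^sub>R a"] by (simp only: ac_simps)
  then show ?thesis by (simp add: periodic_def line_avg_def)
qed

lemma lattice_scaleR: "n \<in> (lattice :: real set) \<Longrightarrow> a \<in> lattice \<Longrightarrow> n *\<^sub>R a \<in> lattice"
  by (simp add: lattice_def)

lemma periodic_line: "periodic G \<Longrightarrow> a \<in> lattice \<Longrightarrow> periodic (\<lambda>s::real. G (x + s *\<^sub>R a))"
  unfolding periodic_def by (metis add.assoc lattice_scaleR scaleR_left_distrib)

text \<open>Moving the base point along the line only rotates the circle variable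
  \<open>s\<close>.\<close>

lemma line_avg_invariant:
  assumes [measurable]: "G \<in> borel_measurable borel" and "periodic G" "a \<in> lattice"
  shows "line_avg a G (x + r *\<^sub>R a) = line_avg a G x"
proof -
  have "line_avg a G (x + r *\<^sub>R a) = (\<integral>\<^sup>+s. G (x + (s + r) *\<^sub>R a) \<partial>torus)"
    by (simp add: line_avg_def algebra_simps)
  also have "\<dots> = line_avg a G x"
    unfolding line_avg_def
    by (rule nn_integral_torus_translate[of "\<lambda>s. G (x + s *\<^sub>R a)"])
      (measurable, rule periodic_line, fact+)
  finally show ?thesis .
qed

text \<open>Translations commute, so averaging in one direction keeps an invariance already gained
  in another.\<close>

lemma line_avg_preserves_invariance:
  assumes "\<And>x r. G (x + r *\<^sub>R b) = G x"
  shows "line_avg a G (x + r *\<^sub>R b) = line_avg a G x"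
proof -
  have "G (x + r *\<^sub>R b + s *\<^sub>R a) = G (x + s *\<^sub>R a)" for s
    using assms[of "x + s *\<^sub>R a" r] by (simp only: ac_simps)
  then show ?thesis by (simp add: line_avg_def)
qed

lemma nn_integral_line_avg:
  assumes [measurable]: "G \<in> borel_measurable borel" and per: "periodic G"
  shows "(\<integral>\<^sup>+x. line_avg a G x \<partial>torus) = (\<integral>\<^sup>+x. G x \<partial>torus)"
  unfolding line_avg_def
proof (subst nn_integral_torus_swap)
  show "(\<lambda>(x, s). G (x + s *\<^sub>R a)) \<in> borel_measurable borel"
    by (simp add: borel_prod[symmetric])
  show "(\<integral>\<^sup>+s. (\<integral>\<^sup>+x. G (x + s *\<^sub>R a) \<partial>torus) \<partial>torus) = (\<integral>\<^sup>+x. G x \<partial>torus)"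
    by (simp add: nn_integral_torus_translate[OF _ per])
qed

text \<open>The iterated average is invariant under translation by all three directions, hence constant;
  this avoids any change of variables, whatever the determinant.\<close>

lemma equidistribution:
  assumes G [measurable]: "G \<in> borel_measurable borel" and per: "periodic G"
    and lat: "a1 \<in> lattice" "a2 \<in> lattice" "a3 \<in> lattice"
    and span: "\<And>x. \<exists>r1 r2 r3. x = r1 *\<^sub>R a1 + r2 *\<^sub>R a2 + r3 *\<^sub>R a3"
  shows "line_avg a1 (line_avg a2 (line_avg a3 G)) x = (\<integral>\<^sup>+y. G y \<partial>torus)"
proof -
  let ?J = "line_avg a1 (line_avg a2 (line_avg a3 G))"
  have inv3: "?J (x + r *\<^sub>R a3) = ?J x" for x r
    by (intro line_avg_preserves_invariance line_avg_invariant G per lat)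
  have inv2: "?J (x + r *\<^sub>R a2) = ?J x" for x r
    by (intro line_avg_preserves_invariance line_avg_invariant measurable_line_avg periodic_line_avg G per lat)
  have inv1: "?J (x + r *\<^sub>R a1) = ?J x" for x r
    by (intro line_avg_invariant measurable_line_avg periodic_line_avg G per lat)
  have const: "?J y = ?J x" for y
  proof -
    obtain r1 r2 r3 where "y - x = r1 *\<^sub>R a1 + r2 *\<^sub>R a2 + r3 *\<^sub>R a3"
      using span by blast
    then have "y = x + r1 *\<^sub>R a1 + r2 *\<^sub>R a2 + r3 *\<^sub>R a3" by (simp add: algebra_simps)
    then show ?thesis by (simp add: inv1 inv2 inv3)
  qed
  have "?J x = (\<integral>\<^sup>+y. ?J x \<partial>(torus :: 'a measure))" by simp
  also have "\<dots> = (\<integral>\<^sup>+y. ?J y \<partial>torus)"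
    by (rule nn_integral_cong) (rule const[symmetric])
  also have "\<dots> = (\<integral>\<^sup>+y. G y \<partial>torus)"
    by (simp add: nn_integral_line_avg measurable_line_avg periodic_line_avg per)
  finally show ?thesis .
qed

section \<open>Observability of free transport\<close>

text \<open>\<open>(i, True)\<close> stands for \<open>u i\<close>, which moves along the i-th axis,
  and \<open>(i, False)\<close> for \<open>v i\<close>, which moves against it. The speed
  \<open>c\<close> is kept apart, so that differences of directions are lattice vectors.\<close>

definition dir :: "3 \<times> bool \<Rightarrow> real^3" where
  "dir p = (if snd p then 1 else - 1) *\<^sub>R axis (fst p) 1"

text \<open>Valued in \<open>ennreal\<close>, so that Tonelli, monotonicity and averaging apply to
  gaps free of integrability obligations.\<close>

definition sqdist :: "real \<Rightarrow> real \<Rightarrow> ennreal" where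
  "sqdist a b = ennreal ((a - b)\<^sup>2)"

lemma measurable_sqdist [measurable]:
  assumes [measurable]: "f \<in> borel_measurable M" "g \<in> borel_measurable M"
  shows "(\<lambda>x. sqdist (f x) (g x)) \<in> borel_measurable M"
  unfolding sqdist_def by measurable

lemma sqdist_commute: "sqdist a b = sqdist b a"
  by (simp add: sqdist_def power2_commute)

lemma real_sq_triangle3: "(a - d)\<^sup>2 \<le> 3 * ((a - b)\<^sup>2 + (b - c)\<^sup>2 + (c - d)\<^sup>2)" for a b c d :: real
proof -
  have "0 \<le> ((a - b) - (b - c))\<^sup>2 + ((b - c) - (c - d))\<^sup>2 + ((a - b) - (c - d))\<^sup>2" by simp
  then show ?thesis by (simp add: power2_eq_square algebra_simps)
qed

lemma sqdist_triangle3: "sqdist a d \<le> 3 * (sqdist a b + sqdist b c + sqdist c d)"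
proof -
  have "sqdist a d \<le> ennreal (3 * ((a - b)\<^sup>2 + (b - c)\<^sup>2 + (c - d)\<^sup>2))"
    unfolding sqdist_def by (rule ennreal_leI) (rule real_sq_triangle3)
  also have "\<dots> = 3 * (sqdist a b + sqdist b c + sqdist c d)"
    by (simp add: sqdist_def ennreal_mult ennreal_plus)
  finally show ?thesis .
qed

lemma dir_lattice: "dir p \<in> lattice"
proof -
  have "axis i 1 \<bullet> axis j (1::real) \<in> \<int>" for i j :: 3
    by (cases "i = j") (simp_all add: inner_axis_axis)
  then show ?thesis
    by (auto simp: lattice_def dir_def Basis_vec_def)
qed

lemma lattice_diff: "a \<in> lattice \<Longrightarrow> b \<in> lattice \<Longrightarrow> a - b \<in> lattice"
  by (simp add: lattice_def inner_diff_left)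

lemma measurable_pair_torusI:
  fixes f :: "'a::euclidean_space \<times> 'b::euclidean_space \<Rightarrow> 'c"
  assumes "f \<in> measurable borel M"
  shows "f \<in> measurable (borel \<Otimes>\<^sub>M torus) M"
  by (rule measurable_borel_pairI[OF assms _ measurable_ident_torus]) simp

lemma measurable_nn_integral_torus:
  fixes f :: "'a::euclidean_space \<Rightarrow> 'b::euclidean_space \<Rightarrow> ennreal"
  assumes "(\<lambda>(x, y). f x y) \<in> borel_measurable borel"
  shows "(\<lambda>x. \<integral>\<^sup>+y. f x y \<partial>torus) \<in> borel_measurable borel"
  by (rule torus.borel_measurable_nn_integral) (rule measurable_pair_torusI[OF assms])

locale torus_family =
  fixes W :: "3 \<times> bool \<Rightarrow> real^3 \<Rightarrow> real"
  assumes W_measurable [measurable]: "\<And>i. W i \<in> borel_measurable borel"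
    and W_periodic: "\<And>i. periodic (W i)"
begin

text \<open>Under free transport over the distance \<open>s\<close>, species \<open>i\<close>
  started at \<open>x\<close> and species \<open>j\<close> started at
  \<open>x + s *\<^sub>R (dir i - dir j)\<close> arrive at the same point
  \<open>x + s *\<^sub>R dir i\<close>. The gap is what an interaction at that moment sees of the
  initial state.\<close>

definition pair_gap :: "3 \<times> bool \<Rightarrow> 3 \<times> bool \<Rightarrow> real \<Rightarrow> ennreal" where
  "pair_gap i j s = (\<integral>\<^sup>+x. sqdist (W i x) (W j (x + s *\<^sub>R (dir i - dir j))) \<partial>torus)"

definition spread :: "3 \<times> bool \<Rightarrow> 3 \<times> bool \<Rightarrow> ennreal" where
  "spread i j = (\<integral>\<^sup>+y. (\<integral>\<^sup>+x. sqdist (W i x) (W j y) \<partial>torus) \<partial>torus)"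

lemma measurable_pair_gap [measurable]: "pair_gap i j \<in> borel_measurable borel"
  unfolding pair_gap_def
  by (rule measurable_nn_integral_torus) (simp add: borel_prod[symmetric])

lemma periodic_sqdist: "periodic f \<Longrightarrow> periodic g \<Longrightarrow> periodic (\<lambda>x. sqdist (f x) (g x))"
  by (rule periodic_comp2)

lemma spread_translate:
  "(\<integral>\<^sup>+y. (\<integral>\<^sup>+x. sqdist (W i (x + a)) (W j (y + b)) \<partial>torus) \<partial>torus) = spread i j"
proof -
  have "(\<integral>\<^sup>+x. sqdist (W i (x + a)) (W j (y + b)) \<partial>torus)
      = (\<integral>\<^sup>+x. sqdist (W i x) (W j (y + b)) \<partial>torus)" for y
    by (rule nn_integral_torus_translate[of "\<lambda>x. sqdist (W i x) (W j (y + b))"])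
      (auto intro!: periodic_sqdist W_periodic periodic_const)
  moreover have "(\<integral>\<^sup>+y. (\<integral>\<^sup>+x. sqdist (W i x) (W j (y + b)) \<partial>torus) \<partial>torus) = spread i j"
    unfolding spread_def
  proof (rule nn_integral_torus_translate[of "\<lambda>y. \<integral>\<^sup>+x. sqdist (W i x) (W j y) \<partial>torus"])
    show "(\<lambda>y. \<integral>\<^sup>+x. sqdist (W i x) (W j y) \<partial>torus) \<in> borel_measurable borel"
      by (rule measurable_nn_integral_torus) (simp add: borel_prod[symmetric])
    show "periodic (\<lambda>y. \<integral>\<^sup>+x. sqdist (W i x) (W j y) \<partial>torus)"
      using W_periodic by (rule periodic_comp)
  qed
  ultimately show ?thesis by simp
qed

text \<open>The parameters of the three links are independent circle variables, and the accumulated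
  displacement \<open>s1 *\<^sub>R a1 + s2 *\<^sub>R a2 + s3 *\<^sub>R a3\<close> fills the torus
  uniformly. Averaging over the parameters is therefore averaging over all displacements, that is,
  over independent \<open>x\<close> and \<open>y\<close>. Each of the three links costs
  \<open>\<delta>\<close> and the squared triangle inequality a factor 3, hence 9.\<close>

lemma spread_core:
  assumes gap: "\<And>i j. (\<integral>\<^sup>+s. pair_gap i j s \<partial>torus) \<le> \<delta>"
  shows "spread (1, True) (3, False) \<le> 9 * \<delta>"
proof -
  define p1 p2 p3 p6 :: "3 \<times> bool" where "p1 = (1, True)" "p2 = (2, True)" "p3 = (3, True)" "p6 = (3, False)"
  note p_defs = this
  define a1 a2 a3 where "a1 = dir p1 - dir p2" "a2 = dir p2 - dir p3" "a3 = dir p3 - dir p6"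
  note a_defs = this
  \<comment> \<open>\<open>K y\<close> is the mean squared distance of the two end species at
    displacement \<open>y\<close>; its average over \<open>y\<close> is the spread.\<close>
  define K where "K = (\<lambda>y. \<integral>\<^sup>+x. sqdist (W p1 x) (W p6 (x + y)) \<partial>torus)"
  have lat: "a1 \<in> lattice" "a2 \<in> lattice" "a3 \<in> lattice"
    by (auto simp: a_defs intro!: lattice_diff dir_lattice)
  have K_meas: "K \<in> borel_measurable borel"
    unfolding K_def by (rule measurable_nn_integral_torus) (simp add: borel_prod[symmetric])
  have K_per: "periodic K"
    unfolding periodic_def K_def using W_periodic by (auto simp: periodic_def add.assoc[symmetric])
  \<comment> \<open>The directions are \<open>e1 - e2\<close>, \<open>e2 - e3\<close> and
    \<open>2 e3\<close>; the witnesses solve the triangular system \<open>r1 = x1\<close>,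
    \<open>r2 - r1 = x2\<close>, \<open>2 r3 - r2 = x3\<close>.\<close>
  have span: "\<exists>r1 r2 r3. x = r1 *\<^sub>R a1 + r2 *\<^sub>R a2 + r3 *\<^sub>R a3" for x
    by (rule exI[of _ "x $ 1"], rule exI[of _ "x $ 1 + x $ 2"], rule exI[of _ "(x $ 1 + x $ 2 + x $ 3) / 2"])
      (simp add: vec_eq_iff forall_3 a_defs p_defs dir_def axis_def)
  have K_le: "K (s1 *\<^sub>R a1 + s2 *\<^sub>R a2 + s3 *\<^sub>R a3) \<le> 3 * (pair_gap p1 p2 s1 + pair_gap p2 p3 s2 + pair_gap p3 p6 s3)"
    for s1 s2 s3
  proof -
    let ?h = "s1 *\<^sub>R a1" and ?h' = "s1 *\<^sub>R a1 + s2 *\<^sub>R a2"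
    have "K (s1 *\<^sub>R a1 + s2 *\<^sub>R a2 + s3 *\<^sub>R a3)
      \<le> (\<integral>\<^sup>+x. 3 * (sqdist (W p1 x) (W p2 (x + ?h)) + sqdist (W p2 (x + ?h)) (W p3 (x + ?h + s2 *\<^sub>R a2))
            + sqdist (W p3 (x + ?h')) (W p6 (x + ?h' + s3 *\<^sub>R a3))) \<partial>torus)"
      unfolding K_def
    proof (rule nn_integral_mono)
      fix x
      show "sqdist (W p1 x) (W p6 (x + (s1 *\<^sub>R a1 + s2 *\<^sub>R a2 + s3 *\<^sub>R a3)))
        \<le> 3 * (sqdist (W p1 x) (W p2 (x + ?h)) + sqdist (W p2 (x + ?h)) (W p3 (x + ?h + s2 *\<^sub>R a2))
            + sqdist (W p3 (x + ?h')) (W p6 (x + ?h' + s3 *\<^sub>R a3)))"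
        using sqdist_triangle3[of "W p1 x" "W p6 (x + ?h' + s3 *\<^sub>R a3)" "W p2 (x + ?h)" "W p3 (x + ?h')"]
        by (simp only: add.assoc)
    qed
    also have "\<dots> = 3 * ((\<integral>\<^sup>+x. sqdist (W p1 x) (W p2 (x + ?h)) \<partial>torus)
        + (\<integral>\<^sup>+x. sqdist (W p2 (x + ?h)) (W p3 (x + ?h + s2 *\<^sub>R a2)) \<partial>torus)
        + (\<integral>\<^sup>+x. sqdist (W p3 (x + ?h')) (W p6 (x + ?h' + s3 *\<^sub>R a3)) \<partial>torus))"
      by (simp add: nn_integral_cmult nn_integral_add)
    also have "(\<integral>\<^sup>+x. sqdist (W p2 (x + ?h)) (W p3 (x + ?h + s2 *\<^sub>R a2)) \<partial>torus) = pair_gap p2 p3 s2"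
      unfolding pair_gap_def a_defs(2)
      by (rule nn_integral_torus_translate[of "\<lambda>x. sqdist (W p2 x) (W p3 (x + s2 *\<^sub>R (dir p2 - dir p3)))"])
        (auto intro!: periodic_sqdist W_periodic periodic_translate)
    also have "(\<integral>\<^sup>+x. sqdist (W p3 (x + ?h')) (W p6 (x + ?h' + s3 *\<^sub>R a3)) \<partial>torus) = pair_gap p3 p6 s3"
      unfolding pair_gap_def a_defs(3)
      by (rule nn_integral_torus_translate[of "\<lambda>x. sqdist (W p3 x) (W p6 (x + s3 *\<^sub>R (dir p3 - dir p6)))"])
        (auto intro!: periodic_sqdist W_periodic periodic_translate)
    finally show ?thesis by (simp add: pair_gap_def a_defs)
  qed
  have "spread p1 p6 = (\<integral>\<^sup>+x. (\<integral>\<^sup>+y. sqdist (W p1 x) (W p6 y) \<partial>torus) \<partial>torus)"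
    unfolding spread_def by (rule nn_integral_torus_swap) (simp add: borel_prod[symmetric])
  also have "\<dots> = (\<integral>\<^sup>+x. (\<integral>\<^sup>+y. sqdist (W p1 x) (W p6 (y + x)) \<partial>torus) \<partial>torus)"
  proof (rule nn_integral_cong)
    fix x
    show "(\<integral>\<^sup>+y. sqdist (W p1 x) (W p6 y) \<partial>torus) = (\<integral>\<^sup>+y. sqdist (W p1 x) (W p6 (y + x)) \<partial>torus)"
      by (rule nn_integral_torus_translate[of "\<lambda>y. sqdist (W p1 x) (W p6 y)", symmetric])
        (auto intro!: periodic_sqdist W_periodic periodic_const)
  qed
  also have "\<dots> = (\<integral>\<^sup>+y. K y \<partial>torus)"
    unfolding K_def by (subst nn_integral_torus_swap) (simp_all add: borel_prod[symmetric] add.commute)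
  also have "\<dots> = line_avg a1 (line_avg a2 (line_avg a3 K)) 0"
    by (rule equidistribution[symmetric, OF K_meas K_per lat span])
  also have "\<dots> \<le> (\<integral>\<^sup>+s1. (\<integral>\<^sup>+s2. (\<integral>\<^sup>+s3.
      3 * (pair_gap p1 p2 s1 + pair_gap p2 p3 s2 + pair_gap p3 p6 s3) \<partial>torus) \<partial>torus) \<partial>torus)"
    unfolding line_avg_def using K_le by (intro nn_integral_mono) simp
  also have "\<dots> = 3 * ((\<integral>\<^sup>+s. pair_gap p1 p2 s \<partial>torus) + (\<integral>\<^sup>+s. pair_gap p2 p3 s \<partial>torus)
      + (\<integral>\<^sup>+s. pair_gap p3 p6 s \<partial>torus))"
    by (simp add: nn_integral_cmult nn_integral_add)
  also have "\<dots> \<le> 3 * (\<delta> + \<delta> + \<delta>)"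
    by (intro mult_left_mono add_mono gap) simp
  also have "\<dots> = 9 * \<delta>"
  proof -
    have "\<delta> + \<delta> + \<delta> = (1 + 1 + 1) * \<delta>" by (simp only: distrib_right mult_1)
    then show ?thesis by (simp add: mult.assoc[symmetric])
  qed
  finally show ?thesis by (simp add: p_defs)
qed

text \<open>Arbitrary species are joined through the core pair: from \<open>i\<close> to
  \<open>p1\<close>, across the core, from \<open>p6\<close> to \<open>l\<close>. The inequality
  holds for all displacements \<open>s\<close> and \<open>r\<close> of the outer links, so it may be
  averaged over both; the constant is \<open>3 * (1 + 9 + 1)\<close>.\<close>

lemma spread_bound:
  assumes gap: "\<And>i j. (\<integral>\<^sup>+s. pair_gap i j s \<partial>torus) \<le> \<delta>"
  shows "spread i l \<le> 33 * \<delta>"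
proof -
  define p1 p6 :: "3 \<times> bool" where "p1 = (1, True)" "p6 = (3, False)"
  have core: "spread p1 p6 \<le> 9 * \<delta>"
    unfolding p1_p6_def by (rule spread_core) (rule gap)
  have le: "spread i l \<le> 3 * (pair_gap i p1 s + spread p1 p6 + pair_gap l p6 r)" for s r
  proof -
    let ?a = "s *\<^sub>R (dir i - dir p1)" and ?b = "r *\<^sub>R (dir l - dir p6)"
    have "spread i l \<le> (\<integral>\<^sup>+y. (\<integral>\<^sup>+x. 3 * (sqdist (W i x) (W p1 (x + ?a)) +
        sqdist (W p1 (x + ?a)) (W p6 (y + ?b)) + sqdist (W l y) (W p6 (y + ?b))) \<partial>torus) \<partial>torus)"
      unfolding spread_def
    proof (intro nn_integral_mono)
      fix x y
      show "sqdist (W i x) (W l y) \<le> 3 * (sqdist (W i x) (W p1 (x + ?a)) +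
          sqdist (W p1 (x + ?a)) (W p6 (y + ?b)) + sqdist (W l y) (W p6 (y + ?b)))"
        using sqdist_triangle3[of "W i x" "W l y" "W p1 (x + ?a)" "W p6 (y + ?b)"]
        by (simp only: sqdist_commute[of "W l y"])
    qed
    also have "\<dots> = (\<integral>\<^sup>+y. 3 * (pair_gap i p1 s + (\<integral>\<^sup>+x. sqdist (W p1 (x + ?a)) (W p6 (y + ?b)) \<partial>torus)
        + sqdist (W l y) (W p6 (y + ?b))) \<partial>torus)"
      by (rule nn_integral_cong) (simp add: nn_integral_cmult nn_integral_add pair_gap_def)
    also have "\<dots> = 3 * (pair_gap i p1 s +
        (\<integral>\<^sup>+y. (\<integral>\<^sup>+x. sqdist (W p1 (x + ?a)) (W p6 (y + ?b)) \<partial>torus) \<partial>torus) + pair_gap l p6 r)"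
    proof -
      have [measurable]: "(\<lambda>y. \<integral>\<^sup>+x. sqdist (W p1 (x + ?a)) (W p6 (y + ?b)) \<partial>torus) \<in> borel_measurable borel"
        by (rule measurable_nn_integral_torus) (simp add: borel_prod[symmetric])
      show ?thesis
        by (simp add: nn_integral_cmult nn_integral_add pair_gap_def)
    qed
    also have "\<dots> = 3 * (pair_gap i p1 s + spread p1 p6 + pair_gap l p6 r)"
      by (simp only: spread_translate)
    finally show ?thesis .
  qed
  have "spread i l = (\<integral>\<^sup>+s. (\<integral>\<^sup>+r. spread i l \<partial>(torus :: real measure)) \<partial>(torus :: real measure))"
    by simp
  also have "\<dots> \<le> (\<integral>\<^sup>+s. (\<integral>\<^sup>+r. 3 * (pair_gap i p1 s + spread p1 p6 + pair_gap l p6 r) \<partial>torus) \<partial>torus)"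
    by (intro nn_integral_mono le)
  also have "\<dots> = 3 * ((\<integral>\<^sup>+s. pair_gap i p1 s \<partial>torus) + spread p1 p6 + (\<integral>\<^sup>+r. pair_gap l p6 r \<partial>torus))"
    by (simp add: nn_integral_cmult nn_integral_add)
  also have "\<dots> \<le> 3 * (\<delta> + 9 * \<delta> + \<delta>)"
    by (intro mult_left_mono add_mono gap core) simp
  also have "\<dots> = 33 * \<delta>"
  proof -
    have "\<delta> + 9 * \<delta> + \<delta> = (1 + 9 + 1) * \<delta>" by (simp only: distrib_right mult_1)
    then show ?thesis by (simp add: mult.assoc[symmetric])
  qed
  finally show ?thesis .
qed

end

section \<open>From the spread of squares to the variance\<close>

lemma torus_integrable_bounded:
  fixes f :: "'a::euclidean_space \<Rightarrow> real"
  assumes "f \<in> borel_measurable borel" "\<And>x. \<bar>f x\<bar> \<le> B"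
  shows "integrable torus f"
  by (rule torus.integrable_const_bound[of _ B]) (use assms in \<open>auto intro: measurable_torusI\<close>)

text \<open>Parallel axis identity: the cross term vanishes because \<open>m\<close> is the overall
  mean. It is applied with \<open>a\<close> a value of \<open>f\<close> itself, and with
  \<open>a = 0\<close>.\<close>

lemma mean_minimizes:
  fixes f :: "'i::finite \<Rightarrow> 'a::euclidean_space \<Rightarrow> real" and a m :: real
  assumes f: "\<And>i. f i \<in> borel_measurable borel" and bd: "\<And>i x. \<bar>f i x\<bar> \<le> B"
    and mean: "(\<Sum>i\<in>UNIV. \<integral>x. f i x \<partial>torus) = CARD('i) * m"
  shows "(\<Sum>i\<in>UNIV. \<integral>x. (f i x - a)\<^sup>2 \<partial>torus) = (\<Sum>i\<in>UNIV. \<integral>x. (f i x - m)\<^sup>2 \<partial>torus) + CARD('i) * (a - m)\<^sup>2"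
proof -
  have [simp]: "integrable torus (f i)" for i
    by (rule torus_integrable_bounded[OF f bd])
  have [simp]: "integrable torus (\<lambda>x. (f i x)\<^sup>2)" for i
    using f power_mono[OF bd, of i _ 2] by (intro torus_integrable_bounded[where B = "B\<^sup>2"]) auto
  have e: "(\<integral>x. (f i x - b)\<^sup>2 \<partial>torus) = (\<integral>x. (f i x)\<^sup>2 \<partial>torus) - 2 * b * (\<integral>x. f i x \<partial>torus) + b\<^sup>2" for i b
    by (simp add: power2_diff algebra_simps)
  define S where "S = (\<Sum>i\<in>UNIV. \<integral>x. (f i x)\<^sup>2 \<partial>torus)"
  have s: "(\<Sum>i\<in>UNIV. \<integral>x. (f i x - b)\<^sup>2 \<partial>torus) = S - 2 * b * (CARD('i) * m) + CARD('i) * b\<^sup>2" for b :: real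
    by (simp add: e S_def sum.distrib sum_subtractf sum_distrib_left[symmetric] mean)
  show ?thesis
    by (simp only: s[of a] s[of m]) (simp add: power2_eq_square algebra_simps)
qed

text \<open>The variance around \<open>m\<close> is at most the variance around any other centre, in
  particular around the value \<open>f l y\<close>. The weight \<open>(f l y)\<^sup>2\<close> makes
  the latter comparable with a difference of squares, and integration over \<open>y\<close> leaves a
  sum of six spreads, hence \<open>198 = 6 * 33\<close>.\<close>

lemma observability:
  fixes f :: "3 \<times> bool \<Rightarrow> real^3 \<Rightarrow> real"
  assumes f [measurable]: "\<And>i. f i \<in> borel_measurable borel" and bd: "\<And>i x. \<bar>f i x\<bar> \<le> B"
    and per: "\<And>i. periodic (f i)" and nonneg: "\<And>i. AE x in torus. 0 \<le> f i x"
    and mean: "(\<Sum>i\<in>UNIV. \<integral>x. f i x \<partial>torus) = 6 * m" and m: "0 < m" and \<delta>: "0 \<le> \<delta>"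
    and gap: "\<And>i j. (\<integral>\<^sup>+s. (\<integral>\<^sup>+x. sqdist ((f i x)\<^sup>2) ((f j (x + s *\<^sub>R (dir i - dir j)))\<^sup>2) \<partial>torus) \<partial>torus) \<le> ennreal \<delta>"
  shows "(\<Sum>i\<in>UNIV. \<integral>x. (f i x - m)\<^sup>2 \<partial>torus) \<le> 198 * \<delta> / m\<^sup>2"
proof -
  define E where "E = (\<Sum>i\<in>UNIV. \<integral>x. (f i x - m)\<^sup>2 \<partial>torus)"
  have card: "CARD(3 \<times> bool) = 6" by simp
  have mean': "(\<Sum>i\<in>UNIV. \<integral>x. f i x \<partial>torus) = CARD(3 \<times> bool) * m"
    using mean by (simp add: card)
  note mm = mean_minimizes[where f = f and B = B and m = m, OF f bd mean', unfolded E_def[symmetric] card]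
  have E0: "0 \<le> E" unfolding E_def by (intro sum_nonneg integral_nonneg_AE) simp
  have int_sq: "integrable torus (\<lambda>x. (f i x)\<^sup>2)" for i
    using power_mono[OF bd, of i _ 2] by (intro torus_integrable_bounded[where B = "B\<^sup>2"]) auto
  have B0: "0 \<le> B" using bd[of undefined undefined] by simp
  have int_sqa: "integrable torus (\<lambda>x. (f i x - a)\<^sup>2)" for i a
  proof (intro torus_integrable_bounded[where B = "(B + \<bar>a\<bar>)\<^sup>2"])
    fix x
    have "\<bar>f i x - a\<bar> \<le> B + \<bar>a\<bar>" using bd[of i x] by linarith
    from power_mono[OF this, of 2] show "\<bar>(f i x - a)\<^sup>2\<bar> \<le> (B + \<bar>a\<bar>)\<^sup>2" by simp
  qed measurable
  interpret torus_family "\<lambda>i x. (f i x)\<^sup>2"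
    by unfold_locales (auto intro: periodic_comp per)
  have spread: "spread i l \<le> 33 * ennreal \<delta>" for i l
    by (rule spread_bound) (simp add: pair_gap_def gap)
  have "E * (\<integral>y. (f l y)\<^sup>2 \<partial>torus) \<le> 198 * \<delta>" for l
  proof -
    have "ennreal (E * (\<integral>y. (f l y)\<^sup>2 \<partial>torus)) = (\<integral>\<^sup>+y. ennreal (E * (f l y)\<^sup>2) \<partial>torus)"
      using E0 int_sq by (subst nn_integral_eq_integral) auto
    also have "\<dots> \<le> (\<integral>\<^sup>+y. (\<Sum>i\<in>UNIV. \<integral>\<^sup>+x. sqdist ((f i x)\<^sup>2) ((f l y)\<^sup>2) \<partial>torus) \<partial>torus)"
    proof (rule nn_integral_mono_AE)
      show "AE y in torus. ennreal (E * (f l y)\<^sup>2) \<le> (\<Sum>i\<in>UNIV. \<integral>\<^sup>+x. sqdist ((f i x)\<^sup>2) ((f l y)\<^sup>2) \<partial>torus)"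
        using nonneg[of l]
      proof (rule eventually_mono)
        fix y assume y: "0 \<le> f l y"
        have "ennreal (E * (f l y)\<^sup>2) \<le> ennreal ((f l y)\<^sup>2 * (\<Sum>i\<in>UNIV. \<integral>x. (f i x - f l y)\<^sup>2 \<partial>torus))"
          by (intro ennreal_leI) (simp add: mm distrib_left mult.commute)
        also have "\<dots> = (\<Sum>i\<in>UNIV. ennreal (\<integral>x. (f l y)\<^sup>2 * (f i x - f l y)\<^sup>2 \<partial>torus))"
          by (subst sum_ennreal) (auto simp: sum_distrib_left intro!: mult_nonneg_nonneg)
        also have "\<dots> = (\<Sum>i\<in>UNIV. \<integral>\<^sup>+x. ennreal ((f l y)\<^sup>2 * (f i x - f l y)\<^sup>2) \<partial>torus)"
          using int_sqa by (intro sum.cong refl nn_integral_eq_integral[symmetric]) auto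
        also have "\<dots> \<le> (\<Sum>i\<in>UNIV. \<integral>\<^sup>+x. sqdist ((f i x)\<^sup>2) ((f l y)\<^sup>2) \<partial>torus)"
        proof (intro sum_mono nn_integral_mono_AE)
          fix i
          show "AE x in torus. ennreal ((f l y)\<^sup>2 * (f i x - f l y)\<^sup>2) \<le> sqdist ((f i x)\<^sup>2) ((f l y)\<^sup>2)"
            using nonneg[of i]
          proof (rule eventually_mono)
            fix x assume x: "0 \<le> f i x"
            \<comment> \<open>Here nonnegativity enters: the weight is dominated by the factor
              \<open>f i x + f l y\<close> of the difference of squares.\<close>
            have "(f l y)\<^sup>2 * (f i x - f l y)\<^sup>2 \<le> (f i x + f l y)\<^sup>2 * (f i x - f l y)\<^sup>2"
              using x y by (intro mult_right_mono power_mono) auto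
            also have "\<dots> = ((f i x)\<^sup>2 - (f l y)\<^sup>2)\<^sup>2"
              by (simp add: power2_eq_square algebra_simps)
            finally show "ennreal ((f l y)\<^sup>2 * (f i x - f l y)\<^sup>2) \<le> sqdist ((f i x)\<^sup>2) ((f l y)\<^sup>2)"
              unfolding sqdist_def by (rule ennreal_leI)
          qed
        qed
        finally show "ennreal (E * (f l y)\<^sup>2) \<le> (\<Sum>i\<in>UNIV. \<integral>\<^sup>+x. sqdist ((f i x)\<^sup>2) ((f l y)\<^sup>2) \<partial>torus)" .
      qed
    qed
    also have "\<dots> = (\<Sum>i\<in>UNIV. spread i l)"
    proof -
      have "(\<lambda>y. \<integral>\<^sup>+x. sqdist ((f i x)\<^sup>2) ((f l y)\<^sup>2) \<partial>torus) \<in> borel_measurable borel" for i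
        by (rule measurable_nn_integral_torus) (simp add: borel_prod[symmetric])
      then show ?thesis
        unfolding spread_def by (intro nn_integral_sum measurable_torusI)
    qed
    also have "\<dots> \<le> (\<Sum>i\<in>(UNIV :: (3 \<times> bool) set). 33 * ennreal \<delta>)"
      by (intro sum_mono spread)
    also have "\<dots> = ennreal (198 * \<delta>)"
      using \<delta> by (simp add: card ennreal_mult mult.assoc[symmetric])
    finally show ?thesis
      using \<delta> by (subst (asm) ennreal_le_iff) auto
  qed
  then have "(\<Sum>l\<in>UNIV. E * (\<integral>y. (f l y)\<^sup>2 \<partial>torus)) \<le> (\<Sum>l\<in>(UNIV :: (3 \<times> bool) set). 198 * \<delta>)"
    by (intro sum_mono)
  then have "E * (\<Sum>l\<in>UNIV. \<integral>y. (f l y)\<^sup>2 \<partial>torus) \<le> 6 * (198 * \<delta>)"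
    by (simp add: sum_distrib_left card)
  \<comment> \<open>The centre \<open>0\<close> in the parallel axis identity bounds the total
    weight from below; at this point the positive mean compensates for vacuum.\<close>
  moreover have "6 * m\<^sup>2 \<le> (\<Sum>l\<in>UNIV. \<integral>y. (f l y)\<^sup>2 \<partial>torus)"
    using mm[of 0] E0 by simp
  ultimately have "E * (6 * m\<^sup>2) \<le> 6 * (198 * \<delta>)"
    using E0 by (meson mult_left_mono order_trans)
  then show ?thesis
    using m unfolding E_def[symmetric] by (simp add: field_simps)
qed

section \<open>Time integrals and the chain rule\<close>

definition itv :: "real \<Rightarrow> real \<Rightarrow> real measure" where
  "itv a b = restrict_space lborel {a..b}"

lemma space_itv [simp]: "space (itv a b) = {a..b}"
  by (simp add: itv_def space_restrict_space)

lemma measurable_itvI [measurable (raw)]: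
  "f \<in> measurable borel M \<Longrightarrow> f \<in> measurable (itv a b) M"
  unfolding itv_def by (rule measurable_restrict_space1) simp

lemma measurable_ident_itv: "(\<lambda>x. x) \<in> measurable (itv a b) borel"
  by (rule measurable_itvI) simp

lemma emeasure_itv: "emeasure (itv a b) {a..b} = ennreal (b - a)"
  by (cases "a \<le> b") (simp_all add: itv_def emeasure_restrict_space ennreal_neg)

interpretation itv: finite_measure "itv a b" for a b
  by standard (simp add: emeasure_itv)

lemma measure_itv: "a \<le> b \<Longrightarrow> measure (itv a b) {a..b} = b - a"
  by (simp add: measure_def emeasure_itv)

lemma integral_itv: "(\<integral>s. f s \<partial>itv a b) = (\<integral>s. indicator {a..b} s * f s \<partial>lborel)" for f :: "real \<Rightarrow> real"
  unfolding itv_def by (subst integral_restrict_space) auto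

lemma nn_integral_itv: "(\<integral>\<^sup>+s. f s \<partial>itv a b) = (\<integral>\<^sup>+s. f s * indicator {a..b} s \<partial>lborel)"
  unfolding itv_def by (subst nn_integral_restrict_space) auto

lemma AE_itv_iff: "(AE s in itv a b. P s) \<longleftrightarrow> (AE s in lborel. s \<in> {a..b} \<longrightarrow> P s)"
  unfolding itv_def by (rule AE_restrict_space_iff) simp

lemma AE_itv_mono:
  assumes "AE s in itv a b. P s" "a \<le> a'" "b' \<le> b"
  shows "AE s in itv a' b'. P s"
  using assms(1) unfolding AE_itv_iff by (rule eventually_mono) (use assms(2,3) in auto)

lemma itv_integrable_bounded:
  fixes f :: "real \<Rightarrow> real"
  assumes "f \<in> borel_measurable borel" "\<And>s. a \<le> s \<Longrightarrow> s \<le> b \<Longrightarrow> \<bar>f s\<bar> \<le> L"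
  shows "integrable (itv a b) f"
  by (rule itv.integrable_const_bound[of _ L]) (use assms in \<open>auto intro: measurable_itvI AE_I2\<close>)

text \<open>Bridge to the gauge integral, through which additivity over intervals, the fundamental
  theorem of calculus and continuity of primitives are obtained.\<close>

lemma integral_itv_HK:
  fixes f :: "real \<Rightarrow> real"
  assumes "f \<in> borel_measurable borel" "\<And>s. a \<le> s \<Longrightarrow> s \<le> b \<Longrightarrow> \<bar>f s\<bar> \<le> L"
  shows "f integrable_on {a..b}" "(\<integral>s. f s \<partial>itv a b) = integral {a..b} f"
proof -
  have "set_integrable lborel {a..b} f"
    using itv_integrable_bounded[OF assms] unfolding itv_def set_integrable_def
    by (subst (asm) integrable_restrict_space) auto
  from set_borel_integral_eq_integral[OF this]
  show "f integrable_on {a..b}" "(\<integral>s. f s \<partial>itv a b) = integral {a..b} f"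
    by (simp_all add: integral_itv set_lebesgue_integral_def)
qed

lemma integral_itv_combine:
  fixes f :: "real \<Rightarrow> real"
  assumes f: "f \<in> borel_measurable borel" and bd: "\<And>s. a \<le> s \<Longrightarrow> s \<le> c \<Longrightarrow> \<bar>f s\<bar> \<le> L"
    and "a \<le> b" "b \<le> c"
  shows "(\<integral>s. f s \<partial>itv a b) + (\<integral>s. f s \<partial>itv b c) = (\<integral>s. f s \<partial>itv a c)"
proof -
  have "(\<integral>s. f s \<partial>itv a b) = integral {a..b} f" "(\<integral>s. f s \<partial>itv b c) = integral {b..c} f"
    "(\<integral>s. f s \<partial>itv a c) = integral {a..c} f" "f integrable_on {a..c}"
    by (rule integral_itv_HK[OF f, where L = L], use bd assms(3,4) in auto)+
  then show ?thesis
    using Henstock_Kurzweil_Integration.integral_combine[OF assms(3,4)] by simp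
qed

lemma abs_integral_itv_le:
  fixes f :: "real \<Rightarrow> real"
  assumes "f \<in> borel_measurable borel" "\<And>s. a \<le> s \<Longrightarrow> s \<le> b \<Longrightarrow> \<bar>f s\<bar> \<le> L" "a \<le> b"
  shows "\<bar>\<integral>s. f s \<partial>itv a b\<bar> \<le> L * (b - a)"
proof -
  have int: "integrable (itv a b) f"
    by (rule itv_integrable_bounded[OF assms(1,2)])
  have "\<bar>\<integral>s. f s \<partial>itv a b\<bar> \<le> (\<integral>s. \<bar>f s\<bar> \<partial>itv a b)"
    using integral_norm_bound[of "itv a b" f] by simp
  also have "\<dots> \<le> (\<integral>s. L \<partial>itv a b)"
    using int assms(2) by (intro integral_mono) auto
  finally have "\<bar>\<integral>s. f s \<partial>itv a b\<bar> \<le> (\<integral>s. L \<partial>itv a b)" .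
  then show ?thesis by (simp add: measure_itv assms(3) mult.commute)
qed

text \<open>No absolute-continuity theory is needed: the defect between the two sides is
  quadratically small over short time intervals, so it has zero derivative.\<close>

lemma chain_rule_primitive:
  fixes \<phi> \<phi>' g W :: "real \<Rightarrow> real"
  assumes g: "g \<in> borel_measurable borel" and gL: "\<And>s. \<bar>g s\<bar> \<le> L"
    and W: "W \<in> borel_measurable borel"
    and W_diff: "\<And>s t. 0 \<le> s \<Longrightarrow> s \<le> t \<Longrightarrow> W t - W s = (\<integral>r. g r \<partial>itv s t)"
    and \<phi>: "\<And>r. (\<phi> has_real_derivative \<phi>' r) (at r)"
    and lip: "\<And>r r'. \<bar>\<phi>' r - \<phi>' r'\<bar> \<le> L' * \<bar>r - r'\<bar>"
    and ab: "0 \<le> a" "a \<le> b"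
  shows "\<phi> (W b) - \<phi> (W a) = (\<integral>s. \<phi>' (W s) * g s \<partial>itv a b)"
proof -
  have L0: "0 \<le> L" using gL[of 0] by simp
  have L'0: "0 \<le> L'" using lip[of 1 0] by simp
  have [measurable]: "\<phi>' \<in> borel_measurable borel"
  proof (rule borel_measurable_continuous_onI)
    have "L'-lipschitz_on UNIV \<phi>'" by (rule lipschitz_onI) (auto simp: dist_real_def lip L'0)
    then show "continuous_on UNIV \<phi>'" by (rule lipschitz_on_continuous_on)
  qed
  note [measurable] = g W
  have WL: "\<bar>W t - W s\<bar> \<le> L * (t - s)" if "0 \<le> s" "s \<le> t" for s t
    using abs_integral_itv_le[OF g gL that(2)] W_diff[OF that] by simp
  define P where "P = \<bar>\<phi>' (W a)\<bar> + L' * (L * (b - a))"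
  have P: "\<bar>\<phi>' (W s) * g s\<bar> \<le> P * L" if "a \<le> s" "s \<le> b" for s
  proof -
    have "\<bar>\<phi>' (W s) - \<phi>' (W a)\<bar> \<le> L' * \<bar>W s - W a\<bar>" by (rule lip)
    also have "\<dots> \<le> L' * (L * (s - a))"
      using WL[of a s] that ab L'0 by (intro mult_left_mono) auto
    also have "\<dots> \<le> L' * (L * (b - a))"
      using that L0 L'0 by (intro mult_left_mono) auto
    finally have "\<bar>\<phi>' (W s)\<bar> \<le> P" unfolding P_def by linarith
    then show ?thesis using gL[of s] by (simp add: abs_mult mult_mono)
  qed
  define D where "D t = \<phi> (W t) - (\<integral>s. \<phi>' (W s) * g s \<partial>itv a t)" for t
  have quad: "\<bar>D t - D r\<bar> \<le> 2 * L' * L\<^sup>2 * (t - r)\<^sup>2" if r: "a \<le> r" "r \<le> t" "t \<le> b" for r t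
  proof -
    \<comment> \<open>Only the distance of the intermediate point from \<open>W r\<close> is
      retained, which treats the three possible orders of \<open>W r\<close> and \<open>W t\<close>
      alike.\<close>
    have "\<exists>z. \<bar>z - W r\<bar> \<le> \<bar>W t - W r\<bar> \<and> \<phi> (W t) - \<phi> (W r) = \<phi>' z * (W t - W r)"
    proof (cases "W r" "W t" rule: linorder_cases)
      case less
      from MVT2[OF less \<phi>] obtain z where "W r < z" "z < W t" "\<phi> (W t) - \<phi> (W r) = (W t - W r) * \<phi>' z" by auto
      then show ?thesis by (intro exI[of _ z]) (auto simp: mult.commute)
    next
      case greater
      from MVT2[OF greater \<phi>] obtain z where "W t < z" "z < W r" "\<phi> (W r) - \<phi> (W t) = (W r - W t) * \<phi>' z" by auto
      then show ?thesis by (intro exI[of _ z]) (auto simp: algebra_simps)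
    qed auto
    then obtain z where z: "\<bar>z - W r\<bar> \<le> \<bar>W t - W r\<bar>" "\<phi> (W t) - \<phi> (W r) = \<phi>' z * (W t - W r)" by blast
    have r0: "0 \<le> r" using r ab by linarith
    have int1: "integrable (itv r t) g" by (rule itv_integrable_bounded[OF g gL])
    have int2: "integrable (itv r t) (\<lambda>s. \<phi>' (W s) * g s)"
      using P r by (intro itv_integrable_bounded[where L = "P * L"]) auto
    have "(\<integral>s. \<phi>' (W s) * g s \<partial>itv a r) + (\<integral>s. \<phi>' (W s) * g s \<partial>itv r t) = (\<integral>s. \<phi>' (W s) * g s \<partial>itv a t)"
      using P r by (intro integral_itv_combine[where L = "P * L"]) auto
    then have "D t - D r = \<phi>' z * (\<integral>s. g s \<partial>itv r t) - (\<integral>s. \<phi>' (W s) * g s \<partial>itv r t)"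
      using z(2) W_diff[OF r0 r(2)] unfolding D_def by simp
    also have "\<dots> = (\<integral>s. (\<phi>' z - \<phi>' (W s)) * g s \<partial>itv r t)"
      using int1 int2 by (simp add: left_diff_distrib)
    \<comment> \<open>Both \<open>z\<close> and \<open>W s\<close> lie within
      \<open>L * (t - r)\<close> of \<open>W r\<close>. One factor \<open>t - r\<close> comes from
      this closeness, the other from the length of the interval.\<close>
    also have "\<bar>\<dots>\<bar> \<le> (L' * (2 * (L * (t - r))) * L) * (t - r)"
    proof (rule abs_integral_itv_le[OF _ _ r(2)])
      fix s assume s: "r \<le> s" "s \<le> t"
      have "\<bar>\<phi>' z - \<phi>' (W s)\<bar> \<le> L' * \<bar>z - W s\<bar>" by (rule lip)
      also have "\<dots> \<le> L' * (2 * (L * (t - r)))"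
      proof (intro mult_left_mono L'0)
        have "\<bar>z - W s\<bar> \<le> \<bar>W t - W r\<bar> + \<bar>W s - W r\<bar>" using z(1) by linarith
        also have "\<dots> \<le> L * (t - r) + L * (s - r)" using WL[of r t] WL[of r s] r0 r s by (intro add_mono) auto
        also have "\<dots> \<le> 2 * (L * (t - r))" using mult_left_mono[of "s - r" "t - r" L] s L0 by simp
        finally show "\<bar>z - W s\<bar> \<le> 2 * (L * (t - r))" .
      qed
      finally show "\<bar>(\<phi>' z - \<phi>' (W s)) * g s\<bar> \<le> L' * (2 * (L * (t - r))) * L"
        using gL[of s] by (simp add: abs_mult mult_mono')
    qed measurable
    finally show ?thesis by (simp add: power2_eq_square algebra_simps)
  qed
  have quad': "\<bar>D y - D x\<bar> \<le> 2 * L' * L\<^sup>2 * (y - x)\<^sup>2" if "x \<in> {a..b}" "y \<in> {a..b}" for x y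
    using quad[of x y] quad[of y x] that by (cases "x \<le> y") (auto simp: abs_minus_commute power2_commute)
  have "(D has_field_derivative 0) (at x within {a..b})" if x: "x \<in> {a..b}" for x
    unfolding has_field_derivative_iff
  proof (rule Lim_null_comparison)
    show "\<forall>\<^sub>F y in at x within {a..b}. norm ((D y - D x) / (y - x)) \<le> 2 * L' * L\<^sup>2 * \<bar>y - x\<bar>"
      unfolding eventually_at_filter
    proof (rule always_eventually, intro allI impI)
      fix y assume "y \<noteq> x" "y \<in> {a..b}"
      then show "norm ((D y - D x) / (y - x)) \<le> 2 * L' * L\<^sup>2 * \<bar>y - x\<bar>"
        using quad'[OF x, of y] by (simp add: field_simps power2_eq_square abs_mult_self_eq)
    qed
    show "((\<lambda>y. 2 * L' * L\<^sup>2 * \<bar>y - x\<bar>) \<longlongrightarrow> 0) (at x within {a..b})"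
      by (rule tendsto_eq_intros | simp)+
  qed
  then obtain d where "\<forall>x\<in>{a..b}. D x = d"
    using has_field_derivative_zero_constant[of "{a..b}" D] by auto
  then have "D b = D a" using ab by simp
  moreover have "(\<integral>s. \<phi>' (W s) * g s \<partial>itv a a) = 0"
    using abs_integral_itv_le[of "\<lambda>s. \<phi>' (W s) * g s" a a "P * L"] P ab by simp
  ultimately show ?thesis unfolding D_def by simp
qed

lemma itv_torus_integrable_bounded:
  fixes f :: "real \<Rightarrow> 'a::euclidean_space \<Rightarrow> real"
  assumes "(\<lambda>z. f (fst z) (snd z)) \<in> borel_measurable borel" "\<And>s x. a \<le> s \<Longrightarrow> s \<le> b \<Longrightarrow> \<bar>f s x\<bar> \<le> L"
  shows "integrable (itv a b \<Otimes>\<^sub>M torus) (\<lambda>z. f (fst z) (snd z))"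
proof -
  interpret finite_measure "itv a b \<Otimes>\<^sub>M (torus :: 'a measure)"
    by (rule finite_measure_pair_measure) unfold_locales
  show ?thesis
    by (rule integrable_const_bound[of _ L])
      (auto intro!: AE_I2 assms measurable_borel_pairI[OF assms(1) measurable_ident_itv measurable_ident_torus]
        simp: space_pair_measure)
qed

lemma itv_torus_swap:
  fixes f :: "real \<Rightarrow> 'a::euclidean_space \<Rightarrow> real"
  assumes "(\<lambda>z. f (fst z) (snd z)) \<in> borel_measurable borel" "\<And>s x. a \<le> s \<Longrightarrow> s \<le> b \<Longrightarrow> \<bar>f s x\<bar> \<le> L"
  shows "(\<integral>s. (\<integral>x. f s x \<partial>torus) \<partial>itv a b) = (\<integral>x. (\<integral>s. f s x \<partial>itv a b) \<partial>torus)"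
    and "integrable (itv a b) (\<lambda>s. \<integral>x. f s x \<partial>torus)"
proof -
  interpret pair_sigma_finite "itv a b" "torus :: 'a measure" ..
  have int: "integrable (itv a b \<Otimes>\<^sub>M torus) (\<lambda>(s, x). f s x)"
    using itv_torus_integrable_bounded[OF assms] by (simp add: split_beta')
  show "(\<integral>s. (\<integral>x. f s x \<partial>torus) \<partial>itv a b) = (\<integral>x. (\<integral>s. f s x \<partial>itv a b) \<partial>torus)"
    using Fubini_integral[OF int] by simp
  show "integrable (itv a b) (\<lambda>s. \<integral>x. f s x \<partial>torus)"
    using integrable_fst[OF int] by simp
qed

section \<open>Mild solutions: balance laws and the maximum principle\<close>

lemma measurable_curry_comp:
  fixes f :: "'a::second_countable_topology \<Rightarrow> 'b::second_countable_topology \<Rightarrow> 'c::topological_space"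
  assumes "(\<lambda>z. f (fst z) (snd z)) \<in> borel_measurable borel" "g \<in> borel_measurable N" "h \<in> borel_measurable N"
  shows "(\<lambda>y. f (g y) (h y)) \<in> borel_measurable N"
  using measurable_compose[OF borel_measurable_Pair[OF assms(2,3)] assms(1)] by simp

lemma continuous_bounded_on_interval:
  fixes f :: "real \<Rightarrow> real"
  assumes "continuous_on UNIV f"
  obtains P where "\<And>r. \<bar>r\<bar> \<le> R \<Longrightarrow> \<bar>f r\<bar> \<le> P"
proof -
  have "compact (f ` {-R..R})"
    by (auto intro!: compact_continuous_image continuous_on_subset[OF assms])
  then obtain P where P: "\<forall>y\<in>f ` {-R..R}. norm y \<le> P"
    using compact_imp_bounded bounded_iff by blast
  have "\<bar>f r\<bar> \<le> P" if "\<bar>r\<bar> \<le> R" for r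
    using P that by (auto simp: abs_le_iff)
  then show ?thesis by (rule that)
qed

lemma continuous_of_lipschitz_bound:
  fixes f :: "real \<Rightarrow> real"
  assumes "\<And>r r'. \<bar>f r - f r'\<bar> \<le> L * \<bar>r - r'\<bar>"
  shows "continuous_on UNIV f"
proof -
  have "0 \<le> L" using assms[of 1 0] by simp
  then have "L-lipschitz_on UNIV f" by (intro lipschitz_onI) (auto simp: dist_real_def assms)
  then show ?thesis by (rule lipschitz_on_continuous_on)
qed

text \<open>The source is a given function of time and space, so the solution is explicit; its
  coupling to the solution is added later as an identity almost everywhere. Periodicity and bounds
  hold at every point, because exceptional null sets could not be controlled along a single
  characteristic.\<close>

locale mild_transport =
  fixes c B :: real and b :: "3 \<times> bool \<Rightarrow> real^3 \<Rightarrow> real"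
    and F :: "3 \<times> bool \<Rightarrow> real \<Rightarrow> real^3 \<Rightarrow> real"
  assumes c_pos: "0 < c"
    and b_measurable [measurable]: "\<And>i. b i \<in> borel_measurable borel"
    and b_periodic: "\<And>i. periodic (b i)" and b_bound: "\<And>i x. \<bar>b i x\<bar> \<le> B"
    and F_measurable: "\<And>i. (\<lambda>z. F i (fst z) (snd z)) \<in> borel_measurable borel"
    and F_periodic: "\<And>i s. periodic (F i s)" and F_bound: "\<And>i s x. \<bar>F i s x\<bar> \<le> B"
begin

text \<open>Lagrangian form of the mild solution: \<open>x\<close> is the foot at time 0 of a
  characteristic of species \<open>i\<close>. \<open>sol\<close> is the same function in Eulerian
  coordinates.\<close>

definition path :: "3 \<times> bool \<Rightarrow> real \<Rightarrow> real^3 \<Rightarrow> real" where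
  "path i t x = b i x + (\<integral>s. F i s (x + (c * s) *\<^sub>R dir i) \<partial>itv 0 t)"

definition sol :: "3 \<times> bool \<Rightarrow> real \<Rightarrow> real^3 \<Rightarrow> real" where
  "sol i t x = path i t (x - (c * t) *\<^sub>R dir i)"

lemmas measurable_F [measurable (raw)] = measurable_curry_comp[OF F_measurable]

lemma path_0: "path i 0 x = b i x"
  using abs_integral_itv_le[of "\<lambda>s. F i s (x + (c * s) *\<^sub>R dir i)" 0 0 B] F_bound
  by (simp add: path_def)

lemma sol_0: "sol i 0 x = b i x"
  by (simp add: sol_def path_0)

lemma path_measurable: "(\<lambda>z. path i (fst z) (snd z)) \<in> borel_measurable borel"
proof -
  \<comment> \<open>The moving upper limit is put into the integrand, so that joint measurability
    becomes that of a parameter integral over a fixed measure.\<close>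
  have "(\<lambda>z::real \<times> (real^3). \<integral>s. (if 0 \<le> s \<and> s \<le> fst z then F i s (snd z + (c * s) *\<^sub>R dir i) else 0) \<partial>lborel)
      \<in> borel_measurable borel"
  proof (rule lborel.borel_measurable_lebesgue_integral)
    show "(\<lambda>(z::real \<times> (real^3), s). if 0 \<le> s \<and> s \<le> fst z then F i s (snd z + (c * s) *\<^sub>R dir i) else 0)
      \<in> borel_measurable (borel \<Otimes>\<^sub>M lborel)"
      by (simp add: split_beta' borel_prod[symmetric])
  qed
  moreover have "(\<integral>s. F i s (x + (c * s) *\<^sub>R dir i) \<partial>itv 0 t) =
      (\<integral>s. (if 0 \<le> s \<and> s \<le> t then F i s (x + (c * s) *\<^sub>R dir i) else 0) \<partial>lborel)" for t x
    unfolding integral_itv by (rule Bochner_Integration.integral_cong) auto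
  ultimately show ?thesis
    unfolding path_def by (simp add: borel_prod[symmetric])
qed

lemmas measurable_path [measurable (raw)] = measurable_curry_comp[OF path_measurable]

lemma sol_measurable: "(\<lambda>z. sol i (fst z) (snd z)) \<in> borel_measurable borel"
  unfolding sol_def by (simp add: borel_prod[symmetric])

lemmas measurable_sol [measurable (raw)] = measurable_curry_comp[OF sol_measurable]

lemma path_periodic: "periodic (path i t)"
  unfolding periodic_def path_def
proof (intro ballI allI)
  fix n x :: "real^3" assume n: "n \<in> lattice"
  have "F i s (x + n + (c * s) *\<^sub>R dir i) = F i s (x + (c * s) *\<^sub>R dir i)" for s
    using periodicD[OF F_periodic n, of i s "x + (c * s) *\<^sub>R dir i"] by (simp add: ac_simps)
  then show "b i (x + n) + (\<integral>s. F i s (x + n + (c * s) *\<^sub>R dir i) \<partial>itv 0 t)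
      = b i x + (\<integral>s. F i s (x + (c * s) *\<^sub>R dir i) \<partial>itv 0 t)"
    using periodicD[OF b_periodic n] by simp
qed

lemma sol_periodic: "periodic (sol i t)"
  unfolding sol_def using periodic_translate[OF path_periodic, of i t "- (c * t) *\<^sub>R dir i"] by simp

lemma path_eq_sol: "path i t x = sol i t (x + (c * t) *\<^sub>R dir i)"
  by (simp add: sol_def)

lemma path_diff:
  assumes "0 \<le> s" "s \<le> t"
  shows "path i t x - path i s x = (\<integral>r. F i r (x + (c * r) *\<^sub>R dir i) \<partial>itv s t)"
  unfolding path_def
  using integral_itv_combine[of "\<lambda>r. F i r (x + (c * r) *\<^sub>R dir i)" 0 t B s] F_bound assms by simp

lemma B_nonneg: "0 \<le> B"
  using b_bound[of undefined undefined] by simp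

text \<open>Crude and growing linearly with the horizon; it serves integrability and does not enter
  the decay rate.\<close>

lemma path_bound: "0 \<le> t \<Longrightarrow> t \<le> T \<Longrightarrow> \<bar>path i t x\<bar> \<le> B + B * T"
proof -
  assume t: "0 \<le> t" "t \<le> T"
  have "\<bar>\<integral>s. F i s (x + (c * s) *\<^sub>R dir i) \<partial>itv 0 t\<bar> \<le> B * (t - 0)"
    by (rule abs_integral_itv_le) (auto simp: F_bound t)
  also have "\<dots> \<le> B * T" using t B_nonneg by (simp add: mult_left_mono)
  finally show ?thesis unfolding path_def using b_bound[of i x] by linarith
qed

lemma sol_bound: "0 \<le> t \<Longrightarrow> t \<le> T \<Longrightarrow> \<bar>sol i t x\<bar> \<le> B + B * T"
  unfolding sol_def by (rule path_bound)

text \<open>Along a characteristic the chain rule is one-dimensional. Integrating over all feet and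
  translating, at each fixed time, from the foot to the current point removes the transport term, so
  no spatial derivative of the solution ever appears.\<close>

lemma balance:
  assumes \<phi>: "\<And>r. (\<phi> has_real_derivative \<phi>' r) (at r)"
    and lip: "\<And>r r'. \<bar>\<phi>' r - \<phi>' r'\<bar> \<le> L' * \<bar>r - r'\<bar>"
    and t: "0 \<le> t0" "t0 \<le> t"
  shows "(\<integral>x. \<phi> (sol i t x) \<partial>torus) - (\<integral>x. \<phi> (sol i t0 x) \<partial>torus)
      = (\<integral>s. (\<integral>x. \<phi>' (sol i s x) * F i s x \<partial>torus) \<partial>itv t0 t)"
    and "integrable (itv t0 t) (\<lambda>s. \<integral>x. \<phi>' (sol i s x) * F i s x \<partial>torus)"
proof -
  have cont': "continuous_on UNIV \<phi>'"
    using lip by (rule continuous_of_lipschitz_bound)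
  have cont: "continuous_on UNIV \<phi>"
    by (rule DERIV_continuous_on) (use \<phi> in auto)
  have [measurable]: "\<phi>' \<in> borel_measurable borel" "\<phi> \<in> borel_measurable borel"
    using cont cont' by (auto intro: borel_measurable_continuous_onI)
  define R where "R = B + B * t"
  obtain P P0 where P: "\<And>r. \<bar>r\<bar> \<le> R \<Longrightarrow> \<bar>\<phi>' r\<bar> \<le> P" and P0: "\<And>r. \<bar>r\<bar> \<le> R \<Longrightarrow> \<bar>\<phi> r\<bar> \<le> P0"
    using continuous_bounded_on_interval[OF cont', of R] continuous_bounded_on_interval[OF cont, of R] by metis
  have bd: "\<bar>\<phi>' (path i s x) * F i s y\<bar> \<le> P * B" "\<bar>\<phi>' (sol i s x) * F i s y\<bar> \<le> P * B" if "t0 \<le> s" "s \<le> t" for s x y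
    using P[OF path_bound[of s t i x, folded R_def]] P[OF sol_bound[of s t i x, folded R_def]] F_bound[of i s y] that t
    by (auto simp: abs_mult intro!: mult_mono')
  have int: "integrable torus (\<lambda>x. \<phi> (path i s x))" if "0 \<le> s" "s \<le> t" for s
    by (rule torus_integrable_bounded[where B = P0]) (use P0[OF path_bound[of s t i, folded R_def]] that in auto)
  have tr: "(\<integral>x. \<phi> (path i s x) \<partial>torus) = (\<integral>x. \<phi> (sol i s x) \<partial>torus)" for s
    unfolding path_eq_sol
    by (rule integral_torus_translate[of "\<lambda>x. \<phi> (sol i s x)"]) (auto intro: periodic_comp sol_periodic)
  have tr': "(\<integral>x. \<phi>' (path i s x) * F i s (x + (c * s) *\<^sub>R dir i) \<partial>torus) = (\<integral>x. \<phi>' (sol i s x) * F i s x \<partial>torus)" for s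
    unfolding path_eq_sol
    by (rule integral_torus_translate[of "\<lambda>x. \<phi>' (sol i s x) * F i s x"])
      (auto intro!: periodic_comp2[where h = "\<lambda>r r'. \<phi>' r * r'"] sol_periodic F_periodic)
  have "(\<integral>x. \<phi> (sol i t x) \<partial>torus) - (\<integral>x. \<phi> (sol i t0 x) \<partial>torus)
      = (\<integral>x. \<phi> (path i t x) - \<phi> (path i t0 x) \<partial>torus)"
    using int t by (simp add: tr[symmetric])
  also have "\<dots> = (\<integral>x. (\<integral>s. \<phi>' (path i s x) * F i s (x + (c * s) *\<^sub>R dir i) \<partial>itv t0 t) \<partial>torus)"
  proof (rule Bochner_Integration.integral_cong[OF refl])
    fix x
    show "\<phi> (path i t x) - \<phi> (path i t0 x) = (\<integral>s. \<phi>' (path i s x) * F i s (x + (c * s) *\<^sub>R dir i) \<partial>itv t0 t)"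
      by (rule chain_rule_primitive[where L = B and L' = L']) (auto simp: F_bound path_diff lip t intro: \<phi>)
  qed
  also have "\<dots> = (\<integral>s. (\<integral>x. \<phi>' (path i s x) * F i s (x + (c * s) *\<^sub>R dir i) \<partial>torus) \<partial>itv t0 t)"
    by (rule itv_torus_swap(1)[symmetric, where L = "P * B"]) (use bd in \<open>auto simp: borel_prod[symmetric]\<close>)
  finally show "(\<integral>x. \<phi> (sol i t x) \<partial>torus) - (\<integral>x. \<phi> (sol i t0 x) \<partial>torus)
      = (\<integral>s. (\<integral>x. \<phi>' (sol i s x) * F i s x \<partial>torus) \<partial>itv t0 t)"
    by (simp add: tr')
  show "integrable (itv t0 t) (\<lambda>s. \<integral>x. \<phi>' (sol i s x) * F i s x \<partial>torus)"
    by (rule itv_torus_swap(2)[where L = "P * B"]) (use bd in \<open>auto simp: borel_prod[symmetric]\<close>)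
qed

end

section \<open>Relaxation: symmetrisation, maximum principle, energy identity\<close>

lemma integral_nonpos: "(\<And>x. f x \<le> (0::real)) \<Longrightarrow> (\<integral>x. f x \<partial>N) \<le> 0"
  using integral_nonneg_AE[of "\<lambda>x. - f x" N] by simp

text \<open>Symmetrisation: exchange the names of the indices and average. When \<open>g\<close> is
  a nondecreasing function of \<open>z\<close>, every product on the right is nonnegative; this sign
  is the dissipativity of the relaxation term.\<close>

lemma sum_exchange:
  fixes g z :: "'i::finite \<Rightarrow> real"
  shows "(\<Sum>i\<in>UNIV. \<Sum>j\<in>UNIV. g i * (z j - z i)) = - (\<Sum>i\<in>UNIV. \<Sum>j\<in>UNIV. (g i - g j) * (z i - z j)) / 2"
proof -
  have "(\<Sum>i\<in>UNIV. \<Sum>j\<in>UNIV. g i * (z j - z i)) = (\<Sum>i\<in>UNIV. \<Sum>j\<in>UNIV. g j * (z i - z j))"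
    by (rule sum.swap)
  moreover have "(\<Sum>i\<in>UNIV. \<Sum>j\<in>UNIV. g i * (z j - z i)) + (\<Sum>i\<in>UNIV. \<Sum>j\<in>UNIV. g j * (z i - z j))
      = - (\<Sum>i\<in>UNIV. \<Sum>j\<in>UNIV. (g i - g j) * (z i - z j))"
    unfolding sum.distrib[symmetric] sum_negf[symmetric] by (intro sum.cong refl) (simp add: algebra_simps)
  ultimately show ?thesis by linarith
qed

text \<open>The test function of the maximum principle. Its derivative is Lipschitz but has a kink
  at \<open>M\<close>, which is why the chain rule asks for no more than a Lipschitz
  derivative.\<close>

lemma has_real_derivative_pos_part_sq:
  "((\<lambda>r. (max 0 (r - M))\<^sup>2) has_real_derivative 2 * max 0 (r - M)) (at (r::real))"
proof (cases r M rule: linorder_cases)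
  case less
  have "((\<lambda>r. 0) has_real_derivative 0) (at r)" by simp
  then have "((\<lambda>r. (max 0 (r - M))\<^sup>2) has_real_derivative 0) (at r)"
    by (rule has_field_derivative_transform_within_open[of _ _ _ "{..<M}"]) (use less in auto)
  then show ?thesis using less by simp
next
  case greater
  have "((\<lambda>r. (r - M)\<^sup>2) has_real_derivative 2 * (r - M)) (at r)"
    by (auto intro!: derivative_eq_intros)
  then have "((\<lambda>r. (max 0 (r - M))\<^sup>2) has_real_derivative 2 * (r - M)) (at r)"
    by (rule has_field_derivative_transform_within_open[of _ _ _ "{M<..}"]) (use greater in auto)
  then show ?thesis using greater by simp
next
  case equal
  have "((\<lambda>r. (max 0 (r - M))\<^sup>2) has_real_derivative 0) (at M)"
    unfolding has_field_derivative_iff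
  proof (rule Lim_null_comparison)
    have "norm (((max 0 (y - M))\<^sup>2 - (max 0 (M - M))\<^sup>2) / (y - M)) \<le> \<bar>y - M\<bar>" for y
      by (cases "y \<le> M") (auto simp: max_def power2_eq_square)
    then show "\<forall>\<^sub>F y in at M. norm (((max 0 (y - M))\<^sup>2 - (max 0 (M - M))\<^sup>2) / (y - M)) \<le> \<bar>y - M\<bar>"
      by (intro always_eventually allI)
    show "((\<lambda>y. \<bar>y - M\<bar>) \<longlongrightarrow> 0) (at M)"
      by (rule tendsto_eq_intros | simp)+
  qed
  then show ?thesis using equal by simp
qed

text \<open>The rate is a given nonnegative function here, so the nonlinearity of \<open>k\<close>
  is no longer visible. The sum of differences is \<open>\<rho> - 6 z\<close> in the form in which
  it can be symmetrised.\<close>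

locale mild_relaxation = mild_transport +
  fixes T M m :: real and \<kappa> :: "real \<Rightarrow> real^3 \<Rightarrow> real"
  assumes \<kappa>_measurable: "(\<lambda>z. \<kappa> (fst z) (snd z)) \<in> borel_measurable borel"
    and \<kappa>_nonneg: "\<And>s x. 0 \<le> \<kappa> s x" and \<kappa>_bound: "\<And>s x. \<kappa> s x \<le> B"
    and source: "AE s in itv 0 T. AE x in torus. \<forall>i. F i s x = \<kappa> s x * (\<Sum>j\<in>UNIV. sol j s x - sol i s x)"
    and b_le: "\<And>i x. b i x \<le> M"
    and mean_b: "(\<Sum>i\<in>UNIV. \<integral>x. b i x \<partial>torus) = 6 * m"
begin

lemmas measurable_\<kappa> [measurable (raw)] = measurable_curry_comp[OF \<kappa>_measurable]

lemma sum_balance: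
  assumes \<phi>: "\<And>r. (\<phi> has_real_derivative \<phi>' r) (at r)"
    and lip: "\<And>r r'. \<bar>\<phi>' r - \<phi>' r'\<bar> \<le> L' * \<bar>r - r'\<bar>"
    and t: "0 \<le> t0" "t0 \<le> t" "t \<le> T"
  shows "(\<Sum>i\<in>UNIV. \<integral>x. \<phi> (sol i t x) \<partial>torus) - (\<Sum>i\<in>UNIV. \<integral>x. \<phi> (sol i t0 x) \<partial>torus)
      = (\<integral>s. (\<integral>x. \<kappa> s x * (\<Sum>i\<in>UNIV. \<Sum>j\<in>UNIV. \<phi>' (sol i s x) * (sol j s x - sol i s x)) \<partial>torus) \<partial>itv t0 t)"
proof -
  let ?R = "\<lambda>s x. \<kappa> s x * (\<Sum>i\<in>UNIV. \<Sum>j\<in>UNIV. \<phi>' (sol i s x) * (sol j s x - sol i s x))"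
  let ?G = "\<lambda>s x. \<Sum>i\<in>UNIV. \<phi>' (sol i s x) * F i s x"
  have cont': "continuous_on UNIV \<phi>'"
    using lip by (rule continuous_of_lipschitz_bound)
  have [measurable]: "\<phi>' \<in> borel_measurable borel"
    using cont' by (auto intro: borel_measurable_continuous_onI)
  define R where "R = B + B * t"
  obtain P where P: "\<And>r. \<bar>r\<bar> \<le> R \<Longrightarrow> \<bar>\<phi>' r\<bar> \<le> P"
    using continuous_bounded_on_interval[OF cont', of R] by metis
  have bd: "\<bar>\<phi>' (sol i s x) * F i s x\<bar> \<le> P * B" if "t0 \<le> s" "s \<le> t" for i s x
    using P[OF sol_bound[of s t i x, folded R_def]] F_bound[of i s x] that t
    by (auto simp: abs_mult intro!: mult_mono')
  have "(\<Sum>i\<in>UNIV. \<integral>x. \<phi> (sol i t x) \<partial>torus) - (\<Sum>i\<in>UNIV. \<integral>x. \<phi> (sol i t0 x) \<partial>torus)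
      = (\<Sum>i\<in>UNIV. (\<integral>s. (\<integral>x. \<phi>' (sol i s x) * F i s x \<partial>torus) \<partial>itv t0 t))"
    unfolding sum_subtractf[symmetric] by (intro sum.cong refl balance(1)[OF \<phi> lip t(1,2)])
  also have "\<dots> = (\<integral>s. (\<Sum>i\<in>UNIV. (\<integral>x. \<phi>' (sol i s x) * F i s x \<partial>torus)) \<partial>itv t0 t)"
    by (intro Bochner_Integration.integral_sum[symmetric] balance(2)[OF \<phi> lip t(1,2)])
  also have "\<dots> = (\<integral>s. (\<integral>x. (?G s x) \<partial>torus) \<partial>itv t0 t)"
  proof (rule Bochner_Integration.integral_cong[OF refl])
    fix s assume "s \<in> space (itv t0 t)"
    then show "(\<Sum>i\<in>UNIV. (\<integral>x. \<phi>' (sol i s x) * F i s x \<partial>torus)) = (\<integral>x. (?G s x) \<partial>torus)"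
      by (intro Bochner_Integration.integral_sum[symmetric] torus_integrable_bounded[where B = "P * B"])
        (use bd in auto)
  qed
  also have "\<dots> = (\<integral>s. (\<integral>x. ?R s x \<partial>torus) \<partial>itv t0 t)"
  proof (rule integral_cong_AE)
    have "(\<lambda>s. \<integral>x. (?G s x) \<partial>torus) \<in> borel_measurable borel"
      by (rule torus.borel_measurable_lebesgue_integral, rule measurable_pair_torusI)
        (simp add: borel_prod[symmetric] split_beta')
    then show "(\<lambda>s. \<integral>x. (?G s x) \<partial>torus) \<in> borel_measurable (itv t0 t)"
      by (rule measurable_itvI)
    have "(\<lambda>s. \<integral>x. ?R s x \<partial>torus) \<in> borel_measurable borel"
      by (rule torus.borel_measurable_lebesgue_integral, rule measurable_pair_torusI)
        (simp add: borel_prod[symmetric] split_beta')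
    then show "(\<lambda>s. \<integral>x. ?R s x \<partial>torus) \<in> borel_measurable (itv t0 t)"
      by (rule measurable_itvI)
    show "AE s in itv t0 t. (\<integral>x. (?G s x) \<partial>torus)
        = (\<integral>x. ?R s x \<partial>torus)"
      using AE_itv_mono[OF source t(1,3)]
    proof (rule eventually_mono)
      fix s assume ae: "AE x in torus. \<forall>i. F i s x = \<kappa> s x * (\<Sum>j\<in>UNIV. sol j s x - sol i s x)"
      show "(\<integral>x. (?G s x) \<partial>torus)
        = (\<integral>x. ?R s x \<partial>torus)"
      proof (rule integral_cong_AE)
        show "AE x in torus. (?G s x)
            = ?R s x"
          using ae
        proof (rule eventually_mono)
          fix x assume "\<forall>i. F i s x = \<kappa> s x * (\<Sum>j\<in>UNIV. sol j s x - sol i s x)"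
          then have "F i s x = \<kappa> s x * (\<Sum>j\<in>UNIV. sol j s x - sol i s x)" for i by blast
          then show "(?G s x)
            = ?R s x"
            by (simp only: sum_distrib_left mult_ac)
        qed
      qed measurable
    qed
  qed
  finally show ?thesis .
qed

lemma max_principle:
  assumes t: "0 \<le> t" "t \<le> T"
  shows "AE x in torus. sol i t x \<le> M"
proof -
  let ?\<phi> = "\<lambda>r. (max 0 (r - M))\<^sup>2" and ?\<phi>' = "\<lambda>r. 2 * max 0 (r - M)"
  have int: "integrable torus (\<lambda>x. ?\<phi> (sol j t x))" for j
  proof (rule torus_integrable_bounded[where B = "(B + B * T + \<bar>M\<bar>)\<^sup>2"])
    fix x
    have "\<bar>max 0 (sol j t x - M)\<bar> \<le> B + B * T + \<bar>M\<bar>"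
      using sol_bound[OF t, of j x] by (auto simp: max_def)
    from power_mono[OF this, of 2] show "\<bar>?\<phi> (sol j t x)\<bar> \<le> (B + B * T + \<bar>M\<bar>)\<^sup>2" by simp
  qed measurable
  have "(\<Sum>i\<in>UNIV. \<integral>x. ?\<phi> (sol i t x) \<partial>torus) - (\<Sum>i\<in>UNIV. \<integral>x. ?\<phi> (sol i 0 x) \<partial>torus)
      = (\<integral>s. (\<integral>x. \<kappa> s x * (\<Sum>i\<in>UNIV. \<Sum>j\<in>UNIV. ?\<phi>' (sol i s x) * (sol j s x - sol i s x)) \<partial>torus) \<partial>itv 0 t)"
  proof (rule sum_balance[where L' = 2])
    show "\<bar>?\<phi>' r - ?\<phi>' r'\<bar> \<le> 2 * \<bar>r - r'\<bar>" for r r'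
      by (simp add: max_def abs_if)
  qed (rule has_real_derivative_pos_part_sq, simp_all add: t)
  also have "\<dots> \<le> 0"
  proof -
    have "\<kappa> s x * (\<Sum>i\<in>UNIV. \<Sum>j\<in>UNIV. ?\<phi>' (sol i s x) * (sol j s x - sol i s x)) \<le> 0" for s x
    proof -
      \<comment> \<open>The derivative of the test function is nondecreasing, so after
        symmetrisation every term has a sign.\<close>
      have "0 \<le> (?\<phi>' a - ?\<phi>' d) * (a - d)" for a d
        by (cases "a \<le> d") (auto simp: max_def intro: mult_nonpos_nonpos)
      then have "0 \<le> (\<Sum>i\<in>UNIV. \<Sum>j\<in>UNIV. (?\<phi>' (sol i s x) - ?\<phi>' (sol j s x)) * (sol i s x - sol j s x))"
        by (intro sum_nonneg)
      then show ?thesis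
        using \<kappa>_nonneg by (subst sum_exchange) (auto intro!: mult_nonneg_nonpos)
    qed
    then show ?thesis by (intro integral_nonpos)
  qed
  also have "(\<Sum>i\<in>UNIV. \<integral>x. ?\<phi> (sol i 0 x) \<partial>torus) = 0"
    using b_le by (simp add: sol_0 max_absorb1)
  finally have le: "(\<Sum>i\<in>UNIV. \<integral>x. ?\<phi> (sol i t x) \<partial>torus) \<le> 0" by simp
  have "(\<Sum>i\<in>UNIV. \<integral>x. ?\<phi> (sol i t x) \<partial>torus) = 0"
    by (intro antisym le sum_nonneg) (auto intro!: integral_nonneg_AE)
  then have "\<forall>i\<in>UNIV. (\<integral>x. ?\<phi> (sol i t x) \<partial>torus) = 0"
    by (subst (asm) sum_nonneg_eq_0_iff) (auto intro!: integral_nonneg_AE)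
  then have "(\<integral>x. ?\<phi> (sol i t x) \<partial>torus) = 0" by blast
  then have "AE x in torus. ?\<phi> (sol i t x) = 0"
    using integral_nonneg_eq_0_iff_AE[OF int] by simp
  then show ?thesis
    by (rule eventually_mono) (auto simp: max_def split: if_splits)
qed

lemma mass_conservation:
  assumes t: "0 \<le> t" "t \<le> T"
  shows "(\<Sum>i\<in>UNIV. \<integral>x. sol i t x \<partial>torus) = 6 * m"
proof -
  have zero: "(\<Sum>i\<in>UNIV. \<Sum>j\<in>UNIV. 1 * (sol j s x - sol i s x)) = 0" for s x
    by (subst sum_exchange) simp
  have "(\<Sum>i\<in>UNIV. \<integral>x. sol i t x \<partial>torus) - (\<Sum>i\<in>UNIV. \<integral>x. sol i 0 x \<partial>torus)
      = (\<integral>s. (\<integral>x. \<kappa> s x * (\<Sum>i\<in>UNIV. \<Sum>j\<in>UNIV. 1 * (sol j s x - sol i s x)) \<partial>torus) \<partial>itv 0 t)"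
    by (rule sum_balance[where L' = 0 and \<phi> = "\<lambda>r. r"]) (auto simp: t)
  also have "\<dots> = 0" unfolding zero by simp
  finally show ?thesis by (simp add: sol_0 mean_b)
qed

definition energy_at :: "real \<Rightarrow> real" where
  "energy_at t = (\<Sum>i\<in>UNIV. \<integral>x. (sol i t x - m)\<^sup>2 \<partial>torus)"

lemma energy_identity:
  assumes t: "0 \<le> t0" "t0 \<le> t" "t \<le> T"
  shows "energy_at t0 - energy_at t
      = (\<integral>s. (\<integral>x. \<kappa> s x * (\<Sum>i\<in>UNIV. \<Sum>j\<in>UNIV. (sol i s x - sol j s x)\<^sup>2) \<partial>torus) \<partial>itv t0 t)"
proof -
  \<comment> \<open>The 2 from differentiating the square cancels the 1/2 of the symmetrisation, so
    the dissipation carries no numerical factor.\<close>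
  have e: "(\<Sum>i\<in>UNIV. \<Sum>j\<in>UNIV. 2 * (sol i s x - m) * (sol j s x - sol i s x))
      = - (\<Sum>i\<in>UNIV. \<Sum>j\<in>UNIV. (sol i s x - sol j s x)\<^sup>2)" for s x
  proof -
    have "(\<Sum>i\<in>UNIV. \<Sum>j\<in>UNIV. (2 * (sol i s x - m) - 2 * (sol j s x - m)) * (sol i s x - sol j s x))
        = 2 * (\<Sum>i\<in>UNIV. \<Sum>j\<in>UNIV. (sol i s x - sol j s x)\<^sup>2)"
      unfolding sum_distrib_left by (intro sum.cong refl) (simp add: power2_eq_square algebra_simps)
    then show ?thesis by (subst sum_exchange) simp
  qed
  have "energy_at t - energy_at t0
      = (\<integral>s. (\<integral>x. \<kappa> s x * (\<Sum>i\<in>UNIV. \<Sum>j\<in>UNIV. 2 * (sol i s x - m) * (sol j s x - sol i s x)) \<partial>torus) \<partial>itv t0 t)"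
    unfolding energy_at_def
    by (rule sum_balance[where L' = 2 and \<phi> = "\<lambda>r. (r - m)\<^sup>2"]) (auto intro!: derivative_eq_intros simp: t abs_if)
  then show ?thesis unfolding e by simp
qed

lemma energy_nonneg: "0 \<le> energy_at t"
  unfolding energy_at_def by (intro sum_nonneg integral_nonneg_AE) simp

lemma energy_antimono:
  assumes t: "0 \<le> t0" "t0 \<le> t" "t \<le> T"
  shows "energy_at t \<le> energy_at t0"
proof -
  have "0 \<le> energy_at t0 - energy_at t"
    unfolding energy_identity[OF t]
    by (intro integral_nonneg_AE AE_I2 mult_nonneg_nonneg sum_nonneg \<kappa>_nonneg) simp
  then show ?thesis by simp
qed

end

section \<open>Decay for mild solutions\<close>

lemma itv_cauchy_schwarz:
  fixes g :: "real \<Rightarrow> real"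
  assumes g [measurable]: "g \<in> borel_measurable borel" and bd: "\<And>s. \<bar>g s\<bar> \<le> L" and ab: "a \<le> b"
  shows "(\<integral>s. g s \<partial>itv a b)\<^sup>2 \<le> (b - a) * (\<integral>s. (g s)\<^sup>2 \<partial>itv a b)"
proof (cases "a = b")
  case True
  have "\<bar>\<integral>s. g s \<partial>itv a a\<bar> \<le> L * (a - a)"
    by (rule abs_integral_itv_le) (auto simp: bd)
  then show ?thesis using True by simp
next
  case False
  let ?l = "b - a" and ?A = "\<integral>s. g s \<partial>itv a b"
  have l: "0 < ?l" using False ab by simp
  have int: "integrable (itv a b) g" "integrable (itv a b) (\<lambda>s. (g s)\<^sup>2)"
    using power_mono[OF bd, of _ 2]
    by (auto intro: itv_integrable_bounded[OF g bd] intro!: itv_integrable_bounded[of "\<lambda>s. (g s)\<^sup>2" _ _ "L\<^sup>2"])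
  \<comment> \<open>The integrand is the square of \<open>l g - A\<close>, with \<open>l\<close> the
    length of the interval and \<open>A\<close> the integral of \<open>g\<close>; scaling by
    \<open>l\<close> postpones the division to the very end.\<close>
  have "0 \<le> (\<integral>s. (?l * g s - ?A)\<^sup>2 \<partial>itv a b)"
    by (rule integral_nonneg_AE) simp
  also have "\<dots> = (\<integral>s. ?l\<^sup>2 * (g s)\<^sup>2 - 2 * ?l * ?A * g s + ?A\<^sup>2 \<partial>itv a b)"
    by (intro Bochner_Integration.integral_cong refl) (simp add: power2_eq_square algebra_simps)
  also have "\<dots> = ?l\<^sup>2 * (\<integral>s. (g s)\<^sup>2 \<partial>itv a b) - 2 * ?l * ?A * ?A + ?A\<^sup>2 * ?l"
    using int by (simp add: measure_itv ab)
  also have "\<dots> = ?l * (?l * (\<integral>s. (g s)\<^sup>2 \<partial>itv a b) - ?A\<^sup>2)"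
    by (simp add: power2_eq_square algebra_simps)
  finally show ?thesis using l by (simp add: zero_le_mult_iff)
qed

lemma nn_itv_torus_swap:
  fixes f :: "real \<Rightarrow> 'a::euclidean_space \<Rightarrow> ennreal"
  assumes "(\<lambda>z. f (fst z) (snd z)) \<in> borel_measurable borel"
  shows "(\<integral>\<^sup>+x. (\<integral>\<^sup>+s. f s x \<partial>itv a b) \<partial>torus) = (\<integral>\<^sup>+s. (\<integral>\<^sup>+x. f s x \<partial>torus) \<partial>itv a b)"
proof -
  interpret pair_sigma_finite "itv a b" "torus :: 'a measure" ..
  show ?thesis
    using Fubini'[of "\<lambda>s x. f s x"] measurable_borel_pairI[OF assms measurable_ident_itv measurable_ident_torus]
    by (simp add: split_beta')
qed

lemma ennreal_mult3: "0 \<le> a \<Longrightarrow> 0 \<le> b \<Longrightarrow> ennreal a * (ennreal b * ennreal d) = ennreal (a * (b * d))"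
  by (simp add: ennreal_mult')

lemma ennreal_triple:
  assumes "0 \<le> a" "0 \<le> b"
  shows "3 * (ennreal a + ennreal b + ennreal a) = ennreal (3 * (a + b + a))"
proof -
  have "ennreal (3 * (a + b + a)) = ennreal 3 * ennreal (a + b + a)"
    by (rule ennreal_mult') simp
  also have "ennreal (a + b + a) = ennreal a + ennreal b + ennreal a"
    using assms by (simp only: ennreal_plus add_nonneg_nonneg)
  finally show ?thesis by simp
qed

text \<open>When a step of length \<open>\<tau>\<close> loses a fixed fraction of the energy, the
  values at multiples of \<open>\<tau>\<close> decay geometrically, and monotonicity covers the
  times in between. The resulting rate does not depend on the horizon \<open>T\<close>.\<close>

lemma exp_decay_of_step:
  fixes E :: "real \<Rightarrow> real"
  assumes \<tau>: "0 < \<tau>" and C0: "0 \<le> C0"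
    and nonneg: "\<And>t. 0 \<le> E t"
    and mono: "\<And>t0 t. 0 \<le> t0 \<Longrightarrow> t0 \<le> t \<Longrightarrow> t \<le> T \<Longrightarrow> E t \<le> E t0"
    and step: "\<And>t0. 0 \<le> t0 \<Longrightarrow> t0 + \<tau> \<le> T \<Longrightarrow> E t0 \<le> C0 * (E t0 - E (t0 + \<tau>))"
    and t: "0 \<le> t" "t \<le> T"
  shows "E t \<le> exp 1 * exp (- (t / (\<tau> * (1 + C0)))) * E 0"
proof -
  \<comment> \<open>Enlarging \<open>C0\<close> by 1 keeps the contraction factor
    \<open>1 - 1 / C\<close> well defined and nonnegative even for small or vanishing
    \<open>C0\<close>.\<close>
  define C where "C = 1 + C0"
  have C: "1 \<le> C" using C0 by (simp add: C_def)
  have it: "real n * \<tau> \<le> T \<Longrightarrow> E (real n * \<tau>) \<le> (1 - 1 / C) ^ n * E 0" for n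
  proof (induction n)
    case (Suc n)
    have le: "real n * \<tau> + \<tau> \<le> T" using Suc.prems by (simp add: algebra_simps)
    have "E (real n * \<tau>) \<le> C0 * (E (real n * \<tau>) - E (real n * \<tau> + \<tau>))"
      using \<tau> le by (intro step) auto
    moreover have "E (real n * \<tau> + \<tau>) \<le> E (real n * \<tau>)"
      using \<tau> le by (intro mono) auto
    ultimately have "E (real n * \<tau>) \<le> C * (E (real n * \<tau>) - E (real n * \<tau> + \<tau>))"
      by (simp add: C_def algebra_simps)
    then have "E (real n * \<tau> + \<tau>) \<le> (1 - 1 / C) * E (real n * \<tau>)"
      using C by (simp add: field_simps)
    also have "\<dots> \<le> (1 - 1 / C) * ((1 - 1 / C) ^ n * E 0)"
      using C Suc.IH le \<tau> by (intro mult_left_mono) (auto simp: field_simps)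
    finally show ?case by (simp add: algebra_simps)
  qed simp
  define n where "n = nat \<lfloor>t / \<tau>\<rfloor>"
  have n: "real n \<le> t / \<tau>" "t / \<tau> - 1 < real n"
    using t \<tau> unfolding n_def by (auto simp: nat_0_le)
  have nT: "real n * \<tau> \<le> t" using n(1) \<tau> by (simp add: field_simps)
  have "E t \<le> E (real n * \<tau>)" using nT t \<tau> by (intro mono) auto
  also have "\<dots> \<le> (1 - 1 / C) ^ n * E 0" using nT t by (intro it) auto
  also have "\<dots> \<le> exp (- 1 / C) ^ n * E 0"
    using C exp_ge_add_one_self[of "- 1 / C"] by (intro mult_right_mono power_mono nonneg) (auto simp: field_simps)
  also have "exp (- 1 / C) ^ n = exp (- (real n / C))"
    by (simp add: exp_of_nat_mult[symmetric])
  also have "exp (- (real n / C)) * E 0 \<le> (exp 1 * exp (- (t / (\<tau> * C)))) * E 0"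
  proof (intro mult_right_mono nonneg)
    \<comment> \<open>Rounding \<open>t / \<tau>\<close> down loses less than one step, which
      changes the exponent by at most \<open>1 / C \<le> 1\<close>; this is the factor
      \<open>exp 1\<close>.\<close>
    have "t / (\<tau> * C) - 1 / C \<le> real n / C"
      using divide_right_mono[of "t / \<tau> - 1" "real n" C] n(2) C by (simp add: diff_divide_distrib)
    moreover have "1 / C \<le> 1" using C by simp
    ultimately have "- (real n / C) \<le> 1 + - (t / (\<tau> * C))" by linarith
    then show "exp (- (real n / C)) \<le> exp 1 * exp (- (t / (\<tau> * C)))"
      unfolding exp_add[symmetric] by simp
  qed
  finally show ?thesis by (simp add: C_def)
qed

text \<open>\<open>\<kappa>_ge\<close> is the form in which the lower bound on the rate is used:
  exponent and essential infimum are hidden in \<open>\<beta>\<close>. \<open>K\<close> bounds the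
  rate almost everywhere along the solution, in contrast to \<open>B\<close>, which bounds its
  extension at every point.\<close>

locale mild_decay = mild_relaxation +
  fixes K \<beta> :: real
  assumes m_pos: "0 < m" and M_pos: "0 < M" and K_nonneg: "0 \<le> K" and \<beta>_nonneg: "0 \<le> \<beta>"
    and sol_nonneg: "\<And>i t. 0 \<le> t \<Longrightarrow> t \<le> T \<Longrightarrow> AE x in torus. 0 \<le> sol i t x"
    and \<kappa>_le: "AE s in itv 0 T. AE x in torus. \<kappa> s x \<le> K"
    and \<kappa>_ge: "AE s in itv 0 T. AE x in torus.
      \<forall>i j. ((sol i s x)\<^sup>2 - (sol j s x)\<^sup>2)\<^sup>2 \<le> \<beta> * (\<kappa> s x * (sol i s x - sol j s x)\<^sup>2)"
begin

definition diss :: "real \<Rightarrow> real^3 \<Rightarrow> real" where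
  "diss s x = \<kappa> s x * (\<Sum>i\<in>UNIV. \<Sum>j\<in>UNIV. (sol i s x - sol j s x)\<^sup>2)"

lemma diss_measurable: "(\<lambda>z. diss (fst z) (snd z)) \<in> borel_measurable borel"
  unfolding diss_def by (simp add: borel_prod[symmetric])

lemmas measurable_diss [measurable (raw)] = measurable_curry_comp[OF diss_measurable]

lemma diss_nonneg: "0 \<le> diss s x"
  unfolding diss_def by (intro mult_nonneg_nonneg sum_nonneg \<kappa>_nonneg) simp

lemma diss_pair: "\<kappa> s x * (sol i s x - sol j s x)\<^sup>2 \<le> diss s x"
  unfolding diss_def
proof (intro mult_left_mono \<kappa>_nonneg)
  have "(sol i s x - sol j s x)\<^sup>2 \<le> (\<Sum>j\<in>UNIV. (sol i s x - sol j s x)\<^sup>2)"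
    by (rule member_le_sum) auto
  also have "\<dots> \<le> (\<Sum>i\<in>UNIV. \<Sum>j\<in>UNIV. (sol i s x - sol j s x)\<^sup>2)"
    by (rule member_le_sum[where f = "\<lambda>i. \<Sum>j\<in>UNIV. (sol i s x - sol j s x)\<^sup>2"]) (auto intro: sum_nonneg)
  finally show "(sol i s x - sol j s x)\<^sup>2 \<le> (\<Sum>i\<in>UNIV. \<Sum>j\<in>UNIV. (sol i s x - sol j s x)\<^sup>2)" .
qed

lemma diss_bound:
  assumes "0 \<le> s" "s \<le> T"
  shows "\<bar>diss s x\<bar> \<le> B * (\<Sum>i\<in>(UNIV::(3 \<times> bool) set). \<Sum>j\<in>(UNIV::(3 \<times> bool) set). (2 * (B + B * T))\<^sup>2)"
proof -
  have "(sol i s x - sol j s x)\<^sup>2 \<le> (2 * (B + B * T))\<^sup>2" for i j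
  proof -
    have "\<bar>sol i s x - sol j s x\<bar> \<le> 2 * (B + B * T)"
      using sol_bound[OF assms, of i x] sol_bound[OF assms, of j x] by (simp add: abs_le_iff)
    from power_mono[OF this, of 2] show ?thesis by simp
  qed
  then have "diss s x \<le> B * (\<Sum>i\<in>(UNIV::(3 \<times> bool) set). \<Sum>j\<in>(UNIV::(3 \<times> bool) set). (2 * (B + B * T))\<^sup>2)"
    unfolding diss_def using \<kappa>_bound B_nonneg by (intro mult_mono sum_mono) (auto intro!: sum_nonneg)
  then show ?thesis using diss_nonneg[of s x] by simp
qed

lemma nn_diss:
  assumes t: "0 \<le> t0" "t0 \<le> t" "t \<le> T"
  shows "(\<integral>\<^sup>+s. (\<integral>\<^sup>+x. ennreal (diss s x) \<partial>torus) \<partial>itv t0 t) = ennreal (energy_at t0 - energy_at t)"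
proof -
  define L where "L = B * (\<Sum>i\<in>(UNIV::(3 \<times> bool) set). \<Sum>j\<in>(UNIV::(3 \<times> bool) set). (2 * (B + B * T))\<^sup>2)"
  have L: "\<bar>diss s x\<bar> \<le> L" if "t0 \<le> s" "s \<le> t" for s x
    unfolding L_def using diss_bound that t by auto
  have "(\<integral>\<^sup>+s. (\<integral>\<^sup>+x. ennreal (diss s x) \<partial>torus) \<partial>itv t0 t) = (\<integral>\<^sup>+s. ennreal (\<integral>x. diss s x \<partial>torus) \<partial>itv t0 t)"
  proof (rule nn_integral_cong)
    fix s assume "s \<in> space (itv t0 t)"
    then have "integrable torus (diss s)"
      using L by (intro torus_integrable_bounded[where B = L]) auto
    then show "(\<integral>\<^sup>+x. ennreal (diss s x) \<partial>torus) = ennreal (\<integral>x. diss s x \<partial>torus)"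
      by (rule nn_integral_eq_integral) (simp add: diss_nonneg)
  qed
  also have "\<dots> = ennreal (\<integral>s. (\<integral>x. diss s x \<partial>torus) \<partial>itv t0 t)"
    by (rule nn_integral_eq_integral)
      (auto intro!: itv_torus_swap(2)[where L = L] diss_measurable L integral_nonneg_AE AE_I2 diss_nonneg)
  also have "(\<integral>s. (\<integral>x. diss s x \<partial>torus) \<partial>itv t0 t) = energy_at t0 - energy_at t"
    unfolding diss_def by (rule energy_identity[symmetric, OF t])
  finally show ?thesis .
qed

text \<open>Of the two factors \<open>\<kappa>\<close> in the square, one is absorbed by
  \<open>K\<close> and the other stays inside the dissipation. The 6 is Cauchy-Schwarz for a sum
  over six species.\<close>

lemma source_sq_le:
  assumes "F i s x = \<kappa> s x * (\<Sum>j\<in>UNIV. sol j s x - sol i s x)" "\<kappa> s x \<le> K"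
  shows "(F i s x)\<^sup>2 \<le> 6 * K * diss s x"
proof -
  have "(F i s x)\<^sup>2 = \<kappa> s x * (\<kappa> s x * (\<Sum>j\<in>UNIV. sol j s x - sol i s x)\<^sup>2)"
    by (simp add: assms(1) power_mult_distrib power2_eq_square)
  also have "\<dots> \<le> K * (\<kappa> s x * (6 * (\<Sum>j\<in>UNIV. \<Sum>l\<in>UNIV. (sol j s x - sol l s x)\<^sup>2)))"
  proof (intro mult_mono mult_left_mono mult_nonneg_nonneg assms(2) \<kappa>_nonneg K_nonneg)
    have "(\<Sum>j\<in>UNIV. sol j s x - sol i s x)\<^sup>2 \<le> 6 * (\<Sum>j\<in>UNIV. (sol j s x - sol i s x)\<^sup>2)"
      using sum_squared_le_sum_of_squares[of "\<lambda>j. sol j s x - sol i s x" UNIV] by simp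
    also have "\<dots> \<le> 6 * (\<Sum>j\<in>UNIV. \<Sum>l\<in>UNIV. (sol j s x - sol l s x)\<^sup>2)"
    proof (intro mult_left_mono sum_mono)
      fix j
      show "(sol j s x - sol i s x)\<^sup>2 \<le> (\<Sum>l\<in>UNIV. (sol j s x - sol l s x)\<^sup>2)"
        by (rule member_le_sum[where f = "\<lambda>l. (sol j s x - sol l s x)\<^sup>2"]) auto
    qed simp
    finally show "(\<Sum>j\<in>UNIV. sol j s x - sol i s x)\<^sup>2 \<le> 6 * (\<Sum>j\<in>UNIV. \<Sum>l\<in>UNIV. (sol j s x - sol l s x)\<^sup>2)" .
  qed (rule order_refl | rule zero_le_power2)+
  also have "\<dots> = 6 * K * diss s x"
    unfolding diss_def by (simp only: mult_ac)
  finally show ?thesis .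
qed

text \<open>Duhamel: the deviation from free transport is the time integral of the source along the
  characteristic. Cauchy-Schwarz in time costs the length of the interval; translation at each fixed
  time removes the shift before the source is compared with the dissipation.\<close>

lemma path_deviation:
  assumes t: "0 \<le> t0" "t0 \<le> t" "t \<le> T"
  shows "(\<integral>\<^sup>+x. sqdist (path i t x) (path i t0 x) \<partial>torus)
    \<le> ennreal (6 * K * (t - t0) * (energy_at t0 - energy_at t))"
proof -
  let ?G = "\<lambda>s x. F i s (x + (c * s) *\<^sub>R dir i)"
  have "(\<integral>\<^sup>+x. (\<integral>\<^sup>+s. ennreal ((?G s x)\<^sup>2) \<partial>itv t0 t) \<partial>torus)
      = (\<integral>\<^sup>+s. (\<integral>\<^sup>+x. ennreal ((?G s x)\<^sup>2) \<partial>torus) \<partial>itv t0 t)"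
    by (rule nn_itv_torus_swap) (auto simp: borel_prod[symmetric])
  also have "\<dots> = (\<integral>\<^sup>+s. (\<integral>\<^sup>+x. ennreal ((F i s x)\<^sup>2) \<partial>torus) \<partial>itv t0 t)"
  proof (rule nn_integral_cong)
    fix s
    show "(\<integral>\<^sup>+x. ennreal ((?G s x)\<^sup>2) \<partial>torus) = (\<integral>\<^sup>+x. ennreal ((F i s x)\<^sup>2) \<partial>torus)"
      by (rule nn_integral_torus_translate[of "\<lambda>x. ennreal ((F i s x)\<^sup>2)"])
        (measurable, rule periodic_comp[OF F_periodic])
  qed
  also have "\<dots> \<le> (\<integral>\<^sup>+s. (\<integral>\<^sup>+x. ennreal (6 * K) * ennreal (diss s x) \<partial>torus) \<partial>itv t0 t)"
  proof (rule nn_integral_mono_AE)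
    show "AE s in itv t0 t. (\<integral>\<^sup>+x. ennreal ((F i s x)\<^sup>2) \<partial>torus) \<le> (\<integral>\<^sup>+x. ennreal (6 * K) * ennreal (diss s x) \<partial>torus)"
      using AE_itv_mono[OF source t(1,3)] AE_itv_mono[OF \<kappa>_le t(1,3)]
    proof eventually_elim
      case (elim s)
      show ?case
      proof (rule nn_integral_mono_AE)
        show "AE x in torus. ennreal ((F i s x)\<^sup>2) \<le> ennreal (6 * K) * ennreal (diss s x)"
          using elim
        proof eventually_elim
          case (elim x)
          have "F i s x = \<kappa> s x * (\<Sum>j\<in>UNIV. sol j s x - sol i s x)" using elim(1) by blast
          from source_sq_le[OF this elim(2)] show ?case
            using K_nonneg by (simp add: ennreal_mult'[symmetric] ennreal_leI)
        qed
      qed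
    qed
  qed
  also have "\<dots> = ennreal (6 * K) * ennreal (energy_at t0 - energy_at t)"
  proof -
    have "(\<lambda>s. \<integral>\<^sup>+x. ennreal (diss s x) \<partial>torus) \<in> borel_measurable borel"
      by (rule measurable_nn_integral_torus) (simp add: borel_prod[symmetric] split_beta')
    then have m: "(\<lambda>s. \<integral>\<^sup>+x. ennreal (diss s x) \<partial>torus) \<in> borel_measurable (itv t0 t)"
      by (rule measurable_itvI)
    have "(\<integral>\<^sup>+x. ennreal (6 * K) * ennreal (diss s x) \<partial>torus) = ennreal (6 * K) * (\<integral>\<^sup>+x. ennreal (diss s x) \<partial>torus)" for s
      by (rule nn_integral_cmult) measurable
    then show ?thesis
      by (simp only: nn_integral_cmult[OF m] nn_diss[OF t])
  qed
  finally have source_bound: "(\<integral>\<^sup>+x. (\<integral>\<^sup>+s. ennreal ((?G s x)\<^sup>2) \<partial>itv t0 t) \<partial>torus)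
      \<le> ennreal (6 * K) * ennreal (energy_at t0 - energy_at t)" .
  have "(\<integral>\<^sup>+x. sqdist (path i t x) (path i t0 x) \<partial>torus)
      \<le> (\<integral>\<^sup>+x. ennreal (t - t0) * (\<integral>\<^sup>+s. ennreal ((?G s x)\<^sup>2) \<partial>itv t0 t) \<partial>torus)"
  proof (rule nn_integral_mono)
    fix x
    have int: "integrable (itv t0 t) (\<lambda>s. (?G s x)\<^sup>2)"
      using power_mono[OF F_bound, of i _ _ 2] by (intro itv_integrable_bounded[where L = "B\<^sup>2"]) auto
    have "sqdist (path i t x) (path i t0 x) = ennreal ((\<integral>s. ?G s x \<partial>itv t0 t)\<^sup>2)"
      unfolding sqdist_def path_diff[OF t(1,2)] ..
    also have "\<dots> \<le> ennreal ((t - t0) * (\<integral>s. (?G s x)\<^sup>2 \<partial>itv t0 t))"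
      by (intro ennreal_leI itv_cauchy_schwarz[where L = B]) (auto simp: F_bound t)
    also have "\<dots> = ennreal (t - t0) * (\<integral>\<^sup>+s. ennreal ((?G s x)\<^sup>2) \<partial>itv t0 t)"
      using t int by (simp add: ennreal_mult' nn_integral_eq_integral)
    finally show "sqdist (path i t x) (path i t0 x) \<le> ennreal (t - t0) * (\<integral>\<^sup>+s. ennreal ((?G s x)\<^sup>2) \<partial>itv t0 t)" .
  qed
  also have "\<dots> = ennreal (t - t0) * (\<integral>\<^sup>+x. (\<integral>\<^sup>+s. ennreal ((?G s x)\<^sup>2) \<partial>itv t0 t) \<partial>torus)"
  proof (rule nn_integral_cmult)
    have "(\<lambda>x. \<integral>\<^sup>+s. ennreal ((?G s x)\<^sup>2) \<partial>itv t0 t) \<in> borel_measurable borel"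
      by (rule itv.borel_measurable_nn_integral, rule measurable_borel_pairI[OF _ _ measurable_ident_itv])
        (auto simp: borel_prod[symmetric] split_beta')
    then show "(\<lambda>x. \<integral>\<^sup>+s. ennreal ((?G s x)\<^sup>2) \<partial>itv t0 t) \<in> borel_measurable torus"
      by (rule measurable_torusI)
  qed
  also have "\<dots> \<le> ennreal (t - t0) * (ennreal (6 * K) * ennreal (energy_at t0 - energy_at t))"
    by (rule mult_left_mono[OF source_bound]) simp
  also have "\<dots> = ennreal ((t - t0) * (6 * K * (energy_at t0 - energy_at t)))"
    using K_nonneg t by (intro ennreal_mult3) auto
  finally show ?thesis by (simp only: mult_ac)
qed

text \<open>Squaring has Lipschitz constant \<open>2 * M\<close> on \<open>[0, M]\<close>; the bound
  \<open>M\<close> from the maximum principle makes this applicable to the solution.\<close>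

lemma sqdist_sq_le:
  assumes "0 \<le> a" "a \<le> M" "0 \<le> d" "d \<le> M"
  shows "sqdist (a\<^sup>2) (d\<^sup>2) \<le> ennreal (4 * M\<^sup>2) * sqdist a d"
proof -
  have "(a\<^sup>2 - d\<^sup>2)\<^sup>2 = (a + d)\<^sup>2 * (a - d)\<^sup>2"
    by (simp add: power2_eq_square algebra_simps)
  also have "\<dots> \<le> (2 * M)\<^sup>2 * (a - d)\<^sup>2"
    using assms by (intro mult_right_mono power_mono) auto
  finally show ?thesis
    unfolding sqdist_def by (simp add: ennreal_mult'[symmetric] ennreal_leI power_mult_distrib)
qed

text \<open>The parameter \<open>s\<close> is the distance travelled, reached after time
  \<open>s / c\<close>; the unit period of the torus takes \<open>1 / c\<close>. Elapsed time and
  energy loss are enlarged to those of the full period, which makes the bound uniform in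
  \<open>s\<close>. The constant is \<open>24 = 4 * 6\<close>, from squaring and from the source
  bound.\<close>

lemma free_transport_deviation:
  assumes t0: "0 \<le> t0" "t0 + 1 / c \<le> T" and s: "0 \<le> s" "s \<le> 1"
  shows "(\<integral>\<^sup>+x. sqdist ((sol i t0 x)\<^sup>2) ((sol i (t0 + s / c) (x + s *\<^sub>R dir i))\<^sup>2) \<partial>torus)
    \<le> ennreal (24 * M\<^sup>2 * K / c * (energy_at t0 - energy_at (t0 + 1 / c)))"
proof -
  let ?t = "t0 + s / c"
  have sc: "0 \<le> s / c" "s / c \<le> 1 / c" using s c_pos by (auto simp: divide_right_mono)
  have t: "0 \<le> t0" "t0 \<le> ?t" "?t \<le> T" "?t \<le> t0 + 1 / c" "t0 \<le> T" "0 \<le> ?t" using t0 sc by linarith+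
  \<comment> \<open>\<open>path\<close> is indexed by feet at time 0, hence the shift by
    \<open>c * t0\<close> before both values become values of \<open>path\<close> at a common
    foot.\<close>
  have "(\<integral>\<^sup>+x. sqdist (sol i ?t (x + s *\<^sub>R dir i)) (sol i t0 x) \<partial>torus)
      = (\<integral>\<^sup>+x. sqdist (sol i ?t (x + (c * t0) *\<^sub>R dir i + s *\<^sub>R dir i)) (sol i t0 (x + (c * t0) *\<^sub>R dir i)) \<partial>torus)"
    by (rule nn_integral_torus_translate[symmetric, of "\<lambda>x. sqdist (sol i ?t (x + s *\<^sub>R dir i)) (sol i t0 x)"])
      (measurable, rule periodic_comp2[OF periodic_translate[OF sol_periodic] sol_periodic])
  also have "\<dots> = (\<integral>\<^sup>+x. sqdist (path i ?t x) (path i t0 x) \<partial>torus)"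
  proof -
    have "c * ?t = c * t0 + s" using c_pos by (simp add: field_simps)
    then show ?thesis by (simp add: path_eq_sol scaleR_left_distrib add.assoc)
  qed
  also have "\<dots> \<le> ennreal (6 * K * (?t - t0) * (energy_at t0 - energy_at ?t))"
    by (rule path_deviation[OF t(1-3)])
  also have "\<dots> \<le> ennreal (6 * K * (1 / c) * (energy_at t0 - energy_at (t0 + 1 / c)))"
    using energy_antimono[OF t(6,4) t0(2)] energy_antimono[OF t(1-3)] K_nonneg sc c_pos
    by (intro ennreal_leI mult_mono mult_nonneg_nonneg) auto
  finally have dev: "(\<integral>\<^sup>+x. sqdist (sol i ?t (x + s *\<^sub>R dir i)) (sol i t0 x) \<partial>torus)
      \<le> ennreal (6 * K * (1 / c) * (energy_at t0 - energy_at (t0 + 1 / c)))" .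
  have "(\<integral>\<^sup>+x. sqdist ((sol i t0 x)\<^sup>2) ((sol i ?t (x + s *\<^sub>R dir i))\<^sup>2) \<partial>torus)
      \<le> (\<integral>\<^sup>+x. ennreal (4 * M\<^sup>2) * sqdist (sol i ?t (x + s *\<^sub>R dir i)) (sol i t0 x) \<partial>torus)"
  proof (rule nn_integral_mono_AE)
    have per: "periodic (\<lambda>x. 0 \<le> sol i ?t x)" "periodic (\<lambda>x. sol i ?t x \<le> M)"
      by (rule periodic_comp[OF sol_periodic])+
    show "AE x in torus. sqdist ((sol i t0 x)\<^sup>2) ((sol i ?t (x + s *\<^sub>R dir i))\<^sup>2)
        \<le> ennreal (4 * M\<^sup>2) * sqdist (sol i ?t (x + s *\<^sub>R dir i)) (sol i t0 x)"
      using sol_nonneg[OF t(1,5), of i] max_principle[OF t(1,5), of i]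
        AE_torus_translate[OF sol_nonneg[OF t(6,3), of i] per(1), of "s *\<^sub>R dir i"]
        AE_torus_translate[OF max_principle[OF t(6,3), of i] per(2), of "s *\<^sub>R dir i"]
      by eventually_elim (simp add: sqdist_commute[of _ "sol i t0 _"] sqdist_sq_le)
  qed
  also have "\<dots> = ennreal (4 * M\<^sup>2) * (\<integral>\<^sup>+x. sqdist (sol i ?t (x + s *\<^sub>R dir i)) (sol i t0 x) \<partial>torus)"
    by (rule nn_integral_cmult) measurable
  also have "\<dots> \<le> ennreal (4 * M\<^sup>2) * ennreal (6 * K * (1 / c) * (energy_at t0 - energy_at (t0 + 1 / c)))"
    by (rule mult_left_mono[OF dev]) simp
  also have "\<dots> = ennreal (4 * M\<^sup>2 * (6 * K * (1 / c) * (energy_at t0 - energy_at (t0 + 1 / c))))"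
    by (rule ennreal_mult'[symmetric]) simp
  also have "4 * M\<^sup>2 * (6 * K * (1 / c) * (energy_at t0 - energy_at (t0 + 1 / c)))
      = 24 * M\<^sup>2 * K / c * (energy_at t0 - energy_at (t0 + 1 / c))"
    by (simp add: algebra_simps)
  finally show ?thesis .
qed

text \<open>Averaging over the distance \<open>s\<close> amounts to \<open>c\<close> times
  integrating over one period of time, and at almost every time the differences of squares are paid
  for by the dissipation.\<close>

lemma pair_dissipation:
  assumes t0: "0 \<le> t0" "t0 + 1 / c \<le> T"
  shows "(\<integral>\<^sup>+s. (\<integral>\<^sup>+x. sqdist ((sol i (t0 + s / c) x)\<^sup>2) ((sol j (t0 + s / c) x)\<^sup>2) \<partial>torus) \<partial>torus)
    \<le> ennreal (c * \<beta> * (energy_at t0 - energy_at (t0 + 1 / c)))"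
proof -
  let ?t1 = "t0 + 1 / c"
  define H where "H t = (\<integral>\<^sup>+x. sqdist ((sol i t x)\<^sup>2) ((sol j t x)\<^sup>2) \<partial>torus)" for t
  have [measurable]: "H \<in> borel_measurable borel"
    unfolding H_def by (rule measurable_nn_integral_torus) (simp add: borel_prod[symmetric] split_beta')
  have "(\<integral>\<^sup>+t. H t \<partial>itv t0 ?t1) \<le> (\<integral>\<^sup>+t. (\<integral>\<^sup>+x. ennreal \<beta> * ennreal (diss t x) \<partial>torus) \<partial>itv t0 ?t1)"
  proof (rule nn_integral_mono_AE)
    show "AE t in itv t0 ?t1. H t \<le> (\<integral>\<^sup>+x. ennreal \<beta> * ennreal (diss t x) \<partial>torus)"
      using AE_itv_mono[OF \<kappa>_ge t0]
    proof eventually_elim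
      case (elim t)
      show ?case
        unfolding H_def
      proof (rule nn_integral_mono_AE)
        show "AE x in torus. sqdist ((sol i t x)\<^sup>2) ((sol j t x)\<^sup>2) \<le> ennreal \<beta> * ennreal (diss t x)"
          using elim
        proof eventually_elim
          case (elim x)
          have "((sol i t x)\<^sup>2 - (sol j t x)\<^sup>2)\<^sup>2 \<le> \<beta> * (\<kappa> t x * (sol i t x - sol j t x)\<^sup>2)"
            using elim by blast
          also have "\<dots> \<le> \<beta> * diss t x"
            by (rule mult_left_mono[OF diss_pair \<beta>_nonneg])
          finally show ?case
            unfolding sqdist_def using \<beta>_nonneg by (simp add: ennreal_mult'[symmetric] ennreal_leI)
        qed
      qed
    qed
  qed
  also have "\<dots> = ennreal \<beta> * ennreal (energy_at t0 - energy_at ?t1)"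
  proof -
    have t: "0 \<le> t0" "t0 \<le> ?t1" "?t1 \<le> T" using t0 c_pos by auto
    have "(\<lambda>s. \<integral>\<^sup>+x. ennreal (diss s x) \<partial>torus) \<in> borel_measurable borel"
      by (rule measurable_nn_integral_torus) (simp add: borel_prod[symmetric] split_beta')
    then have m: "(\<lambda>s. \<integral>\<^sup>+x. ennreal (diss s x) \<partial>torus) \<in> borel_measurable (itv t0 ?t1)"
      by (rule measurable_itvI)
    have "(\<integral>\<^sup>+x. ennreal \<beta> * ennreal (diss s x) \<partial>torus) = ennreal \<beta> * (\<integral>\<^sup>+x. ennreal (diss s x) \<partial>torus)" for s
      by (rule nn_integral_cmult) measurable
    then show ?thesis
      by (simp only: nn_integral_cmult[OF m] nn_diss[OF t])
  qed
  finally have H_bound: "(\<integral>\<^sup>+t. H t \<partial>itv t0 ?t1) \<le> ennreal \<beta> * ennreal (energy_at t0 - energy_at ?t1)" .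
  have "(\<integral>\<^sup>+s. H (t0 + s / c) \<partial>torus) = (\<integral>\<^sup>+s. H (t0 + s / c) * indicator unit_cell s \<partial>lborel)"
    by (rule nn_integral_torus)
  also have "\<dots> \<le> (\<integral>\<^sup>+s. H (t0 + (1 / c) * s) * indicator {t0..?t1} (t0 + (1 / c) * s) \<partial>lborel)"
    using c_pos by (intro nn_integral_mono) (auto simp: indicator_def unit_cell_def field_simps)
  \<comment> \<open>The factor \<open>c * (1 / c) = 1\<close> is inserted to supply the Jacobian of
    \<open>t = t0 + s / c\<close>.\<close>
  also have "\<dots> = ennreal c * (ennreal \<bar>1 / c\<bar> * (\<integral>\<^sup>+s. H (t0 + (1 / c) * s) * indicator {t0..?t1} (t0 + (1 / c) * s) \<partial>lborel))"
    using c_pos by (simp add: mult.assoc[symmetric] ennreal_mult'[symmetric])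
  also have "\<dots> = ennreal c * (\<integral>\<^sup>+t. H t * indicator {t0..?t1} t \<partial>lborel)"
    using c_pos by (subst nn_integral_real_affine[of "\<lambda>t. H t * indicator {t0..?t1} t" "1 / c" t0]) auto
  also have "\<dots> = ennreal c * (\<integral>\<^sup>+t. H t \<partial>itv t0 ?t1)"
    by (simp add: nn_integral_itv)
  also have "\<dots> \<le> ennreal c * (ennreal \<beta> * ennreal (energy_at t0 - energy_at ?t1))"
    by (rule mult_left_mono[OF H_bound]) simp
  also have "\<dots> = ennreal (c * (\<beta> * (energy_at t0 - energy_at ?t1)))"
    using \<beta>_nonneg c_pos by (intro ennreal_mult3) auto
  finally show ?thesis unfolding H_def by (simp only: mult.assoc)
qed

text \<open>From the state at \<open>x\<close>, follow species \<open>i\<close> to the meeting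
  point, switch to species \<open>j\<close> there, and go back along \<open>j\<close>. The two outer
  legs cost the deviation from free transport and the middle one the dissipation, so that
  \<open>144 = 3 * 2 * 24\<close>, and 198 is the observability constant.\<close>

lemma energy_step:
  assumes t0: "0 \<le> t0" "t0 + 1 / c \<le> T"
  shows "energy_at t0 \<le> 198 * (144 * M\<^sup>2 * K / c + 3 * c * \<beta>) / m\<^sup>2 * (energy_at t0 - energy_at (t0 + 1 / c))"
proof -
  let ?f = "\<lambda>i x. (sol i t0 x)\<^sup>2"
  define D where "D = energy_at t0 - energy_at (t0 + 1 / c)"
  have tT: "t0 \<le> T" "t0 \<le> t0 + 1 / c" using t0 c_pos divide_pos_pos[of 1 c] by linarith+
  have D: "0 \<le> D" unfolding D_def using energy_antimono[OF t0(1) tT(2) t0(2)] by simp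
  define A where "A = 24 * M\<^sup>2 * K / c * D"
  have A: "0 \<le> A" unfolding A_def using D K_nonneg c_pos by simp
  define \<delta> where "\<delta> = (144 * M\<^sup>2 * K / c + 3 * c * \<beta>) * D"
  have \<delta>: "0 \<le> \<delta>" unfolding \<delta>_def using D K_nonneg \<beta>_nonneg c_pos by simp
  have "(\<Sum>i\<in>UNIV. \<integral>x. (sol i t0 x - m)\<^sup>2 \<partial>torus) \<le> 198 * \<delta> / m\<^sup>2"
  proof (rule observability[where B = "B + B * T"])
    fix i j
    let ?P = "\<lambda>s. \<integral>\<^sup>+x. sqdist ((sol i (t0 + s / c) x)\<^sup>2) ((sol j (t0 + s / c) x)\<^sup>2) \<partial>torus"
    have P: "?P \<in> borel_measurable borel"
      by (rule measurable_nn_integral_torus) (simp add: borel_prod[symmetric] split_beta')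
    have "(\<integral>\<^sup>+s. (\<integral>\<^sup>+x. sqdist (?f i x) (?f j (x + s *\<^sub>R (dir i - dir j))) \<partial>torus) \<partial>torus)
        \<le> (\<integral>\<^sup>+s. 3 * (ennreal A + ?P s + ennreal A) \<partial>torus)"
    proof (rule nn_integral_mono)
      fix s :: real assume "s \<in> space torus"
      then have s: "0 \<le> s" "s \<le> 1" by (auto simp: unit_cell_def)
      let ?g = "\<lambda>i x. (sol i (t0 + s / c) x)\<^sup>2" and ?a = "s *\<^sub>R (dir i - dir j)"
      let ?h = "s *\<^sub>R dir i"
      have "(\<integral>\<^sup>+x. sqdist (?f i x) (?f j (x + ?a)) \<partial>torus)
          \<le> (\<integral>\<^sup>+x. 3 * (sqdist (?f i x) (?g i (x + ?h))
            + sqdist (?g i (x + ?h)) (?g j (x + ?h))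
            + sqdist (?g j (x + ?h)) (?f j (x + ?a))) \<partial>torus)"
        by (intro nn_integral_mono sqdist_triangle3)
      also have "\<dots> = 3 * ((\<integral>\<^sup>+x. sqdist (?f i x) (?g i (x + ?h)) \<partial>torus)
            + (\<integral>\<^sup>+x. sqdist (?g i (x + ?h)) (?g j (x + ?h)) \<partial>torus)
            + (\<integral>\<^sup>+x. sqdist (?g j (x + ?h)) (?f j (x + ?a)) \<partial>torus))"
        by (simp add: nn_integral_cmult nn_integral_add)
      also have "\<dots> \<le> 3 * (ennreal A + ?P s + ennreal A)"
      proof (intro mult_left_mono add_mono)
        show "(\<integral>\<^sup>+x. sqdist (?f i x) (?g i (x + ?h)) \<partial>torus) \<le> ennreal A"
          unfolding A_def D_def by (rule free_transport_deviation[OF t0 s])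
        have "(\<integral>\<^sup>+x. sqdist (?g i (x + ?h)) (?g j (x + ?h)) \<partial>torus) = ?P s"
          by (rule nn_integral_torus_translate[of "\<lambda>x. sqdist (?g i x) (?g j x)"])
            (measurable, rule periodic_comp2[OF sol_periodic sol_periodic])
        then show "(\<integral>\<^sup>+x. sqdist (?g i (x + ?h)) (?g j (x + ?h)) \<partial>torus) \<le> ?P s"
          by simp
        \<comment> \<open>The meeting point is also \<open>x + ?a + s *\<^sub>R dir j\<close>;
          translated by \<open>?a\<close>, this leg is the first one for species \<open>j\<close> in
          reverse.\<close>
        have "(\<integral>\<^sup>+x. sqdist (?g j (x + ?h)) (?f j (x + ?a)) \<partial>torus)
          = (\<integral>\<^sup>+x. sqdist (?f j (x + ?a)) (?g j (x + ?a + s *\<^sub>R dir j)) \<partial>torus)"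
          by (simp add: sqdist_commute algebra_simps)
        also have "\<dots> = (\<integral>\<^sup>+x. sqdist (?f j x) (?g j (x + s *\<^sub>R dir j)) \<partial>torus)"
          by (rule nn_integral_torus_translate[of "\<lambda>x. sqdist (?f j x) (?g j (x + s *\<^sub>R dir j))"])
            (measurable, rule periodic_comp2[OF sol_periodic periodic_translate[OF sol_periodic]])
        also have "\<dots> \<le> ennreal A"
          unfolding A_def D_def by (rule free_transport_deviation[OF t0 s])
        finally show "(\<integral>\<^sup>+x. sqdist (?g j (x + ?h)) (?f j (x + ?a)) \<partial>torus) \<le> ennreal A" .
      qed simp
      finally show "(\<integral>\<^sup>+x. sqdist (?f i x) (?f j (x + ?a)) \<partial>torus)
          \<le> 3 * (ennreal A + ?P s + ennreal A)" .
    qed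
    also have "\<dots> = 3 * (ennreal A + (\<integral>\<^sup>+s. ?P s \<partial>torus) + ennreal A)"
      using measurable_torusI[OF P] by (subst nn_integral_cmult) (simp_all add: nn_integral_add)
    also have "\<dots> \<le> 3 * (ennreal A + ennreal (c * \<beta> * D) + ennreal A)"
      unfolding D_def by (intro mult_left_mono add_mono pair_dissipation t0) auto
    also have "\<dots> = ennreal \<delta>"
    proof -
      have "0 \<le> c * \<beta> * D" using c_pos \<beta>_nonneg D by simp
      then have "3 * (ennreal A + ennreal (c * \<beta> * D) + ennreal A) = ennreal (3 * (A + c * \<beta> * D + A))"
        using A by (intro ennreal_triple) auto
      also have "3 * (A + c * \<beta> * D + A) = \<delta>"
        unfolding A_def \<delta>_def by (simp add: algebra_simps)
      finally show ?thesis .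
    qed
    finally show "(\<integral>\<^sup>+s. (\<integral>\<^sup>+x. sqdist (?f i x) (?f j (x + s *\<^sub>R (dir i - dir j))) \<partial>torus) \<partial>torus) \<le> ennreal \<delta>" .
  qed (use sol_bound[OF t0(1) tT(1)] sol_periodic sol_nonneg[OF t0(1) tT(1)] mass_conservation[OF t0(1) tT(1)] m_pos \<delta> in auto)
  then show ?thesis unfolding energy_at_def[symmetric] \<delta>_def D_def by (simp only: times_divide_eq_left mult.assoc)
qed

lemma energy_decay:
  assumes "0 \<le> t" "t \<le> T"
  shows "energy_at t \<le> exp 1 * exp (- (t / (1 / c * (1 + 198 * (144 * M\<^sup>2 * K / c + 3 * c * \<beta>) / m\<^sup>2)))) * energy_at 0"
  by (rule exp_decay_of_step[where T = T])
    (use c_pos K_nonneg \<beta>_nonneg energy_nonneg energy_antimono energy_step assms in auto)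

end

section \<open>Smooth test functions\<close>

lemma Ck_SucI:
  assumes "\<And>x. (f has_derivative D x) (at x)" "\<And>w. Ck n (\<lambda>x. D x w)"
  shows "Ck (Suc n) f"
proof -
  have "frechet_derivative f (at x) = D x" for x
    using frechet_derivative_at[OF assms(1)] by simp
  then show ?thesis using assms by (auto intro: differentiableI)
qed

lemma Ck_SucD:
  assumes "Ck (Suc n) f"
  shows "(f has_derivative frechet_derivative f (at x)) (at x)" "Ck n (\<lambda>x. frechet_derivative f (at x) w)"
  using assms by (auto simp: frechet_derivative_works)

lemma Ck_Suc_mono: "Ck (Suc n) f \<Longrightarrow> Ck n f"
proof (induction n arbitrary: f)
  case 0
  then have "\<And>x. f differentiable (at x)" by simp
  then show ?case
    by (auto simp: continuous_on_eq_continuous_within intro: differentiable_imp_continuous_within)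
next
  case (Suc n)
  have "\<forall>x. f differentiable (at x)" using Suc.prems by simp
  moreover have "Ck n (\<lambda>x. frechet_derivative f (at x) w)" for w
    using Suc.prems by (intro Suc.IH) simp
  ultimately show ?case by simp
qed

lemma Ck_const: "Ck n (\<lambda>x. a)"
proof (induction n arbitrary: a)
  case (Suc n)
  show ?case by (rule Ck_SucI[where D = "\<lambda>x w. 0"]) (auto intro: Suc)
qed simp

lemma Ck_linear: "bounded_linear f \<Longrightarrow> Ck n f"
proof (cases n)
  case 0
  assume "bounded_linear f" then show ?thesis using 0 by (simp add: linear_continuous_on)
next
  case (Suc k)
  assume "bounded_linear f" then show ?thesis
    unfolding Suc by (intro Ck_SucI[where D = "\<lambda>x. f"] bounded_linear_imp_has_derivative Ck_const)
qed

lemma Ck_add: "Ck n f \<Longrightarrow> Ck n g \<Longrightarrow> Ck n (\<lambda>x. f x + g x)"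
proof (induction n arbitrary: f g)
  case (Suc n)
  show ?case
    by (rule Ck_SucI[OF has_derivative_add[OF Ck_SucD(1)[OF Suc.prems(1)] Ck_SucD(1)[OF Suc.prems(2)]]])
      (intro Suc.IH Ck_SucD(2)[OF Suc.prems(1)] Ck_SucD(2)[OF Suc.prems(2)])
qed (auto intro: continuous_intros)

lemma Ck_mult: "Ck n f \<Longrightarrow> Ck n g \<Longrightarrow> Ck n (\<lambda>x. f x * g x)"
proof (induction n arbitrary: f g)
  case (Suc n)
  show ?case
    by (rule Ck_SucI[OF has_derivative_mult[OF Ck_SucD(1)[OF Suc.prems(1)] Ck_SucD(1)[OF Suc.prems(2)]]])
      (intro Ck_add Suc.IH Ck_Suc_mono[OF Suc.prems(1)] Ck_Suc_mono[OF Suc.prems(2)]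
        Ck_SucD(2)[OF Suc.prems(1)] Ck_SucD(2)[OF Suc.prems(2)])
qed (auto intro: continuous_intros)

lemma Ck_compose:
  fixes \<phi> :: "real \<Rightarrow> real"
  shows "Ck n \<phi> \<Longrightarrow> Ck n h \<Longrightarrow> Ck n (\<lambda>x. \<phi> (h x))"
proof (induction n arbitrary: \<phi> h)
  case 0
  then show ?case using continuous_on_compose2[of UNIV \<phi> UNIV h] by simp
next
  case (Suc n)
  let ?D = "\<lambda>x w. frechet_derivative h (at x) w * frechet_derivative \<phi> (at (h x)) 1"
  show ?case
  proof (rule Ck_SucI)
    fix x
    have "((\<lambda>x. \<phi> (h x)) has_derivative (\<lambda>w. frechet_derivative \<phi> (at (h x)) (frechet_derivative h (at x) w))) (at x)"
      by (rule has_derivative_compose[OF Ck_SucD(1)[OF Suc.prems(2)] Ck_SucD(1)[OF Suc.prems(1)]])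
    \<comment> \<open>The derivative of a function of one variable is multiplication by its value at
      \<open>1\<close>. The composite derivative thus becomes a product, to which
      \<open>Ck_mult\<close> and the induction hypothesis apply.\<close>
    also have "(\<lambda>w. frechet_derivative \<phi> (at (h x)) (frechet_derivative h (at x) w)) = ?D x"
    proof
      fix w
      show "frechet_derivative \<phi> (at (h x)) (frechet_derivative h (at x) w) = ?D x w"
        using linear_scale[OF has_derivative_linear[OF Ck_SucD(1)[OF Suc.prems(1), of "h x"]],
            of "frechet_derivative h (at x) w" 1] by simp
    qed
    finally show "((\<lambda>x. \<phi> (h x)) has_derivative ?D x) (at x)" .
  next
    fix w
    show "Ck n (\<lambda>x. ?D x w)"
      by (intro Ck_mult Ck_SucD(2)[OF Suc.prems(2)] Suc.IH[OF Ck_SucD(2)[OF Suc.prems(1)] Ck_Suc_mono[OF Suc.prems(2)]])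
  qed
qed

lemma Ck_real_derivI:
  assumes "\<And>x. (f has_real_derivative f' x) (at x)" "Ck n f'"
  shows "Ck (Suc n) f"
proof (rule Ck_SucI)
  show "(f has_derivative (*) (f' x)) (at x)" for x
    using assms(1) by (simp add: has_field_derivative_def)
  show "Ck n (\<lambda>x. f' x * w)" for w
    by (intro Ck_mult Ck_const assms(2))
qed

lemma smooth_const: "smooth_fun (\<lambda>x. a)"
  by (simp add: smooth_fun_def Ck_const)

lemma smooth_linear: "bounded_linear f \<Longrightarrow> smooth_fun f"
  by (simp add: smooth_fun_def Ck_linear)

lemma smooth_add: "smooth_fun f \<Longrightarrow> smooth_fun g \<Longrightarrow> smooth_fun (\<lambda>x. f x + g x)"
  by (simp add: smooth_fun_def Ck_add)

lemma smooth_mult: "smooth_fun f \<Longrightarrow> smooth_fun g \<Longrightarrow> smooth_fun (\<lambda>x. f x * g x)"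
  by (simp add: smooth_fun_def Ck_mult)

lemma smooth_compose: "smooth_fun (\<phi> :: real \<Rightarrow> real) \<Longrightarrow> smooth_fun h \<Longrightarrow> smooth_fun (\<lambda>x. \<phi> (h x))"
  by (simp add: smooth_fun_def Ck_compose)

lemma smooth_prod: "finite A \<Longrightarrow> (\<And>j. j \<in> A \<Longrightarrow> smooth_fun (f j)) \<Longrightarrow> smooth_fun (\<lambda>x. \<Prod>j\<in>A. f j x)"
  by (induction A rule: finite_induct) (auto intro: smooth_const smooth_mult)

lemma smooth_real_derivI:
  assumes "\<And>x. (f has_real_derivative f' x) (at x)" "smooth_fun f'"
  shows "smooth_fun f"
  unfolding smooth_fun_def
proof
  fix n
  have "Ck (Suc n) f" using assms by (intro Ck_real_derivI) (auto simp: smooth_fun_def)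
  then show "Ck n f" by (rule Ck_Suc_mono)
qed

lemma smooth_has_derivative: "smooth_fun f \<Longrightarrow> (f has_derivative frechet_derivative f (at x)) (at x)"
  unfolding smooth_fun_def by (meson Ck_SucD(1))

lemma smooth_continuous: "smooth_fun f \<Longrightarrow> continuous_on UNIV f"
  unfolding smooth_fun_def by (metis Ck.simps(1))

lemma smooth_sin: "smooth_fun (sin :: real \<Rightarrow> real)"
proof -
  have "Ck n (sin :: real \<Rightarrow> real) \<and> Ck n (cos :: real \<Rightarrow> real)" for n
  proof (induction n)
    case (Suc n)
    have "Ck n (\<lambda>x::real. (- 1) * sin x)" using Suc by (intro Ck_mult Ck_const) auto
    then have "Ck n (\<lambda>x::real. - sin x)" by simp
    then show ?case using Suc
      by (auto intro!: Ck_real_derivI[of sin cos] Ck_real_derivI[of cos "\<lambda>x. - sin x"] DERIV_sin DERIV_cos simp del: Ck.simps)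
  qed (auto intro: continuous_intros)
  then show ?thesis by (simp add: smooth_fun_def)
qed

text \<open>The functions for all \<open>k\<close> together are closed under differentiation up to
  linear combinations, so a single induction over the order proves them smooth.
  \<open>flat 0\<close> is the classical cutoff \<open>exp (- (1 / y))\<close>.\<close>

definition flat :: "nat \<Rightarrow> real \<Rightarrow> real" where
  "flat k y = (if 0 < y then exp (- (1 / y)) / y ^ k else 0)"

lemma flat_tendsto_0: "(flat k \<longlongrightarrow> 0) (at 0)"
proof -
  have right: "(flat k \<longlongrightarrow> 0) (at_right 0)"
  proof (rule Lim_transform_eventually)
    have "((\<lambda>y. inverse y ^ k / exp (inverse y)) \<longlongrightarrow> (0::real)) (at_right 0)"
      by (rule filterlim_compose[OF tendsto_power_div_exp_0 filterlim_inverse_at_top_right])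
    then show "((\<lambda>y. inverse y ^ k / exp (inverse y)) \<longlongrightarrow> (0::real)) (at_right 0)" .
    show "\<forall>\<^sub>F y in at_right 0. inverse y ^ k / exp (inverse y) = flat k y"
      unfolding eventually_at_filter
      by (rule always_eventually) (auto simp: flat_def exp_minus field_simps)
  qed
  have left: "(flat k \<longlongrightarrow> 0) (at_left 0)"
  proof (rule Lim_transform_eventually[OF tendsto_const])
    show "\<forall>\<^sub>F y in at_left 0. 0 = flat k y"
      unfolding eventually_at_filter by (rule always_eventually) (auto simp: flat_def)
  qed
  show ?thesis using left right by (simp add: filterlim_split_at)
qed

lemma flat_has_derivative:
  "(flat k has_real_derivative flat (k + 2) y + (- real k) * flat (k + 1) y) (at y)"
proof (cases y "0::real" rule: linorder_cases)
  case less
  have "((\<lambda>y. 0) has_real_derivative 0) (at y)" by simp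
  then have "(flat k has_real_derivative 0) (at y)"
    by (rule has_field_derivative_transform_within_open[of _ _ _ "{..<0}"]) (use less in \<open>auto simp: flat_def\<close>)
  then show ?thesis using less by (simp add: flat_def)
next
  case greater
  have "((\<lambda>y. exp (- (1 / y)) / y ^ k) has_real_derivative flat (k + 2) y + (- real k) * flat (k + 1) y) (at y)"
  proof (cases k)
    case 0
    then show ?thesis using greater
      by (auto intro!: derivative_eq_intros simp: flat_def field_simps power2_eq_square)
  next
    case (Suc j)
    have "((\<lambda>y. exp (- (1 / y)) / y ^ k) has_real_derivative
        (exp (- (1 / y)) * (1 / y\<^sup>2) * y ^ k - exp (- (1 / y)) * (real k * y ^ (k - 1))) / (y ^ k * y ^ k)) (at y)"
      using greater by (auto intro!: derivative_eq_intros simp: power2_eq_square)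
    moreover have "(exp (- (1 / y)) * (1 / y\<^sup>2) * y ^ k - exp (- (1 / y)) * (real k * y ^ (k - 1))) / (y ^ k * y ^ k)
        = flat (k + 2) y + (- real k) * flat (k + 1) y"
      using greater Suc by (simp add: flat_def power_add power2_eq_square divide_simps) (simp add: algebra_simps)?
    ultimately show ?thesis by simp
  qed
  then show ?thesis
    by (rule has_field_derivative_transform_within_open[of _ _ _ "{0<..}"]) (use greater in \<open>auto simp: flat_def\<close>)
next
  case equal
  have "(flat k has_real_derivative 0) (at 0)"
    unfolding has_field_derivative_iff
  proof (rule Lim_transform_eventually[OF flat_tendsto_0[of "k + 1"]])
    show "\<forall>\<^sub>F y in at 0. flat (k + 1) y = (flat k y - flat k 0) / (y - 0)"
      unfolding eventually_at_filter by (rule always_eventually) (auto simp: flat_def)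
  qed
  then show ?thesis using equal by (simp add: flat_def)
qed

lemma smooth_flat: "smooth_fun (flat k)"
proof -
  have "Ck n (flat k)" for n k
  proof (induction n arbitrary: k)
    case 0
    show ?case using flat_has_derivative by (auto intro!: DERIV_continuous_on[of _ "flat k"])
  next
    case (Suc n)
    show ?case
      by (rule Ck_real_derivI[OF flat_has_derivative]) (intro Ck_add Ck_mult Ck_const Suc)
  qed
  then show ?thesis by (simp add: smooth_fun_def)
qed

section \<open>Test functions in time, in space and along characteristics\<close>

lemma flat_0_nonneg: "0 \<le> flat 0 y" and flat_0_le_1: "flat 0 y \<le> 1"
  by (auto simp: flat_def)

definition bump :: "real \<Rightarrow> real \<Rightarrow> real \<Rightarrow> real" where
  "bump a b t = flat 0 (t - a) * flat 0 (b - t)"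

lemma smooth_affine: "smooth_fun (\<lambda>t::real. r + q * t)"
  using smooth_add[OF smooth_const smooth_linear[OF bounded_linear_mult_right[of q]], of r] by simp

lemma smooth_bump: "smooth_fun (bump a b)"
proof -
  have "smooth_fun (\<lambda>t. flat 0 (- a + 1 * t) * flat 0 (b + (- 1) * t))"
    by (intro smooth_mult smooth_compose[OF smooth_flat] smooth_affine)
  then show ?thesis unfolding bump_def[abs_def] by simp
qed

lemma bump_eq_0: "t \<le> a \<or> b \<le> t \<Longrightarrow> bump a b t = 0"
  by (auto simp: bump_def flat_def)

lemma bump_pos: "a < t \<Longrightarrow> t < b \<Longrightarrow> 0 < bump a b t"
  by (simp add: bump_def flat_def)

lemma bump_bounds: "0 \<le> bump a b t" "bump a b t \<le> 1"
  using flat_0_nonneg flat_0_le_1 by (auto simp: bump_def intro: mult_le_one)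

lemma bump_measurable [measurable]: "bump a b \<in> borel_measurable borel"
  by (rule borel_measurable_continuous_onI[OF smooth_continuous[OF smooth_bump]])

text \<open>\<open>\<theta>\<close> is the primitive of \<open>- bump a b\<close> that vanishes from
  \<open>T\<close> on. In the weak formulation its derivative localises the solution at times
  between \<open>a\<close> and \<open>b\<close>, while its values weight the initial data and the
  source.\<close>

lemma time_cutoff:
  assumes "b \<le> T"
  obtains \<theta> where "smooth_fun \<theta>" "\<And>t. T \<le> t \<Longrightarrow> \<theta> t = 0"
    "\<And>t. (\<theta> has_real_derivative - bump a b t) (at t)"
    "\<And>t. t \<le> T \<Longrightarrow> \<theta> t = (\<integral>s. bump a b s \<partial>itv t T)"
proof -
  obtain \<Theta> where \<Theta>: "\<And>x. (\<Theta> has_vector_derivative bump a b x) (at x)"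
    using einterval_antiderivative[of "-\<infinity>" "\<infinity>" "bump a b"] smooth_continuous[OF smooth_bump, of a b]
    by (auto simp: continuous_on_eq_continuous_at)
  define \<theta> where "\<theta> t = \<Theta> T - \<Theta> t" for t
  have d: "(\<theta> has_real_derivative - bump a b t) (at t)" for t
    unfolding \<theta>_def using \<Theta>[of t]
    by (auto intro!: derivative_eq_intros simp: has_real_derivative_iff_has_vector_derivative[symmetric])
  have sm: "smooth_fun \<theta>"
  proof (rule smooth_real_derivI[OF d])
    have "smooth_fun (\<lambda>t. (- 1) * bump a b t)" by (intro smooth_mult smooth_const smooth_bump)
    then show "smooth_fun (\<lambda>t. - bump a b t)" by simp
  qed
  have int: "\<theta> t = (\<integral>s. bump a b s \<partial>itv t T)" if "t \<le> T" for t
  proof -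
    have "(bump a b has_integral \<Theta> T - \<Theta> t) {t..T}"
      by (rule fundamental_theorem_of_calculus[OF that]) (rule has_vector_derivative_at_within[OF \<Theta>])
    then have "integral {t..T} (bump a b) = \<theta> t" by (simp add: integral_unique \<theta>_def)
    moreover have "(\<integral>s. bump a b s \<partial>itv t T) = integral {t..T} (bump a b)"
      by (rule integral_itv_HK(2)[where L = 1]) (use bump_bounds in auto)
    ultimately show ?thesis by simp
  qed
  have zero: "\<theta> t = 0" if "T \<le> t" for t
  proof -
    have "(bump a b has_integral \<Theta> t - \<Theta> T) {T..t}"
      by (rule fundamental_theorem_of_calculus[OF that]) (rule has_vector_derivative_at_within[OF \<Theta>])
    moreover have "(bump a b has_integral 0) {T..t}"
      by (rule has_integral_is_0) (use assms in \<open>auto intro: bump_eq_0\<close>)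
    ultimately have "\<Theta> t - \<Theta> T = 0" by (rule has_integral_unique)
    then show ?thesis by (simp add: \<theta>_def)
  qed
  show ?thesis by (rule that[OF sm zero d int])
qed

text \<open>Under an integer shift both sines acquire the same sign, so their product is periodic;
  for a box inside the unit cube it is positive there exactly when the coordinate lies between those
  of \<open>l\<close> and \<open>u\<close>. Feeding \<open>n\<close> times this product into
  \<open>flat 0\<close> gives smooth periodic functions that tend to the indicator of the
  box.\<close>

definition box_bump :: "nat \<Rightarrow> real^3 \<Rightarrow> real^3 \<Rightarrow> real^3 \<Rightarrow> real" where
  "box_bump n l u x = (\<Prod>j\<in>UNIV. flat 0 (real n * (sin (pi * (x $ j - l $ j)) * sin (pi * (u $ j - x $ j)))))"

lemma smooth_box_bump_linear:
  fixes L :: "'a::euclidean_space \<Rightarrow> real^3"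
  assumes "bounded_linear L"
  shows "smooth_fun (\<lambda>z. box_bump n l u (L z))"
proof -
  have lin: "smooth_fun (\<lambda>z. r + q * (L z $ j))" for r q j
    by (intro smooth_add smooth_mult smooth_const smooth_linear bounded_linear_compose[OF bounded_linear_vec_nth assms])
  have "smooth_fun (\<lambda>z. \<Prod>j\<in>UNIV. flat 0 (real n * (sin (- pi * l $ j + pi * (L z $ j)) * sin (pi * u $ j + (- pi) * (L z $ j)))))"
    by (intro smooth_prod smooth_compose[OF smooth_flat] smooth_mult smooth_const smooth_compose[OF smooth_sin] lin) simp
  then show ?thesis
    by (simp add: box_bump_def algebra_simps)
qed

lemma box_bump_bounds: "0 \<le> box_bump n l u x" "box_bump n l u x \<le> 1"
  unfolding box_bump_def by (auto intro!: prod_nonneg prod_le_1 flat_0_nonneg flat_0_le_1)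

lemma box_bump_continuous: "continuous_on UNIV (box_bump n l u)"
  using smooth_continuous[OF smooth_box_bump_linear[OF bounded_linear_ident]] .

lemma box_bump_measurable [measurable]: "box_bump n l u \<in> borel_measurable borel"
  by (rule borel_measurable_continuous_onI[OF box_bump_continuous])

lemma sin_product_int_shift:
  "sin (pi * (x + of_int k - l)) * sin (pi * (u - (x + of_int k))) = sin (pi * (x - l)) * sin (pi * (u - x))"
proof -
  have a: "sin (y + of_int k * pi) = (if even k then 1 else - 1) * sin y" for y k
    using sin_npi_int[of k] cos_npi_int[of k] by (simp add: sin_add mult.commute)
  have "pi * (x + of_int k - l) = pi * (x - l) + of_int k * pi"
    "pi * (u - (x + of_int k)) = pi * (u - x) + of_int (- k) * pi"
    by (simp_all add: algebra_simps)
  then show ?thesis by (simp only: a) simp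
qed

lemma box_bump_periodic: "periodic (box_bump n l u)"
  unfolding periodic_def
proof (intro ballI allI)
  fix m x :: "real^3" assume m: "m \<in> lattice"
  have "\<exists>k. m $ j = of_int k" for j
  proof -
    have "m \<bullet> axis j 1 \<in> \<int>" using m by (auto simp: lattice_def Basis_vec_def)
    then show ?thesis by (auto simp: inner_axis elim: Ints_cases)
  qed
  then obtain k where k: "\<And>j. m $ j = of_int (k j)" by metis
  show "box_bump n l u (x + m) = box_bump n l u x"
    unfolding box_bump_def by (simp add: k sin_product_int_shift)
qed

lemma sin_product_pos_iff:
  assumes "0 \<le> x" "x \<le> 1" "0 \<le> l" "l < u" "u \<le> 1"
  shows "0 < sin (pi * (x - l)) * sin (pi * (u - x)) \<longleftrightarrow> l < x \<and> x < u"
proof -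
  have pos: "0 \<le> sin (pi * r)" if "0 \<le> r" "r \<le> 1" for r
    using that by (intro sin_ge_zero) auto
  have pos': "0 < sin (pi * r)" if "0 < r" "r < 1" for r
    using that by (intro sin_gt_zero) auto
  have neg: "sin (pi * r) \<le> 0" if "- 1 \<le> r" "r \<le> 0" for r
    using pos[of "- r"] that by simp
  consider "x \<le> l" | "l < x" "x < u" | "u \<le> x" by linarith
  then show ?thesis
  proof cases
    case 1
    then have "sin (pi * (x - l)) * sin (pi * (u - x)) \<le> 0"
      using assms by (intro mult_nonpos_nonneg neg pos) auto
    then show ?thesis using 1 by auto
  next
    case 2
    then show ?thesis using assms by (auto intro!: mult_pos_pos pos')
  next
    case 3
    then have "sin (pi * (x - l)) * sin (pi * (u - x)) \<le> 0"
      using assms by (intro mult_nonneg_nonpos neg pos) auto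
    then show ?thesis using 3 by auto
  qed
qed

lemma flat_scaled_tendsto: "(\<lambda>n. flat 0 (real n * y)) \<longlonglongrightarrow> (if 0 < y then 1 else 0)"
proof (cases "0 < y")
  case True
  have "(\<lambda>n. exp (- (1 / y) * inverse (real n))) \<longlonglongrightarrow> exp (- (1 / y) * 0)"
    by (intro tendsto_intros LIMSEQ_inverse_real_of_nat[THEN LIMSEQ_imp_Suc] lim_inverse_n)
  moreover have "\<forall>\<^sub>F n in sequentially. exp (- (1 / y) * inverse (real n)) = flat 0 (real n * y)"
    using eventually_gt_at_top[of 0] by eventually_elim (use True in \<open>simp add: flat_def field_simps\<close>)
  ultimately show ?thesis using True by (auto intro: Lim_transform_eventually)
next
  case False
  then have "flat 0 (real n * y) = 0" for n
    by (auto simp: flat_def zero_less_mult_iff)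
  then show ?thesis using False by simp
qed

lemma box_bump_tendsto:
  assumes "\<And>j. 0 \<le> x $ j \<and> x $ j \<le> 1" "\<And>j. 0 \<le> l $ j \<and> l $ j < u $ j \<and> u $ j \<le> 1"
  shows "(\<lambda>n. box_bump n l u x) \<longlonglongrightarrow> indicator (box l u) x"
proof -
  have "(\<lambda>n. box_bump n l u x) \<longlonglongrightarrow> (\<Prod>j\<in>UNIV. if l $ j < x $ j \<and> x $ j < u $ j then 1 else (0::real))"
    unfolding box_bump_def
  proof (rule tendsto_prod)
    fix j
    show "(\<lambda>n. flat 0 (real n * (sin (pi * (x $ j - l $ j)) * sin (pi * (u $ j - x $ j)))))
        \<longlonglongrightarrow> (if l $ j < x $ j \<and> x $ j < u $ j then 1 else 0)"
      using flat_scaled_tendsto[of "sin (pi * (x $ j - l $ j)) * sin (pi * (u $ j - x $ j))"]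
        sin_product_pos_iff[of "x $ j" "l $ j" "u $ j"] assms by simp
  qed
  also have "(\<Prod>j\<in>UNIV. if l $ j < x $ j \<and> x $ j < u $ j then 1 else (0::real)) = indicator (box l u) x"
    by (auto simp: indicator_def mem_box_cart prod_eq_1_iff intro!: prod_zero)
  finally show ?thesis .
qed

text \<open>The spatial factor is carried along by the flow, so differentiation in the direction of
  transport sees only \<open>\<theta>\<close>. Integer shifts commute with the flow, hence
  periodicity in space survives.\<close>

lemma transport_test_function:
  fixes d l u :: "real^3" and \<theta> :: "real \<Rightarrow> real" and c :: real and n :: nat
  assumes \<theta>: "smooth_fun \<theta>" "\<And>t. T \<le> t \<Longrightarrow> \<theta> t = 0" "\<And>t. (\<theta> has_real_derivative \<theta>' t) (at t)"
  defines "\<psi> \<equiv> \<lambda>z. \<theta> (fst z) * box_bump n l u (snd z - (c * fst z) *\<^sub>R d)"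
  shows "test_fun \<psi>"
    and "frechet_derivative \<psi> (at (t, x)) (1, c *\<^sub>R d) = \<theta>' t * box_bump n l u (x - (c * t) *\<^sub>R d)"
proof -
  let ?L = "\<lambda>z::real \<times> (real^3). snd z - (c * fst z) *\<^sub>R d"
  have L: "bounded_linear ?L"
    by (intro bounded_linear_sub bounded_linear_snd bounded_linear_scaleR_const
        bounded_linear_compose[OF bounded_linear_mult_right bounded_linear_fst])
  have sm: "smooth_fun \<psi>"
    unfolding \<psi>_def
    by (intro smooth_mult smooth_compose[OF \<theta>(1)] smooth_linear[OF bounded_linear_fst] smooth_box_bump_linear[OF L])
  have ax: "axis i 1 \<in> (lattice :: (real^3) set)" for i
    using dir_lattice[of "(i, True)"] by (simp add: dir_def)
  have "\<psi> (t, x + axis i 1) = \<psi> (t, x)" for t x i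
    using periodicD[OF box_bump_periodic ax, of n l u "x - (c * t) *\<^sub>R d" i]
    by (simp add: \<psi>_def algebra_simps)
  moreover have "\<forall>t x. T \<le> t \<longrightarrow> \<psi> (t, x) = 0"
    by (simp add: \<psi>_def \<theta>(2))
  ultimately show "test_fun \<psi>"
    unfolding test_fun_def using sm by blast
  let ?X = "box_bump n l u"
  have X: "(?X has_derivative frechet_derivative ?X (at y)) (at y)" for y
    by (rule smooth_has_derivative) (rule smooth_box_bump_linear[OF bounded_linear_ident])
  have "((\<lambda>z. \<theta> (fst z)) has_derivative (\<lambda>h. \<theta>' t * fst h)) (at (t, x))"
    using has_derivative_compose[OF has_derivative_fst[OF has_derivative_ident], of \<theta> "\<lambda>h. \<theta>' t * h" "(t, x)" UNIV]
      \<theta>(3)[of t] by (simp add: has_field_derivative_def)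
  moreover have "((\<lambda>z. ?X (?L z)) has_derivative (\<lambda>h. frechet_derivative ?X (at (?L (t, x))) (?L h))) (at (t, x))"
    by (rule has_derivative_compose[OF bounded_linear_imp_has_derivative[OF L] X])
  ultimately have "(\<psi> has_derivative (\<lambda>h. \<theta> (fst (t, x)) * frechet_derivative ?X (at (?L (t, x))) (?L h)
      + \<theta>' t * fst h * ?X (?L (t, x)))) (at (t, x))"
    unfolding \<psi>_def by (rule has_derivative_mult)
  from frechet_derivative_at[OF this]
  have "frechet_derivative \<psi> (at (t, x)) (1, c *\<^sub>R d)
      = \<theta> t * frechet_derivative ?X (at (?L (t, x))) 0 + \<theta>' t * ?X (x - (c * t) *\<^sub>R d)"
    by (metis (no_types, lifting) cancel_comm_monoid_add_class.diff_cancel fst_conv mult.right_neutral snd_conv)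
  then show "frechet_derivative \<psi> (at (t, x)) (1, c *\<^sub>R d) = \<theta>' t * ?X (x - (c * t) *\<^sub>R d)"
    using linear_0[OF has_derivative_linear[OF X]] by simp
qed

section \<open>Borel representatives and separation by boxes\<close>

lemma axis_Basis: "axis j 1 \<in> (Basis :: (real^'n) set)"
  by (simp add: axis_in_Basis_iff)

lemma One_nth: "(One :: real^'n) $ j = 1"
proof -
  have "(One :: real^'n) \<bullet> b = 1" if "b \<in> Basis" for b
    using that by (simp add: inner_sum_left inner_Basis)
  from this[OF axis_Basis] show ?thesis by (simp add: inner_axis)
qed

lemma T3_eq_cbox: "T3 = cbox 0 (One :: real^3)"
  unfolding T3_def by (rule set_eqI) (simp add: mem_box_cart One_nth del: sum_component)

lemma T3_measurable [measurable]: "T3 \<in> sets borel"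
  by (simp add: T3_eq_cbox)

lemma T3_lebesgue: "T3 \<in> sets lebesgue"
  by (simp add: T3_eq_cbox)

lemma AE_T3_iff: "(AE x in lebesgue_on T3. P x) \<longleftrightarrow> (AE x in torus. P x)"
proof -
  have "(AE x in lebesgue_on T3. P x) \<longleftrightarrow> (AE x in lborel. x \<in> T3 \<longrightarrow> P x)"
    using T3_lebesgue by (subst AE_restrict_space_iff) (simp_all add: AE_completion_iff)
  also have "\<dots> \<longleftrightarrow> (AE x in lborel. x \<in> unit_cell \<longrightarrow> P x)"
    by (rule eventually_subst, rule eventually_mono[OF AE_unit_cell_iff_cbox]) (auto simp: T3_eq_cbox)
  also have "\<dots> \<longleftrightarrow> (AE x in torus. P x)"
    unfolding torus_def by (subst AE_restrict_space_iff) auto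
  finally show ?thesis .
qed

lemma int_T3_eq:
  assumes f: "f \<in> borel_measurable (lebesgue_on T3)" and g [measurable]: "g \<in> borel_measurable borel"
    and fg: "AE x in torus. f x = g x"
  shows "int_T3 f = (\<integral>x. g x \<partial>torus)"
proof -
  have "int_T3 f = (\<integral>x. g x \<partial>lebesgue_on T3)"
    unfolding int_T3_def
  proof (rule integral_cong_AE[OF f])
    show "g \<in> borel_measurable (lebesgue_on T3)"
      by (rule measurable_restrict_space1) (simp add: measurable_completion)
    show "AE x in lebesgue_on T3. f x = g x" using fg by (simp add: AE_T3_iff)
  qed
  also have "\<dots> = (\<integral>x. indicator T3 x *\<^sub>R g x \<partial>lebesgue)"
    using T3_lebesgue by (subst integral_restrict_space) auto
  also have "\<dots> = (\<integral>x. indicator T3 x *\<^sub>R g x \<partial>lborel)"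
    by (rule integral_completion) measurable
  also have "\<dots> = (\<integral>x. indicator unit_cell x *\<^sub>R g x \<partial>lborel)"
    by (rule integral_cong_AE, measurable, rule eventually_mono[OF AE_unit_cell_iff_cbox])
      (auto simp: T3_eq_cbox indicator_def)
  also have "\<dots> = (\<integral>x. g x \<partial>torus)"
    unfolding torus_def by (subst integral_restrict_space) auto
  finally show ?thesis .
qed

text \<open>Composition with \<open>wrap\<close> makes the representative periodic at every point
  and changes nothing on the cell.\<close>

lemma ex_borel_rep_T3:
  fixes f :: "real^3 \<Rightarrow> real"
  assumes "f \<in> borel_measurable (lebesgue_on T3)"
  obtains g where "g \<in> borel_measurable borel" "periodic g" "AE x in torus. f x = g x"
proof -
  have "(\<lambda>x. indicator T3 x *\<^sub>R f x) \<in> borel_measurable (completion lborel)"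
    using assms T3_lebesgue by (subst (asm) borel_measurable_restrict_space_iff) auto
  from completion_ex_borel_measurable_real[OF this]
  obtain g where g: "g \<in> borel_measurable lborel" "AE x in lborel. indicator T3 x *\<^sub>R f x = g x" by auto
  then have [measurable]: "g \<in> borel_measurable borel" by simp
  have "AE x in torus. f x = g (wrap x)"
    unfolding torus_def
    using g(2) by (subst AE_restrict_space_iff)
      (auto elim!: eventually_mono simp: wrap_unit_cell T3_eq_cbox dest: subsetD[OF unit_cell_bounds(2)])
  then show ?thesis
    by (intro that[of "\<lambda>x. g (wrap x)"]) (auto intro: periodic_wrap)
qed

lemma ex_borel_rep_QT:
  fixes w :: "real \<Rightarrow> real^3 \<Rightarrow> real"
  assumes meas: "(\<lambda>z. w (fst z) (snd z)) \<in> borel_measurable (lebesgue_on ({0..<T} \<times> T3))"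
  obtains g where "g \<in> borel_measurable borel"
    "AE z in lborel. z \<in> {0..<T} \<times> T3 \<longrightarrow> w (fst z) (snd z) = g z"
proof -
  have S: "{0..<T} \<times> T3 \<in> sets (borel :: (real \<times> (real^3)) measure)"
    by (simp add: borel_prod[symmetric])
  then have "(\<lambda>z. indicator ({0..<T} \<times> T3) z *\<^sub>R w (fst z) (snd z)) \<in> borel_measurable (completion lborel)"
    using meas by (subst (asm) borel_measurable_restrict_space_iff) auto
  from completion_ex_borel_measurable_real[OF this]
  obtain g where g: "g \<in> borel_measurable lborel"
    "AE z in lborel. indicator ({0..<T} \<times> T3) z *\<^sub>R w (fst z) (snd z) = g z" by auto
  show ?thesis
    by (rule that[of g]) (use g in \<open>auto elim!: eventually_mono\<close>)
qed

text \<open>Replaces an integral over unbounded time in the completed measure by an iterated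
  integral of a bounded Borel function supported in \<open>[0, T]\<close>, where Fubini is
  available.\<close>

lemma int_QT_eq:
  assumes g: "(\<lambda>z. g (fst z) (snd z)) \<in> borel_measurable borel"
    and bd: "\<And>t x. 0 \<le> t \<Longrightarrow> t \<le> T \<Longrightarrow> \<bar>g t x\<bar> \<le> L" and zero: "\<And>t x. T < t \<Longrightarrow> g t x = 0"
    and fg: "AE z in lborel. z \<in> {0..} \<times> T3 \<longrightarrow> f (fst z) (snd z) = g (fst z) (snd z)"
  shows "int_QT f = (\<integral>t. (\<integral>x. g t x \<partial>torus) \<partial>itv 0 T)"
proof -
  let ?S = "{0..} \<times> T3 :: (real \<times> (real^3)) set"
  define G where "G z = indicator ({0..T} \<times> unit_cell) z * g (fst z) (snd z)" for z :: "real \<times> (real^3)"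
  have S: "?S \<in> sets borel" by (simp add: borel_prod[symmetric])
  have C: "{0..T} \<times> unit_cell \<in> sets (borel :: (real \<times> (real^3)) measure)" by (simp add: borel_prod[symmetric])
  have G [measurable]: "G \<in> borel_measurable borel"
    unfolding G_def using g C by measurable
  have cell: "AE z in (lborel :: (real \<times> (real^3)) measure). snd z \<in> unit_cell \<longleftrightarrow> snd z \<in> (T3 :: (real^3) set)"
    unfolding lborel_prod[symmetric]
  proof (rule lborel_pair.AE_pair_measure)
    show "{z \<in> space (lborel \<Otimes>\<^sub>M lborel). snd z \<in> unit_cell \<longleftrightarrow> snd z \<in> T3} \<in> sets (lborel \<Otimes>\<^sub>M lborel)"
      by measurable
    show "AE t in (lborel :: real measure). AE x in lborel. snd (t, x) \<in> unit_cell \<longleftrightarrow> snd (t, x) \<in> T3"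
      by (rule AE_I2) (use AE_unit_cell_iff_cbox in \<open>simp add: T3_eq_cbox\<close>)
  qed
  have fG: "AE z in lborel. G z = indicator ?S z *\<^sub>R f (fst z) (snd z)"
    using fg cell
  proof eventually_elim
    case (elim z)
    then show ?case
      using zero[of "fst z" "snd z"] by (cases z) (auto simp: G_def indicator_def not_le)
  qed
  have "int_QT f = (\<integral>z. indicator ?S z *\<^sub>R f (fst z) (snd z) \<partial>lebesgue)"
    unfolding int_QT_def using S by (subst integral_restrict_space) auto
  also have "\<dots> = (\<integral>z. G z \<partial>lebesgue)"
  proof (rule integral_cong_AE)
    show "G \<in> borel_measurable lebesgue" by (simp add: measurable_completion)
    \<comment> \<open>Lebesgue measure is complete, so equality almost everywhere with a Borel
      function gives measurability.\<close>
    then show "(\<lambda>z. indicator ?S z *\<^sub>R f (fst z) (snd z)) \<in> borel_measurable lebesgue"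
      by (rule borel_measurable_AE) (use fG in \<open>simp add: AE_completion_iff\<close>)
    show "AE z in lebesgue. indicator ?S z *\<^sub>R f (fst z) (snd z) = G z"
      using fG by (auto simp: AE_completion_iff elim!: eventually_mono)
  qed
  also have "\<dots> = (\<integral>z. G z \<partial>(lborel \<Otimes>\<^sub>M lborel))"
    by (simp add: integral_completion lborel_prod)
  also have "\<dots> = (\<integral>t. (\<integral>x. G (t, x) \<partial>lborel) \<partial>lborel)"
  proof (rule lborel_pair.integral_fst'[symmetric])
    have "integrable lborel G"
    proof (rule integrableI_bounded_set[where A = "{0..T} \<times> unit_cell" and B = L])
      show "emeasure lborel ({0..T} \<times> (unit_cell :: (real^3) set)) < \<infinity>"
      proof -
        have "emeasure lborel (unit_cell :: (real^3) set) = 1"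
          using emeasure_torus_unit_cell by (simp add: torus_def emeasure_restrict_space)
        then show ?thesis
          unfolding lborel_prod[symmetric] using emeasure_compact_finite[of "{0..T}"]
          by (subst lborel.emeasure_pair_measure_Times) auto
      qed
    qed (use C bd in \<open>auto simp: G_def indicator_def intro!: AE_I2\<close>)
    then show "integrable (lborel \<Otimes>\<^sub>M lborel) G" by (simp add: lborel_prod)
  qed
  also have "\<dots> = (\<integral>t. indicator {0..T} t * (\<integral>x. g t x \<partial>torus) \<partial>lborel)"
  proof (rule Bochner_Integration.integral_cong[OF refl])
    fix t
    have "(\<integral>x. G (t, x) \<partial>lborel) = (\<integral>x. indicator {0..T} t * (indicator unit_cell x *\<^sub>R g t x) \<partial>lborel)"
      by (rule Bochner_Integration.integral_cong) (auto simp: G_def indicator_def)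
    also have "\<dots> = indicator {0..T} t * (\<integral>x. g t x \<partial>torus)"
      unfolding torus_def by (subst integral_restrict_space) auto
    finally show "(\<integral>x. G (t, x) \<partial>lborel) = indicator {0..T} t * (\<integral>x. g t x \<partial>torus)" .
  qed
  also have "\<dots> = (\<integral>t. (\<integral>x. g t x \<partial>torus) \<partial>itv 0 T)"
    by (simp add: integral_itv)
  finally show ?thesis .
qed

text \<open>Open boxes form an intersection-stable generator of the Borel sets. Vanishing of the
  integrals extends to all Borel sets by Dynkin's argument, and these integrals determine an
  integrable function up to a null set.\<close>

lemma zero_on_boxes_imp_AE_zero:
  fixes g :: "real^3 \<Rightarrow> real"
  assumes int: "integrable torus g"
    and box: "\<And>l u. (\<And>j. 0 \<le> l $ j \<and> l $ j < u $ j \<and> u $ j \<le> 1) \<Longrightarrow> (\<integral>x. indicator (box l u) x * g x \<partial>torus) = 0"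
  shows "AE x in torus. g x = 0"
proof -
  \<comment> \<open>Arbitrary boxes are clipped to the unit cube. Almost every point of the cell is
    an interior point, so clipping to an open box changes no integral.\<close>
  have mod_box: "(\<integral>x. indicator (box l u) x *\<^sub>R g x \<partial>torus) = 0" for l u
  proof -
    define l' u' :: "real^3" where "l' = (\<chi> j. max 0 (l $ j))" "u' = (\<chi> j. min 1 (u $ j))"
    note defs = this
    have bd: "AE x in (torus :: (real^3) measure). \<forall>j. 0 < x $ j \<and> x $ j < 1"
    proof -
      have "AE x in torus. x \<in> box 0 (One::real^3)"
      proof -
        have "cbox 0 One - box 0 (One::real^3) \<in> null_sets lborel" by (simp add: null_sets_cbox_Diff_box)
        then have "AE x in lborel. x \<notin> cbox 0 One - box 0 (One::real^3)" by (rule AE_not_in)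
        then show ?thesis
          unfolding torus_def by (subst AE_restrict_space_iff)
            (auto elim!: eventually_mono dest: subsetD[OF unit_cell_bounds(2)])
      qed
      then show ?thesis
      proof (rule eventually_mono)
        fix x :: "real^3" assume x: "x \<in> box 0 One"
        then show "\<forall>j. 0 < x $ j \<and> x $ j < 1"
          by (simp add: mem_box_cart One_nth del: sum_component)
      qed
    qed
    have "(\<integral>x. indicator (box l u) x *\<^sub>R g x \<partial>torus) = (\<integral>x. indicator (box l' u') x * g x \<partial>torus)"
    proof (rule integral_cong_AE)
      show "AE x in torus. indicator (box l u) x *\<^sub>R g x = indicator (box l' u') x * g x"
        using bd by (rule eventually_mono) (auto simp: defs indicator_def mem_box_cart)
      show "(\<lambda>x. indicator (box l u) x *\<^sub>R g x) \<in> borel_measurable torus"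
        "(\<lambda>x. indicator (box l' u') x * g x) \<in> borel_measurable torus"
        using borel_measurable_integrable[OF int] by measurable
    qed
    also have "\<dots> = 0"
    proof (cases "\<forall>j. l' $ j < u' $ j")
      case True
      then show ?thesis by (intro box) (auto simp: defs)
    next
      case False
      then obtain j where "\<not> l' $ j < u' $ j" by blast
      then have "x \<notin> box l' u'" for x
        unfolding mem_box_cart by (meson less_trans)
      then have "box l' u' = {}" by blast
      then show ?thesis by simp
    qed
    finally show ?thesis .
  qed
  \<comment> \<open>The cell lies in one large open box; this value is needed for complements in the
    induction.\<close>
  have all: "(\<integral>x. g x \<partial>torus) = 0"
  proof -
    have "indicator (box (\<chi> j. - 1) (\<chi> j. 2)) x *\<^sub>R g x = g x" if "x \<in> space torus" for x
    proof -
      have "x \<in> T3" using that unit_cell_bounds(2) by (auto simp: T3_eq_cbox)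
      then have "0 \<le> x $ j" "x $ j \<le> 1" for j by (auto simp: T3_def)
      then have "- 1 < x $ j \<and> x $ j < 2" for j
        using le_less_trans[of "x $ j" 1 2] less_le_trans[of "- 1" 0 "x $ j"] by simp
      then have "x \<in> box (\<chi> j. - 1) (\<chi> j. 2)"
        by (simp add: mem_box_cart)
      then show ?thesis by simp
    qed
    then have "(\<integral>x. g x \<partial>torus) = (\<integral>x. indicator (box (\<chi> j. - 1) (\<chi> j. 2)) x *\<^sub>R g x \<partial>torus)"
      by (intro Bochner_Integration.integral_cong) simp_all
    then show ?thesis using mod_box by simp
  qed
  have set_int: "set_integrable torus (A :: (real^3) set) g" if "A \<in> sets borel" for A
    unfolding set_integrable_def
  proof (rule Bochner_Integration.integrable_bound[OF int])
    show "(\<lambda>x. indicator A x *\<^sub>R g x) \<in> borel_measurable torus"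
      by (intro borel_measurable_scaleR borel_measurable_integrable[OF int] measurable_torusI
          borel_measurable_indicator that)
  qed (auto simp: indicator_def)
  have borel: "sets (borel :: (real^3) measure) = sigma_sets UNIV (range (\<lambda>(a, b). box a b))"
    by (subst borel_eq_box) simp
  have stable: "Int_stable (range (\<lambda>(a, b). box a b :: (real^3) set))"
    unfolding Int_stable_def by (auto simp: box_Int_box)
  have subset_Pow: "range (\<lambda>(a, b). box a b :: (real^3) set) \<subseteq> Pow UNIV" by simp
  have zero: "(\<integral>x. indicator A x *\<^sub>R g x \<partial>torus) = 0" if "A \<in> sets borel" for A
    using stable subset_Pow that unfolding borel
  proof (induction A rule: sigma_sets_induct_disjoint)
    case (basic A)
    then show ?case using mod_box by auto
  next
    case (compl A)
    have "A \<in> sets borel" using compl(1) by (simp only: borel)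
    then have i: "integrable torus (\<lambda>x. indicator A x *\<^sub>R g x)" using set_int by (simp add: set_integrable_def)
    have "(\<integral>x. indicator (UNIV - A) x *\<^sub>R g x \<partial>torus) = (\<integral>x. g x - indicator A x *\<^sub>R g x \<partial>torus)"
      by (rule Bochner_Integration.integral_cong) (auto simp: indicator_def)
    also have "\<dots> = 0" using int i compl.IH all by simp
    finally show ?case .
  next
    case (union A)
    have A: "A i \<in> sets borel" for i using union(2) by (auto simp only: borel)
    \<comment> \<open>Measurable sets of \<open>torus\<close> lie in the cell, so countable
      additivity is applied to the intersections with it.\<close>
    have restr: "(\<integral>x. indicator B x *\<^sub>R g x \<partial>torus) = (LINT x:(B \<inter> unit_cell)|torus. g x)" for B
      unfolding set_lebesgue_integral_def
      by (rule Bochner_Integration.integral_cong) (auto simp: indicator_def)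
    have "(LINT x:(\<Union>i. A i \<inter> unit_cell)|torus. g x) = (\<Sum>i. (LINT x:(A i \<inter> unit_cell)|torus. g x))"
    proof (rule lebesgue_integral_countable_add)
      show "A i \<inter> unit_cell \<in> sets torus" for i
        using A[of i] by (auto simp: torus_def sets_restrict_space)
      show "A i \<inter> unit_cell \<inter> (A j \<inter> unit_cell) = {}" if "i \<noteq> j" for i j
        using union(1) that by (auto simp: disjoint_family_on_def)
      show "set_integrable torus (\<Union>i. A i \<inter> unit_cell) g"
        using A by (intro set_int) auto
    qed
    also have "(\<Union>i. A i \<inter> unit_cell) = (\<Union>i. A i) \<inter> unit_cell" by blast
    also have "(\<Sum>i. (LINT x:(A i \<inter> unit_cell)|torus. g x)) = 0"
      using union.IH unfolding restr by simp
    finally show ?case unfolding restr .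
  qed simp_all
  show ?thesis
  proof (rule density_unique_real[OF int, of "\<lambda>_. 0"])
    fix A assume "A \<in> sets (torus :: (real^3) measure)"
    then have "A \<in> sets borel" by (auto simp: torus_def sets_restrict_space)
    from zero[OF this] show "(LINT x:A|torus. g x) = (LINT x:A|torus. 0)"
      by (simp add: set_lebesgue_integral_def)
  qed simp
qed

section \<open>Weak solutions are mild solutions\<close>

text \<open>Fubini over the triangle \<open>t \<le> s\<close>. It trades the time cutoff, a
  primitive of the bump, for the running integral of the source.\<close>

lemma triangle_swap:
  fixes g h :: "real \<Rightarrow> real"
  assumes [measurable]: "g \<in> borel_measurable borel" "h \<in> borel_measurable borel"
    and g: "\<And>s. \<bar>g s\<bar> \<le> L" and h: "\<And>s. \<bar>h s\<bar> \<le> L'"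
  shows "(\<integral>t. (\<integral>s. g s \<partial>itv t T) * h t \<partial>itv 0 T) = (\<integral>s. g s * (\<integral>t. h t \<partial>itv 0 s) \<partial>itv 0 T)"
proof -
  interpret pair_sigma_finite "itv 0 T" "itv 0 T" ..
  interpret P: finite_measure "itv 0 T \<Otimes>\<^sub>M itv 0 T"
    by (rule finite_measure_pair_measure) unfold_locales
  have "integrable (itv 0 T \<Otimes>\<^sub>M itv 0 T) (\<lambda>(t, s). if t \<le> s then g s * h t else 0)"
  proof (rule P.integrable_const_bound[of _ "L * L'"])
    have "0 \<le> L" "0 \<le> L'" using g[of 0] h[of 0] by auto
    then show "AE z in itv 0 T \<Otimes>\<^sub>M itv 0 T. norm (case z of (t, s) \<Rightarrow> if t \<le> s then g s * h t else 0) \<le> L * L'"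
      using g h by (auto intro!: AE_I2 mult_mono simp: abs_mult)
    have "(\<lambda>(t::real, s). if t \<le> s then g s * h t else 0) \<in> borel_measurable borel"
      by (simp add: borel_prod[symmetric])
    then show "(\<lambda>(t, s). if t \<le> s then g s * h t else 0) \<in> borel_measurable (itv 0 T \<Otimes>\<^sub>M itv 0 T)"
      by (rule measurable_borel_pairI[OF _ measurable_ident_itv measurable_ident_itv])
  qed
  from Fubini_integral[OF this]
  have swap: "(\<integral>s. (\<integral>t. (if t \<le> s then g s * h t else 0) \<partial>itv 0 T) \<partial>itv 0 T)
      = (\<integral>t. (\<integral>s. (if t \<le> s then g s * h t else 0) \<partial>itv 0 T) \<partial>itv 0 T)" .
  have "(\<integral>t. (\<integral>s. g s \<partial>itv t T) * h t \<partial>itv 0 T) = (\<integral>t. (\<integral>s. (if t \<le> s then g s * h t else 0) \<partial>itv 0 T) \<partial>itv 0 T)"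
  proof (rule Bochner_Integration.integral_cong[OF refl])
    fix t assume "t \<in> space (itv 0 T)"
    then have t: "0 \<le> t" "t \<le> T" by auto
    have "(\<integral>s. g s \<partial>itv t T) * h t = (\<integral>s. (indicator {t..T} s * g s) * h t \<partial>lborel)"
      by (simp add: integral_itv)
    also have "\<dots> = (\<integral>s. indicator {0..T} s * (if t \<le> s then g s * h t else 0) \<partial>lborel)"
      using t by (intro Bochner_Integration.integral_cong) (auto simp: indicator_def)
    finally show "(\<integral>s. g s \<partial>itv t T) * h t = (\<integral>s. (if t \<le> s then g s * h t else 0) \<partial>itv 0 T)"
      by (simp add: integral_itv)
  qed
  also have "\<dots> = (\<integral>s. g s * (\<integral>t. h t \<partial>itv 0 s) \<partial>itv 0 T)"
    unfolding swap[symmetric]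
  proof (rule Bochner_Integration.integral_cong[OF refl])
    fix s assume "s \<in> space (itv 0 T)"
    then have s: "0 \<le> s" "s \<le> T" by auto
    have "g s * (\<integral>t. h t \<partial>itv 0 s) = (\<integral>t. g s * (indicator {0..s} t * h t) \<partial>lborel)"
      by (simp add: integral_itv)
    also have "\<dots> = (\<integral>t. indicator {0..T} t * (if t \<le> s then g s * h t else 0) \<partial>lborel)"
      using s by (intro Bochner_Integration.integral_cong) (auto simp: indicator_def)
    finally show "(\<integral>t. (if t \<le> s then g s * h t else 0) \<partial>itv 0 T) = g s * (\<integral>t. h t \<partial>itv 0 s)"
      by (simp add: integral_itv)
  qed
  finally show ?thesis .
qed

text \<open>Fundamental lemma of the calculus of variations with bumps supported strictly inside the
  time interval; the end points are reached by continuity.\<close>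

lemma bump_test_zero:
  fixes G :: "real \<Rightarrow> real"
  assumes T: "0 < T" and G: "continuous_on {0..T} G"
    and zero: "\<And>a b. 0 < a \<Longrightarrow> a < b \<Longrightarrow> b < T \<Longrightarrow> integral {0..T} (\<lambda>s. bump a b s * G s) = 0"
    and s: "s \<in> {0..T}"
  shows "G s = 0"
proof -
  have inner: "G r = 0" if r: "r \<in> {0<..<T}" for r
  proof (rule ccontr)
    assume ne: "G r \<noteq> 0"
    have "continuous (at r within {0..T}) G" using G r by (auto simp: continuous_on_eq_continuous_within)
    then obtain e where e: "e > 0" "\<And>y. y \<in> {0..T} \<Longrightarrow> \<bar>y - r\<bar> < e \<Longrightarrow> \<bar>G y - G r\<bar> < \<bar>G r\<bar>"
      using ne unfolding continuous_within_eps_delta dist_real_def by (metis zero_less_abs_iff)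
    define h where "h = Min {e, r, T - r} / 2"
    have h: "0 < h" "h < e" "h < r" "h < T - r" using e r by (auto simp: h_def)
    \<comment> \<open>The factor \<open>sgn (G r)\<close> makes the integrand nonnegative, since
      \<open>G\<close> keeps its sign on the support of the bump.\<close>
    let ?f = "\<lambda>s. bump (r - h) (r + h) s * (sgn (G r) * G s)"
    have "integral {0..T} ?f = sgn (G r) * integral {0..T} (\<lambda>s. bump (r - h) (r + h) s * G s)"
      by (subst integral_mult_right[symmetric]) (simp add: mult_ac)
    also have "\<dots> = 0" using h by (subst zero) auto
    finally have int0: "integral {0..T} ?f = 0" .
    have cont: "continuous_on {0..T} ?f"
      by (intro continuous_intros G continuous_on_subset[OF smooth_continuous[OF smooth_bump]]) auto
    have nonneg: "0 \<le> ?f y" if y: "y \<in> {0..T}" for y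
    proof (cases "\<bar>y - r\<bar> < h")
      case True
      then have "\<bar>G y - G r\<bar> < \<bar>G r\<bar>" using e y h by auto
      then have "0 \<le> sgn (G r) * G y" using ne by (auto simp: sgn_if)
      then show ?thesis using bump_bounds by simp
    next
      case False
      then have "bump (r - h) (r + h) y = 0" by (intro bump_eq_0) auto
      then show ?thesis by simp
    qed
    have "\<forall>y\<in>{0..T}. ?f y = 0"
      using integral_eq_0_iff[OF cont T nonneg] int0 by blast
    then have "?f r = 0" using r by auto
    moreover have "0 < bump (r - h) (r + h) r" using h by (intro bump_pos) auto
    ultimately show False using ne by (auto simp: sgn_if split: if_splits)
  qed
  have cl: "closure {0<..<T} = {0..T}" using T by simp
  show ?thesis
    by (rule continuous_constant_on_closure[of "{0<..<T}" G]) (use G inner s cl in auto)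
qed

section \<open>Time slices of a weak solution\<close>

lemma integrable_torus_translate:
  fixes f :: "'a::euclidean_space \<Rightarrow> real"
  assumes [measurable]: "f \<in> borel_measurable borel" and per: "periodic f" and int: "integrable torus f"
  shows "integrable torus (\<lambda>x. f (x + h))"
proof -
  have "integrable (distr torus torus (\<lambda>x. wrap (x + h))) f"
    using int by (subst distr_torus_translate)
  then have "integrable torus (\<lambda>x. f (wrap (x + h)))"
    by (subst (asm) integrable_distr_eq) auto
  then show ?thesis by (simp add: periodic_eq_wrap[OF per])
qed

lemma integrable_torus_rep:
  fixes f g :: "real^3 \<Rightarrow> real"
  assumes f: "integrable (lebesgue_on T3) f" and g [measurable]: "g \<in> borel_measurable borel"
    and fg: "AE x in torus. f x = g x"
  shows "integrable torus g"
proof -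
  have "integrable (lebesgue_on T3) g"
  proof (rule integrable_cong_AE_imp[OF f])
    show "g \<in> borel_measurable (lebesgue_on T3)"
      by (rule measurable_restrict_space1) (simp add: measurable_completion)
    show "AE x in lebesgue_on T3. f x = g x" using fg by (simp add: AE_T3_iff)
  qed
  then have "integrable lebesgue (\<lambda>x. indicator T3 x *\<^sub>R g x)"
    using T3_lebesgue integrable_restrict_space[of T3 lebesgue g] by simp
  then have "integrable lborel (\<lambda>x. indicator T3 x *\<^sub>R g x)"
    by (subst (asm) integrable_completion) auto
  then have "integrable lborel (\<lambda>x. indicator unit_cell x *\<^sub>R g x)"
  proof (rule integrable_cong_AE_imp)
    show "AE x in lborel. indicator T3 x *\<^sub>R g x = indicator unit_cell x *\<^sub>R g x"
      by (rule eventually_mono[OF AE_unit_cell_iff_cbox]) (auto simp: T3_eq_cbox indicator_def)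
  qed measurable
  then show ?thesis
    unfolding torus_def by (subst integrable_restrict_space) auto
qed

lemma sol_regular_measurable: "sol_regular w \<Longrightarrow> 0 \<le> t \<Longrightarrow> w t \<in> borel_measurable (lebesgue_on T3)"
  unfolding sol_regular_def by (meson order_refl)

lemma sol_regular_integrable:
  assumes "sol_regular w" "0 \<le> t"
  shows "integrable (lebesgue_on T3) (w t)"
proof -
  have "integrable (lebesgue_on T3) (\<lambda>x. \<bar>w t x\<bar> powr 1)"
    using assms unfolding sol_regular_def by (meson order_refl)
  then have "integrable (lebesgue_on T3) (\<lambda>x. \<bar>w t x\<bar>)" by simp
  then show ?thesis
    using sol_regular_measurable[OF assms] by (simp add: integrable_abs_iff)
qed

lemma sol_regular_L1_continuous:
  assumes "sol_regular w" "0 \<le> t"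
  shows "((\<lambda>s. int_T3 (\<lambda>x. \<bar>w s x - w t x\<bar>)) \<longlongrightarrow> 0) (at t within {0..})"
proof -
  have "((\<lambda>s. int_T3 (\<lambda>x. \<bar>w s x - w t x\<bar> powr 1)) \<longlongrightarrow> 0) (at t within {0..})"
    using assms unfolding sol_regular_def by (meson order_refl)
  then show ?thesis by simp
qed

lemma borel_lebesgue_on: "f \<in> borel_measurable borel \<Longrightarrow> f \<in> borel_measurable (lebesgue_on T3)"
  by (rule measurable_restrict_space1) (simp add: measurable_completion)

text \<open>Two effects are separated. With \<open>w t\<close> fixed, the motion of the test
  function is handled by dominated convergence; the change of \<open>w\<close> is controlled by its
  continuity in L1, uniformly because the test function is bounded by 1.\<close>

lemma moving_average_continuous:
  fixes X :: "real^3 \<Rightarrow> real"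
  assumes w: "sol_regular w" and X: "continuous_on UNIV X" and X1: "\<And>x. \<bar>X x\<bar> \<le> 1"
  shows "continuous_on {0..} (\<lambda>t. int_T3 (\<lambda>x. w t x * X (x - (c * t) *\<^sub>R d)))"
  unfolding continuous_on_sequentially
proof (intro allI ballI impI, elim conjE)
  fix r :: "nat \<Rightarrow> real" and t assume t: "t \<in> {0..}" and r: "\<forall>n. r n \<in> {0..}" and lim: "r \<longlonglongrightarrow> t"
  let ?Y = "\<lambda>t x. X (x - (c * t) *\<^sub>R d)"
  let ?A = "\<lambda>t. int_T3 (\<lambda>x. w t x * ?Y t x)"
  have [measurable]: "X \<in> borel_measurable borel" by (rule borel_measurable_continuous_onI[OF X])
  have Xm: "(\<lambda>x. X (x - h)) \<in> borel_measurable (lebesgue_on T3)" for h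
    by (rule borel_lebesgue_on) measurable
  have int: "integrable (lebesgue_on T3) (w s)" if "0 \<le> s" for s
    by (rule sol_regular_integrable[OF w that])
  have intX: "integrable (lebesgue_on T3) (\<lambda>x. w s x * X (x - h))" if "0 \<le> s" for s h
  proof (rule Bochner_Integration.integrable_bound[OF int[OF that]])
    show "(\<lambda>x. w s x * X (x - h)) \<in> borel_measurable (lebesgue_on T3)"
      using sol_regular_measurable[OF w that] Xm by measurable
    show "AE x in lebesgue_on T3. norm (w s x * X (x - h)) \<le> norm (w s x)"
      by (rule AE_I2) (simp add: abs_mult mult_left_le X1)
  qed
  have r0: "0 \<le> r n" for n using r by simp
  have t0: "0 \<le> t" using t by simp
  have "(\<lambda>n. int_T3 (\<lambda>x. w t x * ?Y (r n) x)) \<longlonglongrightarrow> ?A t"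
    unfolding int_T3_def
  proof (rule integral_dominated_convergence[where w = "\<lambda>x. \<bar>w t x\<bar>"])
    show "integrable (lebesgue_on T3) (\<lambda>x. \<bar>w t x\<bar>)" using int[OF t0] by simp
    show "AE x in lebesgue_on T3. (\<lambda>n. w t x * ?Y (r n) x) \<longlonglongrightarrow> w t x * ?Y t x"
    proof (rule AE_I2)
      fix x
      have "isCont X (x - (c * t) *\<^sub>R d)" using X by (simp add: continuous_on_eq_continuous_at)
      moreover have "(\<lambda>n. x - (c * r n) *\<^sub>R d) \<longlonglongrightarrow> x - (c * t) *\<^sub>R d" by (intro tendsto_intros lim)
      ultimately have "(\<lambda>n. ?Y (r n) x) \<longlonglongrightarrow> ?Y t x"
        by (rule isCont_tendsto_compose)
      then show "(\<lambda>n. w t x * ?Y (r n) x) \<longlonglongrightarrow> w t x * ?Y t x"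
        by (intro tendsto_intros)
    qed
    show "AE x in lebesgue_on T3. norm (w t x * ?Y (r n) x) \<le> \<bar>w t x\<bar>" for n
      by (rule AE_I2) (simp add: abs_mult mult_left_le X1)
  qed (use intX[OF t0] in auto)
  moreover have "(\<lambda>n. ?A (r n) - int_T3 (\<lambda>x. w t x * ?Y (r n) x)) \<longlonglongrightarrow> 0"
  proof (rule Lim_null_comparison)
    have "continuous (at t within {0..}) (\<lambda>s. int_T3 (\<lambda>x. \<bar>w s x - w t x\<bar>))"
      using sol_regular_L1_continuous[OF w t0] by (simp add: continuous_within int_T3_def)
    then show "(\<lambda>n. int_T3 (\<lambda>x. \<bar>w (r n) x - w t x\<bar>)) \<longlonglongrightarrow> 0"
      using r lim unfolding continuous_within_sequentially by (auto simp: comp_def int_T3_def)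
    have "norm (?A (r n) - int_T3 (\<lambda>x. w t x * ?Y (r n) x)) \<le> int_T3 (\<lambda>x. \<bar>w (r n) x - w t x\<bar>)" for n
    proof -
      have "?A (r n) - int_T3 (\<lambda>x. w t x * ?Y (r n) x)
          = (\<integral>x. w (r n) x * ?Y (r n) x - w t x * ?Y (r n) x \<partial>lebesgue_on T3)"
        unfolding int_T3_def using intX[OF r0] intX[OF t0] by simp
      also have "norm \<dots> \<le> (\<integral>x. norm (w (r n) x * ?Y (r n) x - w t x * ?Y (r n) x) \<partial>lebesgue_on T3)"
        by (rule integral_norm_bound)
      also have "\<dots> \<le> int_T3 (\<lambda>x. \<bar>w (r n) x - w t x\<bar>)"
        unfolding int_T3_def
      proof (rule integral_mono)
        fix x
        have "norm (w (r n) x * ?Y (r n) x - w t x * ?Y (r n) x)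
            = \<bar>w (r n) x - w t x\<bar> * \<bar>?Y (r n) x\<bar>"
          by (simp add: left_diff_distrib[symmetric] abs_mult)
        also have "\<dots> \<le> \<bar>w (r n) x - w t x\<bar>" by (simp add: mult_left_le X1)
        finally show "norm (w (r n) x * ?Y (r n) x - w t x * ?Y (r n) x) \<le> \<bar>w (r n) x - w t x\<bar>" .
      qed (use int[OF r0] int[OF t0] intX[OF r0] intX[OF t0] in auto)
      finally show ?thesis .
    qed
    then show "\<forall>\<^sub>F n in sequentially. norm (?A (r n) - int_T3 (\<lambda>x. w t x * ?Y (r n) x))
        \<le> int_T3 (\<lambda>x. \<bar>w (r n) x - w t x\<bar>)"
      by (intro always_eventually allI)
  qed
  ultimately have "(\<lambda>n. (?A (r n) - int_T3 (\<lambda>x. w t x * ?Y (r n) x))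
      + int_T3 (\<lambda>x. w t x * ?Y (r n) x)) \<longlonglongrightarrow> 0 + ?A t"
    by (intro tendsto_add)
  then show "(?A \<circ> r) \<longlonglongrightarrow> ?A t" by (simp add: comp_def)
qed

lemma abs_integral_torus_le:
  fixes f :: "'a::euclidean_space \<Rightarrow> real"
  assumes "f \<in> borel_measurable borel" "\<And>x. \<bar>f x\<bar> \<le> r"
  shows "\<bar>\<integral>x. f x \<partial>torus\<bar> \<le> r"
proof -
  have "\<bar>\<integral>x. f x \<partial>torus\<bar> \<le> (\<integral>x. \<bar>f x\<bar> \<partial>torus)"
    using integral_norm_bound[of torus f] by simp
  also have "\<dots> \<le> (\<integral>x. r \<partial>(torus :: 'a measure))"
    by (rule integral_mono) (use assms torus_integrable_bounded[OF assms] in auto)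
  finally show ?thesis by simp
qed

text \<open>\<open>w\<close> and \<open>S\<close> are the raw solution and source, \<open>uh\<close>
  and \<open>F\<close> Borel representatives of them. With the source frozen, the weak formulation
  is that of linear transport with given right-hand side, whose solution is the explicit
  \<open>sol\<close>. The derivative in the direction \<open>(1, c *\<^sub>R dir i)\<close> covers
  both signs of the speed.\<close>

locale weak_transport = mild_transport +
  fixes T :: real and w uh S :: "3 \<times> bool \<Rightarrow> real \<Rightarrow> real^3 \<Rightarrow> real" and w0 :: "3 \<times> bool \<Rightarrow> real^3 \<Rightarrow> real"
  assumes T_pos: "0 < T"
    and uh_measurable: "\<And>i. (\<lambda>z. uh i (fst z) (snd z)) \<in> borel_measurable borel"
    and uh_bound: "\<And>i s x. \<bar>uh i s x\<bar> \<le> B"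
    and uh_eq: "\<And>i. AE z in lborel. z \<in> {0..<T} \<times> T3 \<longrightarrow> w i (fst z) (snd z) = uh i (fst z) (snd z)"
    and S_eq: "\<And>i. AE z in lborel. z \<in> {0..<T} \<times> T3 \<longrightarrow> S i (fst z) (snd z) = F i (fst z) (snd z)"
    and w_regular: "\<And>i. sol_regular (w i)"
    and w0_measurable: "\<And>i. w0 i \<in> borel_measurable (lebesgue_on T3)"
    and w0_eq: "\<And>i. AE x in torus. w0 i x = b i x"
    and weak: "\<And>i \<psi>. test_fun \<psi> \<Longrightarrow>
      int_QT (\<lambda>t x. w i t x * frechet_derivative \<psi> (at (t, x)) (1, c *\<^sub>R dir i))
      + int_T3 (\<lambda>x. \<psi> (0, x) * w0 i x) + int_QT (\<lambda>t x. S i t x * \<psi> (t, x)) = 0"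
begin

lemmas measurable_uh [measurable (raw)] = measurable_curry_comp[OF uh_measurable]

lemma w_eq_uh: "AE s in itv 0 T. AE x in torus. w i s x = uh i s x"
proof -
  have "AE s in lborel. AE x in lborel. (s, x) \<in> {0..<T} \<times> T3 \<longrightarrow> w i s x = uh i s x"
    using lborel_pair.AE_pair[OF uh_eq[unfolded lborel_prod[symmetric]], of i] by simp
  then show ?thesis
    unfolding AE_itv_iff using AE_lborel_singleton[of T]
  proof eventually_elim
    case (elim s)
    show ?case
    proof
      assume "s \<in> {0..T}"
      then have "s \<in> {0..<T}" using elim by auto
      then have "AE x in lborel. x \<in> T3 \<longrightarrow> w i s x = uh i s x" using elim by simp
      then show "AE x in torus. w i s x = uh i s x"
        unfolding torus_def by (subst AE_restrict_space_iff)
          (auto elim!: eventually_mono simp: T3_eq_cbox dest: subsetD[OF unit_cell_bounds(2)])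
    qed
  qed
qed

context
  fixes i :: "3 \<times> bool" and n :: nat and l u :: "real^3"
begin

definition X :: "real^3 \<Rightarrow> real" where "X = box_bump n l u"
text \<open>Pairing with a test function carried by the flow turns the transport equation into the
  ordinary differential equation \<open>avg' = src\<close> with initial value
  \<open>ini\<close>.\<close>

definition avg :: "real \<Rightarrow> real" where "avg t = int_T3 (\<lambda>x. w i t x * X (x - (c * t) *\<^sub>R dir i))"
definition src :: "real \<Rightarrow> real" where "src t = (\<integral>x. F i t x * X (x - (c * t) *\<^sub>R dir i) \<partial>torus)"
definition ini :: real where "ini = (\<integral>x. b i x * X x \<partial>torus)"

lemma X_measurable [measurable]: "X \<in> borel_measurable borel"
  by (simp add: X_def)

lemma X_bound: "\<bar>X x\<bar> \<le> 1"
  using box_bump_bounds[of n l u x] by (simp add: X_def)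

lemma mult_X_bound: "\<bar>r\<bar> \<le> B \<Longrightarrow> \<bar>r * X x\<bar> \<le> B"
  using mult_mono[of "\<bar>r\<bar>" B "\<bar>X x\<bar>" 1] X_bound B_nonneg by (simp add: abs_mult)

lemma src_measurable [measurable]: "src \<in> borel_measurable borel"
  unfolding src_def
  by (rule torus.borel_measurable_lebesgue_integral, rule measurable_pair_torusI)
    (simp add: borel_prod[symmetric] split_beta')

lemma src_bound: "\<bar>src t\<bar> \<le> B"
  unfolding src_def by (rule abs_integral_torus_le) (auto intro: mult_X_bound F_bound)

lemma src_primitive_measurable [measurable]: "(\<lambda>s. \<integral>t. src t \<partial>itv 0 s) \<in> borel_measurable borel"
proof -
  have "(\<lambda>s. \<integral>t. (if 0 \<le> t \<and> t \<le> s then src t else 0) \<partial>lborel) \<in> borel_measurable borel"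
    by (rule lborel.borel_measurable_lebesgue_integral) measurable
  moreover have "(\<integral>t. src t \<partial>itv 0 s) = (\<integral>t. (if 0 \<le> t \<and> t \<le> s then src t else 0) \<partial>lborel)" for s
    unfolding integral_itv by (rule Bochner_Integration.integral_cong) auto
  ultimately show ?thesis by simp
qed
lemma rep_avg_measurable [measurable]:
  "(\<lambda>s. \<integral>x. uh i s x * X (x - (c * s) *\<^sub>R dir i) \<partial>torus) \<in> borel_measurable borel"
  by (rule torus.borel_measurable_lebesgue_integral, rule measurable_pair_torusI)
    (simp add: borel_prod[symmetric] split_beta')

text \<open>The integrated form of that differential equation, tested in time. The transport
  derivative falls on \<open>\<theta>\<close> and produces the bump, while Fubini converts the
  weights of the initial and source terms into the same bump. The Borel representative stands in for
  the solution so that the iterated integrals make sense.\<close>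

lemma weak_bump:
  assumes ab: "0 < a" "a < a'" "a' < T"
  shows "(\<integral>s. bump a a' s * (ini + (\<integral>t. src t \<partial>itv 0 s) - (\<integral>x. uh i s x * X (x - (c * s) *\<^sub>R dir i) \<partial>torus)) \<partial>itv 0 T) = 0"
proof -
  let ?Y = "\<lambda>t x. X (x - (c * t) *\<^sub>R dir i)" and ?\<eta> = "bump a a'"
  define avh where "avh s = (\<integral>x. uh i s x * X (x - (c * s) *\<^sub>R dir i) \<partial>torus)" for s
  obtain \<theta> where \<theta>: "smooth_fun \<theta>" "\<And>t. T \<le> t \<Longrightarrow> \<theta> t = 0"
    "\<And>t. (\<theta> has_real_derivative - ?\<eta> t) (at t)"
    "\<And>t. t \<le> T \<Longrightarrow> \<theta> t = (\<integral>s. ?\<eta> s \<partial>itv t T)"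
    using time_cutoff[of a' T a] ab by auto
  have [measurable]: "\<theta> \<in> borel_measurable borel"
    by (rule borel_measurable_continuous_onI[OF smooth_continuous[OF \<theta>(1)]])
  have \<theta>_bound: "\<bar>\<theta> t\<bar> \<le> T" if "0 \<le> t" "t \<le> T" for t
  proof -
    have "\<bar>\<integral>s. ?\<eta> s \<partial>itv t T\<bar> \<le> 1 * (T - t)"
      by (rule abs_integral_itv_le) (use bump_bounds that in auto)
    then show ?thesis using \<theta>(4)[OF that(2)] that by simp
  qed
  have bump_abs: "\<bar>?\<eta> t\<bar> \<le> 1" for t using bump_bounds[of a a' t] by simp
  define \<psi> where "\<psi> = (\<lambda>z. \<theta> (fst z) * box_bump n l u (snd z - (c * fst z) *\<^sub>R dir i))"
  have test: "test_fun \<psi>"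
    unfolding \<psi>_def by (rule transport_test_function(1)[OF \<theta>(1-3)])
  have deriv: "frechet_derivative \<psi> (at (t, x)) (1, c *\<^sub>R dir i) = - ?\<eta> t * ?Y t x" for t x
    unfolding \<psi>_def X_def by (rule transport_test_function(2)[OF \<theta>(1-3)])
  have \<psi>_eq: "\<psi> (t, x) = \<theta> t * ?Y t x" for t x
    by (simp add: \<psi>_def X_def)
  have m1: "avh \<in> borel_measurable borel"
    unfolding avh_def by (rule rep_avg_measurable)
  have avh_bound: "\<bar>avh s\<bar> \<le> B" for s
    unfolding avh_def by (rule abs_integral_torus_le) (auto intro: mult_X_bound uh_bound)
  have "int_QT (\<lambda>t x. w i t x * frechet_derivative \<psi> (at (t, x)) (1, c *\<^sub>R dir i))
      = (\<integral>t. (\<integral>x. uh i t x * (- ?\<eta> t * ?Y t x) \<partial>torus) \<partial>itv 0 T)"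
  proof (rule int_QT_eq[where L = B])
    show "AE z in lborel. z \<in> {0..} \<times> T3 \<longrightarrow> w i (fst z) (snd z) * frechet_derivative \<psi> (at (fst z, snd z)) (1, c *\<^sub>R dir i)
        = uh i (fst z) (snd z) * (- ?\<eta> (fst z) * ?Y (fst z) (snd z))"
      using uh_eq[of i]
    proof eventually_elim
      case (elim z)
      show ?case
        unfolding deriv using elim ab bump_eq_0[of "fst z" a a'] by (cases z, cases "fst z < T") auto
    qed
    show "uh i t x * (- ?\<eta> t * ?Y t x) = 0" if "T < t" for t x
      using bump_eq_0[of t a a'] that ab by simp
    show "\<bar>uh i t x * (- ?\<eta> t * ?Y t x)\<bar> \<le> B" for t x
    proof -
      have "\<bar>uh i t x\<bar> * (\<bar>?\<eta> t\<bar> * \<bar>?Y t x\<bar>) \<le> B * (1 * 1)"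
        using uh_bound[of i t x] bump_abs[of t] X_bound B_nonneg by (intro mult_mono) auto
      then show ?thesis by (simp add: abs_mult)
    qed
  qed (simp add: borel_prod[symmetric])
  also have "\<dots> = (\<integral>t. - (?\<eta> t * avh t) \<partial>itv 0 T)"
  proof (rule Bochner_Integration.integral_cong[OF refl])
    fix t
    have "(\<integral>x. uh i t x * (- ?\<eta> t * ?Y t x) \<partial>torus)
        = (\<integral>x. (- ?\<eta> t) * (uh i t x * ?Y t x) \<partial>torus)"
      by (simp only: mult_ac)
    then show "(\<integral>x. uh i t x * (- ?\<eta> t * ?Y t x) \<partial>torus) = - (?\<eta> t * avh t)"
      by (simp add: avh_def)
  qed
  finally have term1: "int_QT (\<lambda>t x. w i t x * frechet_derivative \<psi> (at (t, x)) (1, c *\<^sub>R dir i))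
      = - (\<integral>t. ?\<eta> t * avh t \<partial>itv 0 T)" by simp
  have "int_T3 (\<lambda>x. \<psi> (0, x) * w0 i x) = (\<integral>x. \<theta> 0 * (b i x * X x) \<partial>torus)"
  proof (rule int_T3_eq)
    have "(\<lambda>x. \<psi> (0, x)) \<in> borel_measurable (lebesgue_on T3)"
      unfolding \<psi>_eq by (rule borel_lebesgue_on) measurable
    then show "(\<lambda>x. \<psi> (0, x) * w0 i x) \<in> borel_measurable (lebesgue_on T3)"
      using w0_measurable by measurable
    show "AE x in torus. \<psi> (0, x) * w0 i x = \<theta> 0 * (b i x * X x)"
      using w0_eq[of i] by (rule eventually_mono) (simp add: \<psi>_eq)
  qed measurable
  then have term2: "int_T3 (\<lambda>x. \<psi> (0, x) * w0 i x) = (\<integral>s. ?\<eta> s * ini \<partial>itv 0 T)"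
    using \<theta>(4)[of 0] T_pos by (simp add: ini_def)
  have "int_QT (\<lambda>t x. S i t x * \<psi> (t, x)) = (\<integral>t. (\<integral>x. F i t x * (\<theta> t * ?Y t x) \<partial>torus) \<partial>itv 0 T)"
  proof (rule int_QT_eq[where L = "B * T"])
    show "AE z in lborel. z \<in> {0..} \<times> T3 \<longrightarrow> S i (fst z) (snd z) * \<psi> (fst z, snd z)
        = F i (fst z) (snd z) * (\<theta> (fst z) * ?Y (fst z) (snd z))"
      using S_eq[of i]
    proof eventually_elim
      case (elim z)
      show ?case
        unfolding \<psi>_eq using elim \<theta>(2)[of "fst z"] by (cases z, cases "fst z < T") auto
    qed
    show "F i t x * (\<theta> t * ?Y t x) = 0" if "T < t" for t x
      using \<theta>(2) that by simp
    show "\<bar>F i t x * (\<theta> t * ?Y t x)\<bar> \<le> B * T" if "0 \<le> t" "t \<le> T" for t x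
    proof -
      have "\<bar>F i t x\<bar> * (\<bar>\<theta> t\<bar> * \<bar>?Y t x\<bar>) \<le> B * (T * 1)"
        using F_bound[of i t x] \<theta>_bound[OF that] X_bound B_nonneg T_pos by (intro mult_mono) auto
      then show ?thesis by (simp add: abs_mult)
    qed
  qed (simp add: borel_prod[symmetric])
  also have "\<dots> = (\<integral>t. (\<integral>s. ?\<eta> s \<partial>itv t T) * src t \<partial>itv 0 T)"
  proof (rule Bochner_Integration.integral_cong[OF refl])
    fix t assume "t \<in> space (itv 0 T)"
    then have t: "t \<le> T" by simp
    have "(\<integral>x. F i t x * (\<theta> t * ?Y t x) \<partial>torus)
        = (\<integral>x. \<theta> t * (F i t x * ?Y t x) \<partial>torus)"
      by (simp only: mult_ac)
    then show "(\<integral>x. F i t x * (\<theta> t * ?Y t x) \<partial>torus) = (\<integral>s. ?\<eta> s \<partial>itv t T) * src t"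
      by (simp add: src_def \<theta>(4)[OF t])
  qed
  also have "\<dots> = (\<integral>s. ?\<eta> s * (\<integral>t. src t \<partial>itv 0 s) \<partial>itv 0 T)"
    by (rule triangle_swap[where L = 1 and L' = B]) (auto simp: bump_abs src_bound)
  finally have term3: "int_QT (\<lambda>t x. S i t x * \<psi> (t, x)) = (\<integral>s. ?\<eta> s * (\<integral>t. src t \<partial>itv 0 s) \<partial>itv 0 T)" .
  have srcint: "\<bar>\<integral>t. src t \<partial>itv 0 s\<bar> \<le> B * T" if "0 \<le> s" "s \<le> T" for s
  proof -
    have "\<bar>\<integral>t. src t \<partial>itv 0 s\<bar> \<le> B * (s - 0)"
      by (rule abs_integral_itv_le) (auto simp: src_bound that)
    also have "\<dots> \<le> B * T" using that B_nonneg by (simp add: mult_left_mono)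
    finally show ?thesis .
  qed
  have bm: "\<bar>?\<eta> s * r\<bar> \<le> R" if "\<bar>r\<bar> \<le> R" for s r R
    using mult_mono[OF bump_abs[of s] that] by (simp add: abs_mult)
  have ints: "integrable (itv 0 T) (\<lambda>s. ?\<eta> s * avh s)"
    using m1 by (intro itv_integrable_bounded[where L = B] bm avh_bound) measurable
  have ints': "integrable (itv 0 T) (\<lambda>s. ?\<eta> s * ini)"
    by (intro itv_integrable_bounded[where L = "\<bar>ini\<bar>"] bm) auto
  have ints'': "integrable (itv 0 T) (\<lambda>s. ?\<eta> s * (\<integral>t. src t \<partial>itv 0 s))"
    by (intro itv_integrable_bounded[where L = "B * T"] bm srcint) auto
  have "(\<integral>s. ?\<eta> s * (ini + (\<integral>t. src t \<partial>itv 0 s) - avh s) \<partial>itv 0 T)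
      = (\<integral>s. ?\<eta> s * ini + ?\<eta> s * (\<integral>t. src t \<partial>itv 0 s) - ?\<eta> s * avh s \<partial>itv 0 T)"
    by (rule Bochner_Integration.integral_cong) (simp_all add: algebra_simps)
  also have "\<dots> = (\<integral>s. ?\<eta> s * ini \<partial>itv 0 T) + (\<integral>s. ?\<eta> s * (\<integral>t. src t \<partial>itv 0 s) \<partial>itv 0 T)
      - (\<integral>s. ?\<eta> s * avh s \<partial>itv 0 T)"
    using ints ints' ints'' by simp
  also have "\<dots> = 0"
    using weak[OF test, of i] unfolding term1 term2 term3 by simp
  finally show ?thesis by (simp only: avh_def)
qed

lemma avg_AE_eq: "AE s in itv 0 T. avg s = (\<integral>x. uh i s x * X (x - (c * s) *\<^sub>R dir i) \<partial>torus)"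
proof -
  have "AE s in itv 0 T. 0 \<le> s" by (rule AE_I2) simp
  with w_eq_uh[of i] show ?thesis
  proof eventually_elim
    case (elim s)
    show ?case
      unfolding avg_def
    proof (rule int_T3_eq)
      have "(\<lambda>x. X (x - (c * s) *\<^sub>R dir i)) \<in> borel_measurable (lebesgue_on T3)"
        by (rule borel_lebesgue_on) measurable
      then show "(\<lambda>x. w i s x * X (x - (c * s) *\<^sub>R dir i)) \<in> borel_measurable (lebesgue_on T3)"
        using sol_regular_measurable[OF w_regular elim(2)] by measurable
      show "AE x in torus. w i s x * X (x - (c * s) *\<^sub>R dir i) = uh i s x * X (x - (c * s) *\<^sub>R dir i)"
        using elim(1) by (rule eventually_mono) simp
    qed measurable
  qed
qed

text \<open>The weak formulation determines the average for almost every time only. Both sides are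
  continuous in time, \<open>avg\<close> by L1 continuity of the weak solution, which upgrades the
  identity to every single time.\<close>

lemma avg_eq:
  assumes s: "s \<in> {0..T}"
  shows "avg s = ini + (\<integral>t. src t \<partial>itv 0 s)"
proof -
  let ?avh = "\<lambda>s. \<integral>x. uh i s x * X (x - (c * s) *\<^sub>R dir i) \<partial>torus"
  let ?G = "\<lambda>s. ini + (\<integral>t. src t \<partial>itv 0 s) - avg s"
  have HK: "(\<integral>t. src t \<partial>itv 0 r) = integral {0..r} src" for r
    by (rule integral_itv_HK(2)[where L = B]) (auto simp: src_bound)
  have int: "src integrable_on {0..T}"
    by (rule integral_itv_HK(1)[where L = B]) (auto simp: src_bound)
  have "continuous_on {0..T} (\<lambda>s. \<integral>t. src t \<partial>itv 0 s)"
    unfolding HK by (rule indefinite_integral_continuous_1[OF int])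
  moreover have "continuous_on {0..T} avg"
    unfolding avg_def X_def
    by (rule continuous_on_subset[OF moving_average_continuous[OF w_regular box_bump_continuous]])
      (use box_bump_bounds in \<open>auto simp: abs_le_iff intro: order_trans\<close>)
  ultimately have G: "continuous_on {0..T} ?G"
    by (intro continuous_intros)
  have "?G s = 0"
  proof (rule bump_test_zero[OF T_pos G _ s])
    fix a a' assume ab: "0 < a" "a < a'" "a' < T"
    have cont: "continuous_on {0..T} (\<lambda>s. bump a a' s * ?G s)"
      by (intro continuous_on_mult G continuous_on_subset[OF smooth_continuous[OF smooth_bump]]) auto
    have si: "set_integrable lborel {0..T} (\<lambda>s. bump a a' s * ?G s)"
      by (rule borel_integrable_atLeastAtMost'[OF cont])
    then have int: "integrable (itv 0 T) (\<lambda>s. bump a a' s * ?G s)"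
      unfolding itv_def set_integrable_def by (subst integrable_restrict_space) auto
    have "integral {0..T} (\<lambda>s. bump a a' s * ?G s) = (\<integral>s. bump a a' s * ?G s \<partial>itv 0 T)"
      using set_borel_integral_eq_integral(2)[OF si] by (simp add: integral_itv set_lebesgue_integral_def)
    also have "\<dots> = (\<integral>s. bump a a' s * (ini + (\<integral>t. src t \<partial>itv 0 s) - ?avh s) \<partial>itv 0 T)"
    proof (rule integral_cong_AE)
      show "(\<lambda>s. bump a a' s * ?G s) \<in> borel_measurable (itv 0 T)"
        using int by simp
      show "(\<lambda>s. bump a a' s * (ini + (\<integral>t. src t \<partial>itv 0 s) - ?avh s))
          \<in> borel_measurable (itv 0 T)"
        by (rule measurable_itvI) (intro borel_measurable_times borel_measurable_diff borel_measurable_add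
            borel_measurable_const rep_avg_measurable src_primitive_measurable bump_measurable)
      show "AE s in itv 0 T. bump a a' s * ?G s
          = bump a a' s * (ini + (\<integral>t. src t \<partial>itv 0 s) - ?avh s)"
        using avg_AE_eq by (rule eventually_mono) simp
    qed
    also have "\<dots> = 0" by (rule weak_bump[OF ab])
    finally show "integral {0..T} (\<lambda>s. bump a a' s * ?G s) = 0" .
  qed
  then show ?thesis by simp
qed

text \<open>At each time the integral is translated back to the feet of the characteristics. The
  test function then no longer depends on time, and the time integral of the source builds up
  \<open>path\<close>.\<close>

lemma duhamel_tested:
  assumes t: "t \<in> {0..T}"
  shows "ini + (\<integral>s. src s \<partial>itv 0 t) = (\<integral>x. path i t x * X x \<partial>torus)"
proof -
  have t0: "0 \<le> t" using t by simp
  have Xper: "periodic X" by (simp add: X_def box_bump_periodic)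
  have "(\<integral>s. src s \<partial>itv 0 t) = (\<integral>s. (\<integral>x. F i s (x + (c * s) *\<^sub>R dir i) * X x \<partial>torus) \<partial>itv 0 t)"
  proof (rule Bochner_Integration.integral_cong[OF refl])
    fix s
    have "(\<integral>x. F i s (x + (c * s) *\<^sub>R dir i) * X (x + (c * s) *\<^sub>R dir i - (c * s) *\<^sub>R dir i) \<partial>torus) = src s"
      unfolding src_def
    proof (rule integral_torus_translate)
      show "periodic (\<lambda>x. F i s x * X (x - (c * s) *\<^sub>R dir i))"
        using periodic_comp2[OF F_periodic periodic_translate[OF Xper], of "(*)" i s "- (c * s) *\<^sub>R dir i"] by simp
    qed measurable
    then show "src s = (\<integral>x. F i s (x + (c * s) *\<^sub>R dir i) * X x \<partial>torus)" by simp
  qed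
  also have "\<dots> = (\<integral>x. (\<integral>s. F i s (x + (c * s) *\<^sub>R dir i) * X x \<partial>itv 0 t) \<partial>torus)"
    by (rule itv_torus_swap(1)[where L = B]) (auto simp: borel_prod[symmetric] intro: mult_X_bound F_bound)
  also have "\<dots> = (\<integral>x. (path i t x - b i x) * X x \<partial>torus)"
    by (simp add: path_def)
  finally have e: "(\<integral>s. src s \<partial>itv 0 t) = (\<integral>x. (path i t x - b i x) * X x \<partial>torus)" .
  have i1: "integrable torus (\<lambda>x. b i x * X x)"
    by (rule torus_integrable_bounded[where B = B]) (auto intro: mult_X_bound b_bound)
  have i2: "integrable torus (\<lambda>x. path i t x * X x)"
  proof (rule torus_integrable_bounded[where B = "B + B * t"])
    fix x
    have "\<bar>path i t x\<bar> * \<bar>X x\<bar> \<le> (B + B * t) * 1"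
      using path_bound[OF t0 order_refl, of i x] X_bound[of x] B_nonneg t0 by (intro mult_mono) auto
    then show "\<bar>path i t x * X x\<bar> \<le> B + B * t" by (simp add: abs_mult)
  qed measurable
  have "(\<integral>x. (path i t x - b i x) * X x \<partial>torus) = (\<integral>x. path i t x * X x - b i x * X x \<partial>torus)"
    by (simp only: left_diff_distrib)
  also have "\<dots> = (\<integral>x. path i t x * X x \<partial>torus) - ini"
    using i1 i2 by (simp add: ini_def)
  finally show ?thesis using e by simp
qed

end

text \<open>Compared at the feet of the characteristics, both functions have the same integral
  against every \<open>box_bump\<close>. Letting its sharpness tend to infinity gives equal
  integrals over boxes, hence equality almost everywhere, which is then translated back.\<close>

lemma weak_eq_mild:
  assumes t: "t \<in> {0..T}"
  shows "AE x in torus. w i t x = sol i t x"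
proof -
  let ?X = box_bump
  have t0: "0 \<le> t" using t by simp
  let ?h = "(c * t) *\<^sub>R dir i"
  obtain wh where wh: "wh \<in> borel_measurable borel" "periodic wh" "AE x in torus. w i t x = wh x"
    using ex_borel_rep_T3[OF sol_regular_measurable[OF w_regular t0]] by metis
  note [measurable] = wh(1)
  have wh_int: "integrable torus wh"
    by (rule integrable_torus_rep[OF sol_regular_integrable[OF w_regular t0] wh(1,3)])
  define g where "g x = wh (x + ?h) - path i t x" for x
  have path_int: "integrable torus (path i t)"
    by (rule torus_integrable_bounded[where B = "B + B * t"]) (auto intro: path_bound t0)
  have whs_int: "integrable torus (\<lambda>x. wh (x + ?h))"
    by (rule integrable_torus_translate[OF wh(1,2) wh_int])
  have g_int: "integrable torus g"
    unfolding g_def using whs_int path_int by simp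
  have tested: "(\<integral>x. ?X n l u x * g x \<partial>torus) = 0" for n l u
  proof -
    have mi: "integrable torus (\<lambda>x. f x * ?X n l u x)" if "integrable torus f" for f
    proof (rule Bochner_Integration.integrable_bound[OF that])
      show "(\<lambda>x. f x * ?X n l u x) \<in> borel_measurable torus"
        using borel_measurable_integrable[OF that] measurable_torusI[OF box_bump_measurable] by (rule borel_measurable_times)
      show "AE x in torus. norm (f x * ?X n l u x) \<le> norm (f x)"
        using X_bound[of n l u] by (intro AE_I2) (simp add: abs_mult mult_left_le X_def)
    qed
    have "avg i n l u t = (\<integral>x. wh x * ?X n l u (x - ?h) \<partial>torus)"
      unfolding avg_def X_def
    proof (rule int_T3_eq)
      have "(\<lambda>x. ?X n l u (x - ?h)) \<in> borel_measurable (lebesgue_on T3)"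
        by (rule borel_lebesgue_on) measurable
      then show "(\<lambda>x. w i t x * ?X n l u (x - ?h)) \<in> borel_measurable (lebesgue_on T3)"
        using sol_regular_measurable[OF w_regular t0] by measurable
      show "AE x in torus. w i t x * ?X n l u (x - ?h) = wh x * ?X n l u (x - ?h)"
        using wh(3) by (rule eventually_mono) simp
    qed measurable
    also have "\<dots> = (\<integral>x. wh (x + ?h) * ?X n l u (x + ?h - ?h) \<partial>torus)"
    proof (rule integral_torus_translate[symmetric])
      show "periodic (\<lambda>x. wh x * ?X n l u (x - ?h))"
        using periodic_comp2[OF wh(2) periodic_translate[OF box_bump_periodic], of "(*)" n l u "- ?h"] by simp
    qed measurable
    finally have "(\<integral>x. wh (x + ?h) * ?X n l u x \<partial>torus) = (\<integral>x. path i t x * ?X n l u x \<partial>torus)"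
      using avg_eq[OF t, of i n l u] duhamel_tested[OF t, of i n l u] by (simp add: X_def)
    moreover have "(\<integral>x. ?X n l u x * g x \<partial>torus)
        = (\<integral>x. wh (x + ?h) * ?X n l u x - path i t x * ?X n l u x \<partial>torus)"
      unfolding g_def by (simp only: right_diff_distrib mult.commute)
    ultimately show ?thesis
      using mi[OF whs_int] mi[OF path_int] by simp
  qed
  have "AE x in torus. g x = 0"
  proof (rule zero_on_boxes_imp_AE_zero[OF g_int])
    fix l u :: "real^3" assume lu: "\<And>j. 0 \<le> l $ j \<and> l $ j < u $ j \<and> u $ j \<le> 1"
    have "(\<lambda>n. \<integral>x. ?X n l u x * g x \<partial>torus) \<longlonglongrightarrow> (\<integral>x. indicator (box l u) x * g x \<partial>torus)"
    proof (rule integral_dominated_convergence[where w = "\<lambda>x. \<bar>g x\<bar>"])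
      show "integrable torus (\<lambda>x. \<bar>g x\<bar>)" using g_int by simp
      have gm: "g \<in> borel_measurable borel" unfolding g_def by measurable
      show "(\<lambda>x. indicator (box l u) x * g x) \<in> borel_measurable torus"
        "(\<lambda>x. ?X n l u x * g x) \<in> borel_measurable torus" for n
        using gm by (auto intro!: measurable_torusI)
      show "AE x in torus. (\<lambda>n. ?X n l u x * g x) \<longlonglongrightarrow> indicator (box l u) x * g x"
      proof (rule AE_I2)
        fix x :: "real^3" assume "x \<in> space torus"
        then have "x \<in> T3" using unit_cell_bounds(2) by (auto simp: T3_eq_cbox)
        then show "(\<lambda>n. ?X n l u x * g x) \<longlonglongrightarrow> indicator (box l u) x * g x"
          by (intro tendsto_mult tendsto_const box_bump_tendsto) (use lu in \<open>auto simp: T3_def\<close>)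
      qed
      show "AE x in torus. norm (?X n l u x * g x) \<le> \<bar>g x\<bar>" for n
        using box_bump_bounds by (intro AE_I2) (simp add: abs_mult mult_left_le_one_le)
    qed
    then show "(\<integral>x. indicator (box l u) x * g x \<partial>torus) = 0"
      unfolding tested by (simp add: LIMSEQ_const_iff)
  qed
  then have "AE x in torus. wh (x + ?h) = path i t x"
    by (rule eventually_mono) (simp add: g_def)
  moreover have "periodic (\<lambda>x. wh (x + ?h) = path i t x)"
    by (rule periodic_comp2[OF periodic_translate[OF wh(2)] path_periodic])
  ultimately have "AE x in torus. wh (x + (- ?h) + ?h) = path i t (x + (- ?h))"
    by (rule AE_torus_translate)
  with wh(3) show ?thesis
    by eventually_elim (simp add: sol_def)
qed

end

section \<open>Essential bounds and pointwise estimates\<close>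

text \<open>The infimum is attained: the slightly larger bounds
  \<open>Inf ?S + inverse (real (Suc n))\<close> hold off null sets, and countably many of them hold
  simultaneously.\<close>

lemma Linf_T3_AE:
  assumes "Linf_fun_T3 f"
  shows "AE x in torus. \<bar>f x\<bar> \<le> Linf_T3 f"
proof -
  let ?S = "{C. AE x in torus. \<bar>f x\<bar> \<le> C}"
  have Linf: "Linf_T3 f = Inf ?S" by (simp add: Linf_T3_def AE_T3_iff)
  have ne: "?S \<noteq> {}" using assms by (auto simp: Linf_fun_T3_def AE_T3_iff)
  have "AE x in torus. \<forall>n. \<bar>f x\<bar> \<le> Inf ?S + inverse (real (Suc n))"
    unfolding AE_all_countable
  proof
    fix n
    obtain C where "C \<in> ?S" "C < Inf ?S + inverse (real (Suc n))"
      using cInf_lessD[OF ne, of "Inf ?S + inverse (real (Suc n))"] by auto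
    then show "AE x in torus. \<bar>f x\<bar> \<le> Inf ?S + inverse (real (Suc n))"
      by (auto elim!: eventually_mono)
  qed
  then show ?thesis
    unfolding Linf
  proof (rule eventually_mono)
    fix x assume "\<forall>n. \<bar>f x\<bar> \<le> Inf ?S + inverse (real (Suc n))"
    moreover have "(\<lambda>n. Inf ?S + inverse (real (Suc n))) \<longlonglongrightarrow> Inf ?S + 0"
      by (intro tendsto_intros LIMSEQ_inverse_real_of_nat)
    ultimately show "\<bar>f x\<bar> \<le> Inf ?S"
      using LIMSEQ_le_const[of "\<lambda>n. Inf ?S + inverse (real (Suc n))" "Inf ?S" "\<bar>f x\<bar>"] by auto
  qed
qed

lemma ess_inf_T3_AE:
  assumes "Linf_fun_T3 f"
  shows "AE x in torus. ess_inf_T3 f \<le> f x"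
proof -
  let ?S = "{d. AE x in torus. d \<le> f x}"
  have ess: "ess_inf_T3 f = Sup ?S" by (simp add: ess_inf_T3_def AE_T3_iff)
  obtain C where C: "AE x in torus. \<bar>f x\<bar> \<le> C" using assms by (auto simp: Linf_fun_T3_def AE_T3_iff)
  have "- C \<in> ?S" using C by (auto elim!: eventually_mono)
  then have ne: "?S \<noteq> {}" by blast
  have "AE x in torus. \<forall>n. Sup ?S - inverse (real (Suc n)) \<le> f x"
    unfolding AE_all_countable
  proof
    fix n
    obtain d where "d \<in> ?S" "Sup ?S - inverse (real (Suc n)) < d"
      using less_cSupD[OF ne, of "Sup ?S - inverse (real (Suc n))"] by auto
    then show "AE x in torus. Sup ?S - inverse (real (Suc n)) \<le> f x"
      by (auto elim!: eventually_mono)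
  qed
  then show ?thesis
    unfolding ess
  proof (rule eventually_mono)
    fix x assume "\<forall>n. Sup ?S - inverse (real (Suc n)) \<le> f x"
    moreover have "(\<lambda>n. Sup ?S - inverse (real (Suc n))) \<longlonglongrightarrow> Sup ?S - 0"
      by (intro tendsto_intros LIMSEQ_inverse_real_of_nat)
    ultimately show "Sup ?S \<le> f x"
      using LIMSEQ_le_const2[of "\<lambda>n. Sup ?S - inverse (real (Suc n))" "Sup ?S" "f x"] by auto
  qed
qed

lemma sum_3_bool: "(\<Sum>p\<in>UNIV. f p) = (\<Sum>i\<in>(UNIV :: 3 set). f (i, True) + f (i, False))"
  for f :: "3 \<times> bool \<Rightarrow> real"
proof -
  have "(\<Sum>p\<in>UNIV. f p) = (\<Sum>p\<in>(UNIV :: 3 set) \<times> (UNIV :: bool set). f p)" by simp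
  also have "\<dots> = (\<Sum>i\<in>(UNIV :: 3 set). \<Sum>q\<in>(UNIV :: bool set). f (i, q))"
    by (simp add: sum.cartesian_product)
  finally show ?thesis by (simp add: UNIV_bool add.commute)
qed

lemma energy_eq:
  fixes s :: "3 \<times> bool \<Rightarrow> real^3 \<Rightarrow> real"
  assumes f: "\<And>i. f i \<in> borel_measurable (lebesgue_on T3)" and g: "\<And>i. g i \<in> borel_measurable (lebesgue_on T3)"
    and s [measurable]: "\<And>p. s p \<in> borel_measurable borel" and bd: "\<And>p x. \<bar>s p x\<bar> \<le> R"
    and eq: "\<And>i. AE x in torus. f i x = s (i, True) x" "\<And>i. AE x in torus. g i x = s (i, False) x"
  shows "energy f g m = (\<Sum>p\<in>UNIV. \<integral>x. (s p x - m)\<^sup>2 \<partial>torus)"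
proof -
  have int: "integrable torus (\<lambda>x. (s p x - m)\<^sup>2)" for p
  proof (rule torus_integrable_bounded[where B = "(R + \<bar>m\<bar>)\<^sup>2"])
    fix x
    have "\<bar>s p x - m\<bar> \<le> R + \<bar>m\<bar>" using bd[of p x] by linarith
    from power_mono[OF this, of 2] show "\<bar>(s p x - m)\<^sup>2\<bar> \<le> (R + \<bar>m\<bar>)\<^sup>2" by simp
  qed measurable
  have "int_T3 (\<lambda>x. (f i x - m)\<^sup>2 + (g i x - m)\<^sup>2)
      = (\<integral>x. (s (i, True) x - m)\<^sup>2 \<partial>torus) + (\<integral>x. (s (i, False) x - m)\<^sup>2 \<partial>torus)" for i
  proof -
    have "int_T3 (\<lambda>x. (f i x - m)\<^sup>2 + (g i x - m)\<^sup>2)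
        = (\<integral>x. (s (i, True) x - m)\<^sup>2 + (s (i, False) x - m)\<^sup>2 \<partial>torus)"
    proof (rule int_T3_eq)
      show "(\<lambda>x. (f i x - m)\<^sup>2 + (g i x - m)\<^sup>2) \<in> borel_measurable (lebesgue_on T3)"
        using f g by measurable
      show "AE x in torus. (f i x - m)\<^sup>2 + (g i x - m)\<^sup>2 = (s (i, True) x - m)\<^sup>2 + (s (i, False) x - m)\<^sup>2"
        using eq[of i] by eventually_elim simp
    qed measurable
    then show ?thesis using int by simp
  qed
  then show ?thesis by (simp add: energy_def sum_3_bool)
qed

lemma measurable_vec_lambda:
  fixes f :: "'n::finite \<Rightarrow> 'a \<Rightarrow> real"
  assumes "\<And>i. f i \<in> borel_measurable N"
  shows "(\<lambda>z. \<chi> i. f i z) \<in> borel_measurable N"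
proof (subst borel_measurable_euclidean_space, rule ballI)
  fix b :: "real^'n" assume "b \<in> Basis"
  then obtain i where "b = axis i 1" by (auto simp: Basis_vec_def)
  then show "(\<lambda>z. (\<chi> i. f i z) \<bullet> b) \<in> borel_measurable N"
    using assms[of i] by (simp add: inner_axis)
qed

lemma square_gap_le:
  fixes z :: "3 \<times> bool \<Rightarrow> real"
  assumes z: "\<And>p. 0 \<le> z p" "\<And>p. z p \<le> M" and \<alpha>: "0 \<le> \<alpha>" "\<alpha> \<le> 1" and e: "0 < e"
    and \<kappa>: "e * rpow (\<Sum>p\<in>UNIV. z p) \<alpha> \<le> \<kappa>"
  shows "((z p)\<^sup>2 - (z q)\<^sup>2)\<^sup>2 \<le> ((6 * M) powr (2 - \<alpha>) / e) * (\<kappa> * (z p - z q)\<^sup>2)"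
proof -
  define r where "r = (\<Sum>p\<in>UNIV. z p)"
  have M: "0 \<le> M" using z[of p] by linarith
  have r0: "0 \<le> r" unfolding r_def by (intro sum_nonneg z)
  have "r \<le> (\<Sum>p\<in>(UNIV :: (3 \<times> bool) set). M)" unfolding r_def by (intro sum_mono z)
  then have rM: "r \<le> 6 * M" by simp
  have rpow0: "0 \<le> rpow r \<alpha>" by (simp add: rpow_def)
  have "r\<^sup>2 \<le> (6 * M) powr (2 - \<alpha>) * rpow r \<alpha>"
  \<comment> \<open>\<open>rpow\<close> and \<open>powr\<close> differ at \<open>0\<close> when the
    exponent is \<open>0\<close>; at that point the left side vanishes anyway.\<close>
  proof (cases "r = 0")
    case False
    then have rpos: "0 < r" using r0 by simp
    have "r\<^sup>2 = r powr (2 - \<alpha>) * r powr \<alpha>"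
      using rpos by (simp add: powr_add[symmetric])
    also have "\<dots> \<le> (6 * M) powr (2 - \<alpha>) * r powr \<alpha>"
      using rM r0 \<alpha> by (intro mult_right_mono powr_mono2) auto
    also have "r powr \<alpha> = rpow r \<alpha>" using rpos by (simp add: rpow_def)
    finally show ?thesis .
  qed (use rpow0 in simp)
  also have "\<dots> \<le> (6 * M) powr (2 - \<alpha>) * (\<kappa> / e)"
    using \<kappa> e unfolding r_def[symmetric] by (intro mult_left_mono) (auto simp: field_simps)
  finally have r2: "r\<^sup>2 \<le> (6 * M) powr (2 - \<alpha>) / e * \<kappa>" by simp
  have "((z p)\<^sup>2 - (z q)\<^sup>2)\<^sup>2 = (z p + z q)\<^sup>2 * (z p - z q)\<^sup>2"
    by (simp add: power2_eq_square algebra_simps)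
  also have "\<dots> \<le> r\<^sup>2 * (z p - z q)\<^sup>2"
  \<comment> \<open>For distinct indices \<open>z p + z q\<close> is a partial sum of
    \<open>r\<close>. For equal ones it may exceed \<open>r\<close>, but then the difference is
    zero.\<close>
  proof (cases "p = q")
    case False
    have "z p + z q = (\<Sum>p\<in>{p, q}. z p)" using False by simp
    also have "\<dots> \<le> r" unfolding r_def by (rule sum_mono2) (auto simp: z)
    finally show ?thesis using z by (intro mult_right_mono power_mono) auto
  qed simp
  also have "\<dots> \<le> (6 * M) powr (2 - \<alpha>) / e * \<kappa> * (z p - z q)\<^sup>2"
    by (intro mult_right_mono r2) simp
  finally show ?thesis by (simp only: mult.assoc)
qed

section \<open>The decay theorem\<close>

text \<open>The constant of \<open>energy_step\<close> with the \<open>\<beta>\<close> supplied by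
  \<open>square_gap_le\<close>; \<open>e\<close> stands for the essential infimum of
  \<open>k1\<close> and \<open>K\<close> for \<open>\<kappa>1 M\<close>.\<close>

definition decay_constant :: "real \<Rightarrow> real \<Rightarrow> real \<Rightarrow> real \<Rightarrow> real \<Rightarrow> real \<Rightarrow> real" where
  "decay_constant M m c \<alpha> e K = 198 * (144 * M\<^sup>2 * K / c + 3 * c * ((6 * M) powr (2 - \<alpha>) / e)) / m\<^sup>2"

definition pack :: "(3 \<Rightarrow> 'a) \<Rightarrow> (3 \<Rightarrow> 'a) \<Rightarrow> 3 \<times> bool \<Rightarrow> 'a" where
  "pack f g p = (if snd p then f (fst p) else g (fst p))"

lemma pack_simps [simp]: "pack f g (i, True) = f i" "pack f g (i, False) = g i"
  by (simp_all add: pack_def)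

lemma pack_cases: "(\<And>i. P (f i)) \<Longrightarrow> (\<And>i. P (g i)) \<Longrightarrow> P (pack f g p)"
  by (simp add: pack_def)

lemma eventually_all_index: "(\<And>p. eventually (P p) Fl) \<Longrightarrow> eventually (\<lambda>x. \<forall>p::3 \<times> bool. P p x) Fl"
  by (rule eventually_all_finite)

lemma linear_transport_direction:
  assumes "linear D"
  shows "D (1::real, c *\<^sub>R dir (i, True)) = D (1, 0) + c * D (0, axis i 1)"
    and "D (1::real, c *\<^sub>R dir (i, False)) = D (1, 0) - c * (D (0, axis i 1) :: real)"
proof -
  have e: "(1::real, c *\<^sub>R dir (i, True)) = (1, 0) + c *\<^sub>R (0, axis i 1)"
    "(1::real, c *\<^sub>R dir (i, False)) = (1, 0) - c *\<^sub>R (0, axis i 1)"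
    by (simp_all add: dir_def)
  show "D (1::real, c *\<^sub>R dir (i, True)) = D (1, 0) + c * D (0, axis i 1)"
    "D (1::real, c *\<^sub>R dir (i, False)) = D (1, 0) - c * (D (0, axis i 1) :: real)"
    by (simp_all only: e linear_add[OF assms] linear_diff[OF assms] linear_scale[OF assms] real_scaleR_def)
qed

lemma energy_decay_weak:
  fixes k :: "real^3 \<Rightarrow> real^3 \<Rightarrow> real^3 \<Rightarrow> real" and u0 v0 :: "3 \<Rightarrow> real^3 \<Rightarrow> real"
    and u v :: "3 \<Rightarrow> real \<Rightarrow> real^3 \<Rightarrow> real"
  assumes c: "0 < c" and rate: "interaction_rate k" and type1: "type1_with k \<kappa>1"
    and \<alpha>: "0 \<le> \<alpha>" "\<alpha> \<le> 1" and k1: "Linf_fun_T3 k1" and e_pos: "0 < ess_inf_T3 k1"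
    and lower: "\<And>a b x. x \<in> T3 \<Longrightarrow> (\<And>i. 0 \<le> a $ i \<and> 0 \<le> b $ i) \<Longrightarrow>
      k1 x * rpow ((\<Sum>i\<in>UNIV. a $ i) + (\<Sum>i\<in>UNIV. b $ i)) \<alpha> \<le> k a b x"
    and data_meas: "\<And>p. pack u0 v0 p \<in> borel_measurable (lebesgue_on T3)"
    and data_bounds: "\<And>p. AE x in torus. 0 \<le> pack u0 v0 p x \<and> pack u0 v0 p x \<le> M"
    and m: "m = (1/6) * int_T3 (\<lambda>x. \<Sum>i\<in>UNIV. u0 i x + v0 i x)" and m_pos: "0 < m" and M_pos: "0 < M"
    and weak: "weak_solution c k u0 v0 u v" and t: "0 \<le> t"
  shows "energy (\<lambda>i. u i t) (\<lambda>i. v i t) m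
    \<le> exp 1 * exp (- (t / (1 / c * (1 + decay_constant M m c \<alpha> (ess_inf_T3 k1) (\<kappa>1 M))))) * energy u0 v0 m"
proof -
  define w where "w = pack u v"
  define w0 where "w0 = pack u0 v0"
  \<comment> \<open>A horizon beyond \<open>t\<close>; the added 1 keeps it positive when
    \<open>t = 0\<close>.\<close>
  define T where "T = t + 1"
  let ?Q = "{0..<T} \<times> T3" and ?\<beta> = "(6 * M) powr (2 - \<alpha>) / ess_inf_T3 k1"
  have T: "0 < T" "t \<le> T" using t by (auto simp: T_def)
  have w_reg: "sol_regular (w p)" for p
    unfolding w_def by (rule pack_cases[where P = sol_regular]) (use weak in \<open>auto simp: weak_solution_def\<close>)
  have w_nonneg: "AE x in torus. 0 \<le> w p s x" if "0 \<le> s" for p s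
  proof -
    have "AE x in torus. 0 \<le> u i s x \<and> 0 \<le> v i s x" for i
      using weak that by (simp add: weak_solution_def AE_T3_iff)
    then have "AE x in torus. 0 \<le> u i s x" "AE x in torus. 0 \<le> v i s x" for i
      by (auto elim: eventually_mono)
    then show ?thesis unfolding w_def by (intro pack_cases[where P = "\<lambda>f. AE x in torus. 0 \<le> f s x"])
  qed
  have rho_w: "rho u v s x = (\<Sum>p\<in>UNIV. w p s x)" for s x
    by (simp add: rho_def sum_3_bool w_def)
  have "\<exists>g. g \<in> borel_measurable borel \<and> periodic g \<and> (AE x in torus. w0 p x = g x)" for p
    by (rule ex_borel_rep_T3[OF data_meas[of p, folded w0_def]]) blast
  then have "\<exists>b0. \<forall>p. b0 p \<in> borel_measurable borel \<and> periodic (b0 p) \<and> (AE x in torus. w0 p x = b0 p x)"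
    by (intro choice allI)
  then obtain b0 where b0: "\<And>p. b0 p \<in> borel_measurable borel" "\<And>p. periodic (b0 p)"
    "\<And>p. AE x in torus. w0 p x = b0 p x" by blast
  \<comment> \<open>Clipping alters the data only on a null set and makes the bounds hold at every
    point, as the locales demand.\<close>
  define b where "b p x = max 0 (min M (b0 p x))" for p x
  have b_meas [measurable]: "b p \<in> borel_measurable borel" for p
    unfolding b_def using b0(1)[of p] by measurable
  have b_per: "periodic (b p)" for p
    unfolding b_def by (rule periodic_comp[OF b0(2)])
  have b_bounds: "0 \<le> b p x" "b p x \<le> M" for p x using M_pos by (auto simp: b_def)
  have w0_eq: "AE x in torus. w0 p x = b p x" for p
    using b0(3)[of p] data_bounds[of p] unfolding w0_def by eventually_elim (simp add: b_def)
  have "\<exists>g. g \<in> borel_measurable borel \<and> (AE z in lborel. z \<in> ?Q \<longrightarrow> w p (fst z) (snd z) = g z)" for p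
  proof -
    have "(\<lambda>z. w p (fst z) (snd z)) \<in> borel_measurable (lebesgue_on (?Q))"
      using w_reg[of p] T by (simp add: sol_regular_def)
    then obtain g where "g \<in> borel_measurable borel"
      "AE z in lborel. z \<in> ?Q \<longrightarrow> w p (fst z) (snd z) = g z"
      by (rule ex_borel_rep_QT)
    then show ?thesis by blast
  qed
  then have "\<exists>g. \<forall>p. g p \<in> borel_measurable borel \<and>
      (AE z in lborel. z \<in> ?Q \<longrightarrow> w p (fst z) (snd z) = g p z)"
    by (intro choice allI)
  then obtain g where g: "\<And>p. g p \<in> borel_measurable borel"
    "\<And>p. AE z in lborel. z \<in> ?Q \<longrightarrow> w p (fst z) (snd z) = g p z" by blast
  have S_sets: "?Q \<in> sets (borel :: (real \<times> (real^3)) measure)"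
    by (simp add: borel_prod[symmetric])
  have "\<exists>C. AE z in lborel. z \<in> ?Q \<longrightarrow> \<bar>w p (fst z) (snd z)\<bar> \<le> C" for p
  proof -
    obtain C where "AE z in lebesgue_on (?Q). \<bar>w p (fst z) (snd z)\<bar> \<le> C"
      using w_reg[of p] T by (auto simp: sol_regular_def)
    then show ?thesis
      using S_sets by (subst (asm) AE_restrict_space_iff) (auto simp: AE_completion_iff)
  qed
  then have "\<exists>Cp. \<forall>p. AE z in lborel. z \<in> ?Q \<longrightarrow> \<bar>w p (fst z) (snd z)\<bar> \<le> Cp p"
    by (intro choice allI)
  then obtain Cp where Cp: "\<And>p. AE z in lborel. z \<in> ?Q \<longrightarrow> \<bar>w p (fst z) (snd z)\<bar> \<le> Cp p" by blast
  \<comment> \<open>\<open>C\<close> dominates all six local bounds and \<open>M\<close>, and it is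
    positive, so that the type 1 bound applies at \<open>\<gamma> = C\<close>.\<close>
  define C where "C = 1 + M + (\<Sum>p\<in>UNIV. \<bar>Cp p\<bar>)"
  have "0 \<le> (\<Sum>p\<in>UNIV. \<bar>Cp p\<bar>)" by (intro sum_nonneg) simp
  then have C: "0 < C" "M \<le> C" using M_pos unfolding C_def by linarith+
  have Cp_le: "Cp p \<le> C" for p
  proof -
    have "\<bar>Cp p\<bar> \<le> (\<Sum>p\<in>UNIV. \<bar>Cp p\<bar>)" by (rule member_le_sum) auto
    then show ?thesis using M_pos by (simp add: C_def)
  qed
  \<comment> \<open>Clipping to \<open>[0, C]\<close> keeps the arguments of \<open>k\<close> at
    every point in the range where its sign and its type 1 bound are known; wrapping makes the
    representative periodic.\<close>
  define uh where "uh p s x = max 0 (min C (g p (s, wrap x)))" for p s x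
  let ?rep = "\<lambda>p z. w p (fst z) (snd z) = uh p (fst z) (snd z)"
  have uh_bounds: "0 \<le> uh p s x" "uh p s x \<le> C" for p s x using C by (auto simp: uh_def)
  have uh_meas: "(\<lambda>z. uh p (fst z) (snd z)) \<in> borel_measurable borel" for p
  proof -
    have "(\<lambda>z::real \<times> (real^3). (fst z, wrap (snd z))) \<in> borel_measurable borel"
      by (simp add: borel_prod[symmetric])
    from measurable_compose[OF this g(1)[of p]] show ?thesis
      unfolding uh_def by (intro borel_measurable_max borel_measurable_min borel_measurable_const)
  qed
  have cell: "AE z in (lborel :: (real \<times> (real^3)) measure). snd z \<in> T3 \<longrightarrow> snd z \<in> unit_cell"
    unfolding lborel_prod[symmetric]
  proof (rule lborel_pair.AE_pair_measure)
    show "{z \<in> space (lborel \<Otimes>\<^sub>M lborel). snd z \<in> T3 \<longrightarrow> snd z \<in> unit_cell} \<in> sets (lborel \<Otimes>\<^sub>M lborel)"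
      by measurable
    show "AE s in (lborel :: real measure). AE x in lborel. snd (s, x) \<in> T3 \<longrightarrow> snd (s, x) \<in> unit_cell"
      by (rule AE_I2) (use AE_unit_cell_iff_cbox in \<open>auto simp: T3_eq_cbox elim!: eventually_mono\<close>)
  qed
  \<comment> \<open>Nonnegativity is known slice by slice in time. Fubini turns it into a statement
    on the space-time cylinder, for the Borel function \<open>g\<close>, whose sign set is
    measurable.\<close>
  have g_nonneg: "AE z in lborel. z \<in> ?Q \<longrightarrow> 0 \<le> g p z" for p
    unfolding lborel_prod[symmetric]
  proof (rule lborel_pair.AE_pair_measure)
    show "{z \<in> space (lborel \<Otimes>\<^sub>M lborel). z \<in> ?Q \<longrightarrow> 0 \<le> g p z} \<in> sets (lborel \<Otimes>\<^sub>M lborel)"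
      using g(1)[of p] S_sets unfolding borel_prod[symmetric] by measurable
    have "AE s in lborel. AE x in lborel. (s, x) \<in> ?Q \<longrightarrow> w p s x = g p (s, x)"
      using lborel_pair.AE_pair[OF g(2)[of p, unfolded lborel_prod[symmetric]]] by simp
    then show "AE s in lborel. AE x in lborel. (s, x) \<in> ?Q \<longrightarrow> 0 \<le> g p (s, x)"
    proof eventually_elim
      case (elim s)
      show ?case
      proof (cases "0 \<le> s")
        case True
        have "AE x in lborel. x \<in> T3 \<longrightarrow> 0 \<le> w p s x"
          using w_nonneg[OF True, of p] T3_lebesgue
          by (subst (asm) AE_T3_iff[symmetric], subst (asm) AE_restrict_space_iff) (auto simp: AE_completion_iff)
        with elim show ?thesis by eventually_elim auto
      qed auto
    qed
  qed
  have uh_eq: "AE z in lborel. z \<in> ?Q \<longrightarrow> ?rep p z" for p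
    using g(2)[of p] Cp[of p] cell g_nonneg[of p]
  proof eventually_elim
    case (elim z)
    show ?case
    proof
      assume z: "z \<in> ?Q"
      then have "wrap (snd z) = snd z" using elim(3) by (auto intro: wrap_unit_cell)
      moreover have "0 \<le> g p z" "g p z \<le> C" "w p (fst z) (snd z) = g p z"
        using elim(1,2,4) z Cp_le[of p] by auto
      ultimately show "?rep p z"
        by (simp add: uh_def)
    qed
  qed
  \<comment> \<open>The last argument of \<open>k\<close> is reduced to the cell, because
    \<open>k\<close> is a function on the whole space that represents one on the torus only through
    its values on the cube.\<close>
  define \<kappa> where "\<kappa> s x = k (\<chi> i. uh (i, True) s x) (\<chi> i. uh (i, False) s x) (wrap x)" for s x
  have \<kappa>_meas: "(\<lambda>z. \<kappa> (fst z) (snd z)) \<in> borel_measurable borel"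
  proof -
    have k: "(\<lambda>z. k (fst z) (fst (snd z)) (snd (snd z))) \<in> borel_measurable borel"
      using rate by (simp add: interaction_rate_def)
    have "(\<lambda>z::real \<times> (real^3). wrap (snd z)) \<in> borel_measurable borel"
      by (simp add: borel_prod[symmetric])
    then have "(\<lambda>z. (\<chi> i. uh (i, True) (fst z) (snd z), \<chi> i. uh (i, False) (fst z) (snd z), wrap (snd z)))
        \<in> borel_measurable borel"
      by (intro borel_measurable_Pair measurable_vec_lambda uh_meas)
    from measurable_compose[OF this k] show ?thesis by (simp add: \<kappa>_def)
  qed
  have \<kappa>_nonneg: "0 \<le> \<kappa> s x" for s x
    using rate uh_bounds by (simp add: \<kappa>_def interaction_rate_def)
  have k_le: "k a d x \<le> \<kappa>1 \<gamma>" if "0 < \<gamma>" "\<And>i. 0 \<le> a $ i \<and> a $ i \<le> \<gamma> \<and> 0 \<le> d $ i \<and> d $ i \<le> \<gamma>" for a d x \<gamma>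
    using type1 that by (simp add: type1_with_def)
  have \<kappa>_le_C: "\<kappa> s x \<le> \<kappa>1 C" for s x
    unfolding \<kappa>_def by (rule k_le[OF C(1)]) (simp add: uh_bounds)
  have \<kappa>1_pos: "0 < \<kappa>1 \<gamma>" if "0 < \<gamma>" for \<gamma>
    using type1 that by (simp add: type1_with_def)
  define F where "F p s x = \<kappa> s x * ((\<Sum>q\<in>UNIV. uh q s x) - 6 * uh p s x)" for p s x
  define B where "B = C + \<kappa>1 C + \<kappa>1 C * (12 * C)"
  have B_ge: "C \<le> B" "\<kappa>1 C \<le> B" "\<kappa>1 C * (12 * C) \<le> B"
    using C(1) \<kappa>1_pos[OF C(1)] by (auto simp: B_def)
  have F_bound: "\<bar>F p s x\<bar> \<le> B" for p s x
  proof -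
    have "(\<Sum>q\<in>UNIV. uh q s x) \<le> (\<Sum>q\<in>(UNIV :: (3 \<times> bool) set). C)" by (intro sum_mono uh_bounds)
    then have "(\<Sum>q\<in>UNIV. uh q s x) \<le> 6 * C" by simp
    moreover have "0 \<le> (\<Sum>q\<in>UNIV. uh q s x)" by (intro sum_nonneg uh_bounds)
    ultimately have "\<bar>(\<Sum>q\<in>UNIV. uh q s x) - 6 * uh p s x\<bar> \<le> 12 * C"
      using uh_bounds[of p s x] by (simp add: abs_le_iff)
    then have "\<bar>F p s x\<bar> \<le> \<kappa>1 C * (12 * C)"
      unfolding F_def abs_mult using \<kappa>_nonneg[of s x] \<kappa>_le_C[of s x] by (intro mult_mono) auto
    then show ?thesis using B_ge by simp
  qed
  have F_meas: "(\<lambda>z. F p (fst z) (snd z)) \<in> borel_measurable borel" for p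
    unfolding F_def
    by (intro borel_measurable_times borel_measurable_diff borel_measurable_sum borel_measurable_const \<kappa>_meas uh_meas)
  have F_per: "periodic (F p s)" for p s
    by (simp add: periodic_def F_def \<kappa>_def uh_def wrap_add_lattice)
  define S where "S p s x = kval k u v s x * (rho u v s x - 6 * w p s x)" for p s x
  have S_eq: "AE z in lborel. z \<in> ?Q \<longrightarrow> S p (fst z) (snd z) = F p (fst z) (snd z)" for p
    using eventually_all_index[of "\<lambda>p z. z \<in> ?Q \<longrightarrow> ?rep p z", OF uh_eq] cell
  proof eventually_elim
    case (elim z)
    show ?case
    proof
      assume z: "z \<in> ?Q"
      then have wrap: "wrap (snd z) = snd z" using elim(2) by (auto intro: wrap_unit_cell)
      have eq: "w q (fst z) (snd z) = uh q (fst z) (snd z)" for q using elim(1) z by blast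
      have "u i (fst z) (snd z) = uh (i, True) (fst z) (snd z)" "v i (fst z) (snd z) = uh (i, False) (fst z) (snd z)" for i
        using eq[of "(i, True)"] eq[of "(i, False)"] by (simp_all add: w_def)
      then show "S p (fst z) (snd z) = F p (fst z) (snd z)"
        unfolding S_def F_def rho_w eq by (simp add: kval_def \<kappa>_def wrap)
    qed
  qed
  have weak_p: "int_QT (\<lambda>t x. w p t x * frechet_derivative \<psi> (at (t, x)) (1, c *\<^sub>R dir p))
      + int_T3 (\<lambda>x. \<psi> (0, x) * w0 p x) + int_QT (\<lambda>t x. S p t x * \<psi> (t, x)) = 0"
    if \<psi>: "test_fun \<psi>" for p \<psi>
  proof -
    have lin: "linear (frechet_derivative \<psi> (at z))" for z
      using \<psi> by (intro has_derivative_linear[OF smooth_has_derivative]) (simp add: test_fun_def)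
    obtain i q where p: "p = (i, q)" by (cases p)
    show ?thesis
      using weak \<psi> unfolding weak_solution_def p
      by (cases q) (simp_all add: linear_transport_direction[OF lin] dt_def dx_def w_def w0_def S_def)
  qed
  interpret weak_transport c B b F T w uh S w0
  proof
    show "\<bar>b p x\<bar> \<le> B" for p x using b_bounds[of p x] B_ge(1) C(2) by simp
    show "\<bar>uh p s x\<bar> \<le> B" for p s x using uh_bounds[of p s x] B_ge(1) by simp
    show "w0 p \<in> borel_measurable (lebesgue_on T3)" for p unfolding w0_def by (rule data_meas)
  qed (fact c b_meas b_per F_meas F_per F_bound T(1) uh_meas uh_eq S_eq w_reg w0_eq weak_p)+
  have sol_nn: "AE x in torus. 0 \<le> sol p s x" if "0 \<le> s" "s \<le> T" for p s
    using weak_eq_mild[of s p] w_nonneg[OF that(1), of p] that by (auto elim: eventually_elim2)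
  have uh_sol: "AE s in itv 0 T. AE x in torus. \<forall>p. uh p s x = sol p s x"
  proof -
    have "AE s in itv 0 T. \<forall>p. AE x in torus. w p s x = uh p s x"
      by (rule eventually_all_index) (rule w_eq_uh)
    moreover have "AE s in itv 0 T. s \<in> {0..T}" by (rule AE_I2) simp
    ultimately show ?thesis
    proof eventually_elim
      case (elim s)
      show ?case
      proof (rule eventually_all_index)
        fix p
        have "AE x in torus. w p s x = uh p s x" using elim(1) by blast
        with weak_eq_mild[OF elim(2), of p] show "AE x in torus. uh p s x = sol p s x"
          by eventually_elim simp
      qed
    qed
  qed
  have mean_b: "(\<Sum>p\<in>UNIV. \<integral>x. b p x \<partial>torus) = 6 * m"
  proof -
    have bi: "integrable torus (b p)" for p
      by (rule torus_integrable_bounded[where B = M]) (use b_bounds in auto)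
    have "int_T3 (\<lambda>x. \<Sum>i\<in>UNIV. u0 i x + v0 i x) = (\<integral>x. (\<Sum>p\<in>UNIV. b p x) \<partial>torus)"
    proof (rule int_T3_eq)
      have "u0 i \<in> borel_measurable (lebesgue_on T3)" "v0 i \<in> borel_measurable (lebesgue_on T3)" for i
        using data_meas[of "(i, True)"] data_meas[of "(i, False)"] by simp_all
      then show "(\<lambda>x. \<Sum>i\<in>UNIV. u0 i x + v0 i x) \<in> borel_measurable (lebesgue_on T3)"
        by measurable
      show "AE x in torus. (\<Sum>i\<in>UNIV. u0 i x + v0 i x) = (\<Sum>p\<in>UNIV. b p x)"
        using eventually_all_index[of "\<lambda>p x. w0 p x = b p x", OF w0_eq]
      proof (rule eventually_mono)
        fix x assume "\<forall>p. w0 p x = b p x"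
        then have "b p x = w0 p x" for p by metis
        then show "(\<Sum>i\<in>UNIV. u0 i x + v0 i x) = (\<Sum>p\<in>UNIV. b p x)"
          by (simp add: sum_3_bool w0_def)
      qed
    qed measurable
    then show ?thesis using bi by (simp add: m)
  qed
  \<comment> \<open>The source was built from \<open>uh\<close>. Now that \<open>uh\<close> agrees
    with \<open>sol\<close> almost everywhere, the equation closes and acquires its relaxation
    structure.\<close>
  interpret mild_relaxation c B b F T M m \<kappa>
  proof
    show "\<kappa> s x \<le> B" for s x using \<kappa>_le_C[of s x] B_ge(2) by simp
    show "AE s in itv 0 T. AE x in torus. \<forall>p. F p s x = \<kappa> s x * (\<Sum>q\<in>UNIV. sol q s x - sol p s x)"
      using uh_sol
    proof (rule eventually_mono)
      fix s assume "AE x in torus. \<forall>p. uh p s x = sol p s x"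
      then show "AE x in torus. \<forall>p. F p s x = \<kappa> s x * (\<Sum>q\<in>UNIV. sol q s x - sol p s x)"
      proof (rule eventually_mono)
        fix x assume "\<forall>p. uh p s x = sol p s x"
        then have "uh p s x = sol p s x" for p by blast
        then show "\<forall>p. F p s x = \<kappa> s x * (\<Sum>q\<in>UNIV. sol q s x - sol p s x)"
          unfolding F_def by (simp add: sum_subtractf)
      qed
    qed
  qed (fact \<kappa>_meas \<kappa>_nonneg b_bounds(2) mean_b)+
  have range: "AE s in itv 0 T. AE x in torus. \<forall>p. uh p s x = sol p s x \<and> 0 \<le> sol p s x \<and> sol p s x \<le> M"
  proof -
    have "AE s in itv 0 T. 0 \<le> s \<and> s \<le> T" by (rule AE_I2) simp
    with uh_sol show ?thesis
    proof eventually_elim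
      case (elim s)
      have "AE x in torus. \<forall>p. 0 \<le> sol p s x \<and> sol p s x \<le> M"
      proof (rule eventually_all_index)
        fix p
        show "AE x in torus. 0 \<le> sol p s x \<and> sol p s x \<le> M"
          using sol_nn[of s p] max_principle[of s p] elim(2) by (auto elim: eventually_elim2)
      qed
      with elim(1) show ?case by eventually_elim blast
    qed
  qed
  \<comment> \<open>With the range \<open>[0, M]\<close> established, \<open>\<kappa>1 M\<close>
    replaces the crude \<open>\<kappa>1 C\<close>; the decay constant thereby sees neither
    \<open>C\<close> nor the horizon.\<close>
  interpret mild_decay c B b F T M m \<kappa> "\<kappa>1 M" "?\<beta>"
  proof
    show "0 \<le> \<kappa>1 M" using \<kappa>1_pos[OF M_pos] by simp
    show "0 \<le> ?\<beta>" using e_pos by simp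
    show "AE s in itv 0 T. AE x in torus. \<kappa> s x \<le> \<kappa>1 M"
      using range
    proof (rule eventually_mono)
      fix s assume "AE x in torus. \<forall>p. uh p s x = sol p s x \<and> 0 \<le> sol p s x \<and> sol p s x \<le> M"
      then show "AE x in torus. \<kappa> s x \<le> \<kappa>1 M"
      proof (rule eventually_mono)
        fix x assume "\<forall>p. uh p s x = sol p s x \<and> 0 \<le> sol p s x \<and> sol p s x \<le> M"
        then show "\<kappa> s x \<le> \<kappa>1 M"
          unfolding \<kappa>_def by (intro k_le[OF M_pos]) simp
      qed
    qed
    have e_le: "AE x in torus. ess_inf_T3 k1 \<le> k1 (wrap x)"
    proof -
      have "AE x in torus. x \<in> unit_cell" by (rule AE_I2) simp
      with ess_inf_T3_AE[OF k1] show ?thesis by eventually_elim (simp add: wrap_unit_cell)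
    qed
    show "AE s in itv 0 T. AE x in torus. \<forall>p q. ((sol p s x)\<^sup>2 - (sol q s x)\<^sup>2)\<^sup>2
        \<le> ?\<beta> * (\<kappa> s x * (sol p s x - sol q s x)\<^sup>2)"
      using range
    proof (rule eventually_mono)
      fix s assume "AE x in torus. \<forall>p. uh p s x = sol p s x \<and> 0 \<le> sol p s x \<and> sol p s x \<le> M"
      with e_le show "AE x in torus. \<forall>p q. ((sol p s x)\<^sup>2 - (sol q s x)\<^sup>2)\<^sup>2
          \<le> ?\<beta> * (\<kappa> s x * (sol p s x - sol q s x)\<^sup>2)"
      proof eventually_elim
        case (elim x)
        have uh: "uh p s x = sol p s x" and nn: "0 \<le> sol p s x" and le: "sol p s x \<le> M" for p
          using elim(2) by blast+
        have "wrap x \<in> T3" using wrap_in_unit_cell unit_cell_bounds(2) by (auto simp: T3_eq_cbox)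
        then have "k1 (wrap x) * rpow ((\<Sum>i\<in>UNIV. (\<chi> i. uh (i, True) s x) $ i) + (\<Sum>i\<in>UNIV. (\<chi> i. uh (i, False) s x) $ i)) \<alpha> \<le> \<kappa> s x"
          unfolding \<kappa>_def by (rule lower) (simp add: uh_bounds)
        then have "k1 (wrap x) * rpow (\<Sum>p\<in>UNIV. sol p s x) \<alpha> \<le> \<kappa> s x"
          by (simp add: sum_3_bool sum.distrib uh)
        moreover have "ess_inf_T3 k1 * rpow (\<Sum>p\<in>UNIV. sol p s x) \<alpha> \<le> k1 (wrap x) * rpow (\<Sum>p\<in>UNIV. sol p s x) \<alpha>"
          by (rule mult_right_mono[OF elim(1)]) (simp add: rpow_def)
        ultimately show ?case
          by (intro allI square_gap_le nn le \<alpha> e_pos) linarith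
      qed
    qed
  qed (fact m_pos M_pos sol_nn)+
  have e_t: "energy (\<lambda>i. u i t) (\<lambda>i. v i t) m = energy_at t"
    unfolding energy_at_def
  proof (rule energy_eq[where R = "B + B * T"])
    have reg: "sol_regular (u i)" "sol_regular (v i)" for i
      using w_reg[of "(i, True)"] w_reg[of "(i, False)"] by (simp_all add: w_def)
    show "u i t \<in> borel_measurable (lebesgue_on T3)" "v i t \<in> borel_measurable (lebesgue_on T3)" for i
      by (rule sol_regular_measurable[OF reg(1) t], rule sol_regular_measurable[OF reg(2) t])
    show "AE x in torus. u i t x = sol (i, True) t x" "AE x in torus. v i t x = sol (i, False) t x" for i
      using weak_eq_mild[of t "(i, True)"] weak_eq_mild[of t "(i, False)"] t T by (simp_all add: w_def)
    show "\<bar>sol p t x\<bar> \<le> B + B * T" for p x by (rule sol_bound[OF t T(2)])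
  qed measurable
  have e_0: "energy u0 v0 m = energy_at 0"
    unfolding energy_at_def
  proof (rule energy_eq[where R = "B + B * T"])
    show "u0 i \<in> borel_measurable (lebesgue_on T3)" "v0 i \<in> borel_measurable (lebesgue_on T3)" for i
      using data_meas[of "(i, True)"] data_meas[of "(i, False)"] by simp_all
    show "AE x in torus. u0 i x = sol (i, True) 0 x" "AE x in torus. v0 i x = sol (i, False) 0 x" for i
      using w0_eq[of "(i, True)"] w0_eq[of "(i, False)"] by (simp_all add: w0_def sol_0)
    show "\<bar>sol p 0 x\<bar> \<le> B + B * T" for p x using T by (intro sol_bound) auto
  qed measurable
  show ?thesis
    unfolding e_t e_0 decay_constant_def by (rule energy_decay[OF t T(2)])
qed

theorem theorem2p7:
  "\<exists>(\<Lambda> :: real \<Rightarrow> real \<Rightarrow> real \<Rightarrow> real)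
     (lam :: real \<Rightarrow> real \<Rightarrow> real \<Rightarrow> real \<Rightarrow> real \<Rightarrow> real \<Rightarrow> real).
     (\<forall>M m c. 0 < \<Lambda> M m c) \<and> (\<forall>M m c \<alpha> e K. 0 < lam M m c \<alpha> e K) \<and>
     (\<forall>c k \<kappa>1 k1 \<alpha> u0 v0 u v.
        0 < c \<longrightarrow>
        interaction_rate k \<longrightarrow> type1_with k \<kappa>1 \<longrightarrow>
        0 \<le> \<alpha> \<longrightarrow> \<alpha> \<le> 1 \<longrightarrow>
        Linf_fun_T3 k1 \<longrightarrow> 0 < ess_inf_T3 k1 \<longrightarrow>
        (\<forall>a b x. x \<in> T3 \<longrightarrow> (\<forall>i. 0 \<le> a$i \<and> 0 \<le> b$i) \<longrightarrow>
            k1 x * rpow ((\<Sum>i\<in>UNIV. a$i) + (\<Sum>i\<in>UNIV. b$i)) \<alpha> \<le> k a b x) \<longrightarrow>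
        (\<forall>i. Linf_fun_T3 (u0 i) \<and> Linf_fun_T3 (v0 i) \<and>
             (AE x in lebesgue_on T3. 0 \<le> u0 i x \<and> 0 \<le> v0 i x)) \<longrightarrow>
        (let M = Max (range (\<lambda>i. Linf_T3 (u0 i)) \<union> range (\<lambda>i. Linf_T3 (v0 i)));
             m = (1/6) * int_T3 (\<lambda>x. \<Sum>i\<in>UNIV. u0 i x + v0 i x)
         in 0 < m \<longrightarrow> weak_solution c k u0 v0 u v \<longrightarrow>
            (\<forall>t\<ge>0. energy (\<lambda>i. u i t) (\<lambda>i. v i t) m
               \<le> \<Lambda> M m c * exp (- 2 * lam M m c \<alpha> (ess_inf_T3 k1) (\<kappa>1 M) * t)
                 * energy u0 v0 m)))"
proof -
  \<comment> \<open>Positivity is demanded for all arguments, hence the default value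
    \<open>1\<close> outside the relevant range. The division by 2 matches the factor 2 in the
    exponent of the claim.\<close>
  define lam where "lam M m c \<alpha> e K =
    (if 0 < c \<and> 0 < e \<and> 0 < K then c / (1 + decay_constant M m c \<alpha> e K) / 2 else 1)" for M m c \<alpha> e K
  have dc: "0 \<le> decay_constant M m c \<alpha> e K" if "0 < c" "0 < e" "0 < K" for M m c \<alpha> e K
    using that by (simp add: decay_constant_def)
  have lam_pos: "0 < lam M m c \<alpha> e K" for M m c \<alpha> e K
    using dc[of c e K M m \<alpha>] by (auto simp: lam_def intro!: divide_pos_pos add_pos_nonneg)
  show ?thesis
  proof (rule exI[of _ "\<lambda>M m c. exp 1"], rule exI[of _ lam], intro conjI allI impI lam_pos)
    fix c :: real and k :: "real^3 \<Rightarrow> real^3 \<Rightarrow> real^3 \<Rightarrow> real" and \<kappa>1 k1 and \<alpha> :: real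
      and u0 v0 :: "3 \<Rightarrow> real^3 \<Rightarrow> real" and u v :: "3 \<Rightarrow> real \<Rightarrow> real^3 \<Rightarrow> real"
    assume c: "0 < c" and rate: "interaction_rate k" and type1: "type1_with k \<kappa>1"
      and \<alpha>: "0 \<le> \<alpha>" "\<alpha> \<le> 1" and k1: "Linf_fun_T3 k1" and e_pos: "0 < ess_inf_T3 k1"
      and lower: "\<forall>a b x. x \<in> T3 \<longrightarrow> (\<forall>i. 0 \<le> a$i \<and> 0 \<le> b$i) \<longrightarrow>
            k1 x * rpow ((\<Sum>i\<in>UNIV. a$i) + (\<Sum>i\<in>UNIV. b$i)) \<alpha> \<le> k a b x"
      and data: "\<forall>i. Linf_fun_T3 (u0 i) \<and> Linf_fun_T3 (v0 i) \<and>
             (AE x in lebesgue_on T3. 0 \<le> u0 i x \<and> 0 \<le> v0 i x)"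
    define M where "M = Max (range (\<lambda>i. Linf_T3 (u0 i)) \<union> range (\<lambda>i. Linf_T3 (v0 i)))"
    define m where "m = (1/6) * int_T3 (\<lambda>x. \<Sum>i\<in>UNIV. u0 i x + v0 i x)"
    have data_meas: "pack u0 v0 p \<in> borel_measurable (lebesgue_on T3)" for p
      by (rule pack_cases[where P = "\<lambda>f. f \<in> borel_measurable (lebesgue_on T3)"])
        (use data in \<open>auto simp: Linf_fun_T3_def\<close>)
    have data_bounds: "AE x in torus. 0 \<le> pack u0 v0 p x \<and> pack u0 v0 p x \<le> M" for p
    proof -
      have nn: "AE x in torus. 0 \<le> u0 i x \<and> 0 \<le> v0 i x" for i
        using data by (simp add: AE_T3_iff)
      have "Linf_T3 (u0 i) \<le> M" "Linf_T3 (v0 i) \<le> M" for i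
        unfolding M_def by (auto intro!: Max_ge)
      note M_ge = this
      have "AE x in torus. 0 \<le> u0 i x \<and> u0 i x \<le> M" for i
      proof -
        have "AE x in torus. \<bar>u0 i x\<bar> \<le> Linf_T3 (u0 i)" using data by (intro Linf_T3_AE) simp
        with nn[of i] show ?thesis by eventually_elim (use M_ge(1)[of i] in linarith)
      qed
      moreover have "AE x in torus. 0 \<le> v0 i x \<and> v0 i x \<le> M" for i
      proof -
        have "AE x in torus. \<bar>v0 i x\<bar> \<le> Linf_T3 (v0 i)" using data by (intro Linf_T3_AE) simp
        with nn[of i] show ?thesis by eventually_elim (use M_ge(2)[of i] in linarith)
      qed
      ultimately show ?thesis by (intro pack_cases[where P = "\<lambda>f. AE x in torus. 0 \<le> f x \<and> f x \<le> M"])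
    qed
    have "energy (\<lambda>i. u i t) (\<lambda>i. v i t) m
        \<le> exp 1 * exp (- 2 * lam M m c \<alpha> (ess_inf_T3 k1) (\<kappa>1 M) * t) * energy u0 v0 m"
      if m_pos: "0 < m" and weak: "weak_solution c k u0 v0 u v" and t: "0 \<le> t" for t
    proof -
      \<comment> \<open>Otherwise the data would vanish almost everywhere and the mean would be
        zero. Positivity matters because the type 1 condition speaks of positive
        \<open>\<gamma>\<close> only.\<close>
      have M_pos: "0 < M"
      proof (rule ccontr)
        assume "\<not> 0 < M"
        then have "AE x in torus. pack u0 v0 p x = 0" for p
          using data_bounds[of p] by (auto elim: eventually_mono)
        then have "AE x in torus. \<forall>p. pack u0 v0 p x = 0" by (rule eventually_all_index)
        then have zero: "AE x in torus. (\<Sum>i\<in>UNIV. u0 i x + v0 i x) = 0"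
        proof (rule eventually_mono)
          fix x assume "\<forall>p. pack u0 v0 p x = 0"
          then have "u0 i x = 0" "v0 i x = 0" for i
            using pack_simps(1)[of u0 v0 i] pack_simps(2)[of u0 v0 i] by metis+
          then show "(\<Sum>i\<in>UNIV. u0 i x + v0 i x) = 0" by simp
        qed
        have "u0 i \<in> borel_measurable (lebesgue_on T3)" "v0 i \<in> borel_measurable (lebesgue_on T3)" for i
          using data_meas[of "(i, True)"] data_meas[of "(i, False)"] by simp_all
        then have "int_T3 (\<lambda>x. \<Sum>i\<in>UNIV. u0 i x + v0 i x) = (\<integral>x. 0 \<partial>(torus :: (real^3) measure))"
          by (intro int_T3_eq zero borel_measurable_sum borel_measurable_add) auto
        then show False using m_pos by (simp add: m_def)
      qed
      have \<kappa>1: "0 < \<kappa>1 M" using type1 M_pos by (simp add: type1_with_def)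
      have "- (t / (1 / c * (1 + decay_constant M m c \<alpha> (ess_inf_T3 k1) (\<kappa>1 M))))
          = - 2 * lam M m c \<alpha> (ess_inf_T3 k1) (\<kappa>1 M) * t"
      proof -
        have "- (t / (1 / c * D)) = - 2 * (c / D / 2) * t" for D by simp
        then show ?thesis using c e_pos \<kappa>1 by (simp only: lam_def simp_thms if_True)
      qed
      moreover have "energy (\<lambda>i. u i t) (\<lambda>i. v i t) m
        \<le> exp 1 * exp (- (t / (1 / c * (1 + decay_constant M m c \<alpha> (ess_inf_T3 k1) (\<kappa>1 M))))) * energy u0 v0 m"
        by (rule energy_decay_weak[OF c rate type1 \<alpha> k1 e_pos _ data_meas data_bounds m_def m_pos M_pos weak t])
          (use lower in blast)
      ultimately show ?thesis by simp
    qed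
    then show "let M = Max (range (\<lambda>i. Linf_T3 (u0 i)) \<union> range (\<lambda>i. Linf_T3 (v0 i)));
             m = (1/6) * int_T3 (\<lambda>x. \<Sum>i\<in>UNIV. u0 i x + v0 i x)
         in 0 < m \<longrightarrow> weak_solution c k u0 v0 u v \<longrightarrow>
            (\<forall>t\<ge>0. energy (\<lambda>i. u i t) (\<lambda>i. v i t) m
               \<le> exp 1 * exp (- 2 * lam M m c \<alpha> (ess_inf_T3 k1) (\<kappa>1 M) * t)
                 * energy u0 v0 m)"
      unfolding Let_def M_def[symmetric] m_def[symmetric] by blast
  qed simp
qed

end
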